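(* Let $W_5$ be the wheel graph with $6$ vertices (a $5$-cycle together with a hub adjacent to all five vertices of the cycle). Let $A$ be a symmetric matrix over $\mathbb{Z}_2$ with $\det A=1$ which coincides with the adjacency matrix of $W_5$ off the diagonal (such $A$ exists), and let $G$ be the framed simple graph whose matrix $A(G)$ equals $A^{-1}+E$. Then the free graph-knot represented by $G$ is minimal: no framed simple graph representing it has fewer than $6$ vertices. In particular, it is non-trivial (it is not represented by the empty graph). Moreover, no framed simple graph representing this free graph-knot is realisable as an intersection graph of a chord diagram.
   Context: All graphs are finite. A framed simple graph is a simple graph $G$ (the empty graph is allowed) each of whose vertices carries a framing in $\{0,1\}$. $A(G)$ is the symmetric matrix over $\mathbb{Z}_2$ with $a_{ii}$ the framing of $v_i$ and, for $i\ne j$, $a_{ij}=1$ iff $v_i,v_j$ are adjacent; $E$ is the identity matrix. $N(v)$ is the set of neighbours of $v$. The local complementation $\operatorname{LC}(G;v)$ toggles adjacency of every pair $a\ne b$ in $N(v)$. The pivot $\operatorname{piv}(G;u,v)$ toggles adjacency of every pair $x,y\notin\{u,v\}$ with $x\in N(u)$, $y\in N(v)$ and ($x\notin N(v)$ or $y\notin N(u)$). Moves. $\Omega_g1$: add/remove an isolated vertex of framing $0$. $\Omega_g2$: add/remove two non-adjacent vertices both of framing $0$, or two adjacent vertices both of framing $1$, having the same adjacencies with all other vertices. $\Omega_g3$: if $u,v,w$ are distinct vertices of framing $0$ and $u$ is adjacent exactly to $v$ and $w$, change the adjacency of $u$ with each $t\in (N(v)\setminus N(w))\cup(N(w)\setminus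 N(v))$; also the inverse operation. $\Omega_g4$: for adjacent $u,v$ both of framing $0$, replace $G$ by $\operatorname{piv}(G;u,v)$. $\Omega_g4'$: for $v$ of framing $1$, replace $G$ by $\operatorname{LC}(G;v)$ and change the framing of each vertex of $N(v)$. A free graph-link is an equivalence class of framed simple graphs (up to framing-preserving isomorphism) under the moves $\Omega_g1$–$\Omega_g4'$; it is a free graph-knot if $\operatorname{corank}_{\mathbb{Z}_2}(A(G)+E)=0$ for its representatives $G$ (this number is invariant under the moves). The graph $W_5$ is regarded as the "Gauss-diagram type" (looped interlacement) graph of the free graph-knot; the passage $A\mapsto A^{-1}+E$ gives the corresponding framed graph, and the resulting free graph-knot does not depend on the choice of the diagonal of $A$. A chord diagram is a circle with finitely many chords with pairwise distinct endpoints; two chords are linked if the endpoints of one lie in different components of the circle minus the endpoints of the other. The intersection graph of a chord diagram has the chords as vertices, two being adjacent iff the chords are linked. A framed simple graph is realisable if its underlying simple graph is the intersection graph of a chord diagram.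
   Formalization: In Ω_g3 the adjacency of u with v and w is changed as well as with each t in (N(v)∖N(w))∪(N(w)∖N(v)), so that this set becomes N(u); as worded, the move does not preserve corank(A(G)+E) (path w-u-v-t, all framings 0: 0 becomes 1). *)

theory Defs
  imports
    "HOL-Analysis.Elementary_Metric_Spaces"
    "HOL-Analysis.Connected"
    "HOL-Library.Z2"
    "Jordan_Normal_Form.Determinant"
    "Jordan_Normal_Form.DL_Rank"
begin

section \<open>Framed simple graphs\<close>

text \<open>Vertices are natural numbers. This is no loss of generality, since graphs are finite and only
  matter up to isomorphism, and it always leaves fresh vertices to be added. The values of the framing
  outside the vertex set are irrelevant: they are ignored by every notion that follows.\<close>

record framed_graph =
  verts :: "nat set"
  adj :: "nat \<Rightarrow> nat \<Rightarrow> bool"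
  framing :: "nat \<Rightarrow> bit"

definition framed_simple_graph :: "framed_graph \<Rightarrow> bool" where
  "framed_simple_graph G \<longleftrightarrow>
     finite (verts G) \<and>
     (\<forall>u v. adj G u v \<longrightarrow> u \<in> verts G \<and> v \<in> verts G) \<and>
     (\<forall>u v. adj G u v \<longrightarrow> adj G v u) \<and>
     (\<forall>u. \<not> adj G u u)"

definition empty_graph :: framed_graph where
  "empty_graph = \<lparr>verts = {}, adj = (\<lambda>_ _. False), framing = (\<lambda>_. 0)\<rparr>"

definition nbrs :: "framed_graph \<Rightarrow> nat \<Rightarrow> nat set" where
  "nbrs G v = {u. adj G v u}"

definition graph_iso :: "framed_graph \<Rightarrow> framed_graph \<Rightarrow> bool" where
  "graph_iso G H \<longleftrightarrow>
     (\<exists>f. bij_betw f (verts G) (verts H) \<and>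
          (\<forall>u\<in>verts G. \<forall>v\<in>verts G. adj H (f u) (f v) \<longleftrightarrow> adj G u v) \<and>
          (\<forall>v\<in>verts G. framing H (f v) = framing G v))"

text \<open>The vertices are enumerated in increasing order; another enumeration would only permute rows
  and columns simultaneously.\<close>

definition adj_matrix :: "framed_graph \<Rightarrow> bit mat" where
  "adj_matrix G =
     (let n = card (verts G); vs = sorted_list_of_set (verts G)
      in mat n n (\<lambda>(i, j). if i = j then framing G (vs ! i) else of_bool (adj G (vs ! i) (vs ! j))))"

definition corank :: "bit mat \<Rightarrow> nat" where
  "corank M = dim_row M - vec_space.rank (dim_row M) M"


section \<open>Moves\<close>

definition delete_verts :: "framed_graph \<Rightarrow> nat set \<Rightarrow> framed_graph" where
  "delete_verts G X =
     G\<lparr>verts := verts G - X, adj := (\<lambda>u v. adj G u v \<and> u \<notin> X \<and> v \<notin> X)\<rparr>"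

definition toggle_adj :: "framed_graph \<Rightarrow> (nat \<Rightarrow> nat \<Rightarrow> bool) \<Rightarrow> framed_graph" where
  "toggle_adj G P = G\<lparr>adj := (\<lambda>u v. adj G u v \<noteq> P u v)\<rparr>"

definition local_compl :: "framed_graph \<Rightarrow> nat \<Rightarrow> framed_graph" where
  "local_compl G v = toggle_adj G (\<lambda>a b. a \<noteq> b \<and> a \<in> nbrs G v \<and> b \<in> nbrs G v)"

text \<open>The condition on a pair of vertices is imposed on the unordered pair, i.e. for one of its two
  orders.\<close>

definition pivot :: "framed_graph \<Rightarrow> nat \<Rightarrow> nat \<Rightarrow> framed_graph" where
  "pivot G u v =
     (let C = (\<lambda>x y. x \<notin> {u, v} \<and> y \<notin> {u, v} \<and> x \<in> nbrs G u \<and> y \<in> nbrs G v \<and>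
                      (x \<notin> nbrs G v \<or> y \<notin> nbrs G u))
      in toggle_adj G (\<lambda>x y. C x y \<or> C y x))"

definition flip_framing :: "framed_graph \<Rightarrow> nat set \<Rightarrow> framed_graph" where
  "flip_framing G X = G\<lparr>framing := (\<lambda>x. if x \<in> X then framing G x + 1 else framing G x)\<rparr>"

definition set_nbrs :: "framed_graph \<Rightarrow> nat \<Rightarrow> nat set \<Rightarrow> framed_graph" where
  "set_nbrs G u T =
     G\<lparr>adj := (\<lambda>x y. if x = u then y \<in> T else if y = u then x \<in> T else adj G x y)\<rparr>"

text \<open>Each move is given in one direction; the inverse moves come in with the symmetric closure below.

  In the third move the neighbourhood \<open>{v, w}\<close> of \<open>u\<close> is changed to the symmetric difference \<open>D\<close> of the
  neighbourhoods of \<open>v\<close> and \<open>w\<close>. Note that \<open>D\<close> contains \<open>v\<close> and \<open>w\<close> if these are adjacent, and neither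
  of them otherwise. Toggling \<open>D\<close> on top of \<open>{v, w}\<close> would be a different operation, and not the third
  Reidemeister move: on the path \<open>w - u - v - t\<close> with all framings 0 it would add the edge \<open>u - t\<close>, and
  the corank of \<open>A(G) + E\<close> would jump from 0 to 1.\<close>

inductive graph_move :: "framed_graph \<Rightarrow> framed_graph \<Rightarrow> bool" where
  Omega1: "v \<in> verts G \<Longrightarrow> framing G v = 0 \<Longrightarrow> nbrs G v = {} \<Longrightarrow>
    graph_move G (delete_verts G {v})"
| Omega2: "u \<in> verts G \<Longrightarrow> v \<in> verts G \<Longrightarrow> u \<noteq> v \<Longrightarrow>
    (\<not> adj G u v \<and> framing G u = 0 \<and> framing G v = 0) \<or>
    (adj G u v \<and> framing G u = 1 \<and> framing G v = 1) \<Longrightarrow>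
    (\<And>t. t \<in> verts G - {u, v} \<Longrightarrow> adj G u t \<longleftrightarrow> adj G v t) \<Longrightarrow>
    graph_move G (delete_verts G {u, v})"
| Omega3: "u \<in> verts G \<Longrightarrow> v \<in> verts G \<Longrightarrow> w \<in> verts G \<Longrightarrow> distinct [u, v, w] \<Longrightarrow>
    framing G u = 0 \<Longrightarrow> framing G v = 0 \<Longrightarrow> framing G w = 0 \<Longrightarrow>
    nbrs G u = {v, w} \<Longrightarrow>
    graph_move G (set_nbrs G u ((nbrs G v - nbrs G w) \<union> (nbrs G w - nbrs G v)))"
| Omega4: "u \<in> verts G \<Longrightarrow> v \<in> verts G \<Longrightarrow> adj G u v \<Longrightarrow> framing G u = 0 \<Longrightarrow> framing G v = 0 \<Longrightarrow>
    graph_move G (pivot G u v)"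
| Omega4': "v \<in> verts G \<Longrightarrow> framing G v = 1 \<Longrightarrow>
    graph_move G (flip_framing (local_compl G v) (nbrs G v))"


section \<open>Free graph-links and free graph-knots\<close>

definition elementary_equiv :: "framed_graph \<Rightarrow> framed_graph \<Rightarrow> bool" where
  "elementary_equiv G H \<longleftrightarrow>
     framed_simple_graph G \<and> framed_simple_graph H \<and> (graph_iso G H \<or> graph_move G H)"

definition free_graph_link :: "framed_graph \<Rightarrow> framed_graph set" where
  "free_graph_link G = {H. framed_simple_graph H \<and> equivclp elementary_equiv G H}"

definition free_graph_knot :: "framed_graph set \<Rightarrow> bool" where
  "free_graph_knot L \<longleftrightarrow>
     (\<exists>G. framed_simple_graph G \<and> L = free_graph_link G) \<and>
     (\<forall>H\<in>L. corank (adj_matrix H + 1\<^sub>m (card (verts H))) = 0)"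


section \<open>Chord diagrams\<close>

text \<open>A chord is the set of its two endpoints on the unit circle.\<close>

definition chord_diagram :: "complex set set \<Rightarrow> bool" where
  "chord_diagram D \<longleftrightarrow>
     finite D \<and> (\<forall>c\<in>D. c \<subseteq> sphere 0 1 \<and> card c = 2) \<and> disjoint D"

definition linked :: "complex set \<Rightarrow> complex set \<Rightarrow> bool" where
  "linked c d \<longleftrightarrow> (\<exists>p q. d = {p, q} \<and> \<not> connected_component (sphere 0 1 - c) p q)"

definition realisable :: "framed_graph \<Rightarrow> bool" where
  "realisable G \<longleftrightarrow>
     (\<exists>D f. chord_diagram D \<and> bij_betw f (verts G) D \<and>
            (\<forall>u\<in>verts G. \<forall>v\<in>verts G. u \<noteq> v \<longrightarrow> (adj G u v \<longleftrightarrow> linked (f u) (f v))))"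


section \<open>The wheel with six vertices\<close>

text \<open>The rim is the cycle \<open>0, 1, 2, 3, 4\<close>, the hub is 5.\<close>

definition W5 :: framed_graph where
  "W5 = \<lparr>verts = {0..<6},
         adj = (\<lambda>i j. i < 5 \<and> j < 5 \<and> (j = (i + 1) mod 5 \<or> i = (j + 1) mod 5) \<or>
                      i < 5 \<and> j = 5 \<or> i = 5 \<and> j < 5),
         framing = (\<lambda>_. 0)\<rparr>"

definition W5_matrix :: "bit mat \<Rightarrow> bool" where
  "W5_matrix A \<longleftrightarrow>
     A \<in> carrier_mat 6 6 \<and> transpose_mat A = A \<and> det A = 1 \<and>
     (\<forall>i<6. \<forall>j<6. i \<noteq> j \<longrightarrow> A $$ (i, j) = adj_matrix W5 $$ (i, j))"

end

theory Submission
  imports Defs "HOL-Analysis.Complex_Transcendental" "HOL-Combinatorics.Transposition"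
begin

text \<open>
  A framed graph \<open>G\<close> is encoded by the space of all vectors \<open>(X, A(G) X)\<close>. The entry of such a vector at
  a vertex lies in \<open>K = \<int>\<^sub>2 \<times> \<int>\<^sub>2\<close>, and the space is a maximal isotropic subspace for the sum of the
  alternating forms of the copies of \<open>K\<close>: an isotropic system in the sense of Bouchet. At each vertex the three non-zero
  elements of \<open>K\<close> play the role of the three ways to pass a crossing of a framed 4-valent graph:
  \<open>ds\<close> goes straight ahead, \<open>da\<close> and \<open>db\<close> are the two smoothings. Choose a direction \<open>p v\<close> at each
  vertex. The choice is transversal if no non-zero vector of the space has all its entries \<open>v\<close> in
  \<open>{0, p v}\<close>; geometrically, the choice connects everything into one circuit. A transversal choice
  presents the space by another symmetric matrix, and \<open>fund\<close> is the graph of its off-diagonal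
  entries. For the constant choice \<open>db\<close> this graph is \<open>G\<close>. The constant choice \<open>ds\<close> is transversal
  iff \<open>A(G) + E\<close> is invertible, and then the graph is that of \<open>(A(G) + E)\<^sup>-\<^sup>1\<close>, the Gauss diagram.
  For the graph of the theorem it is \<open>W5\<close>.

  On the space, the five moves become very simple operations: exchange \<open>da\<close> and \<open>db\<close> at a vertex,
  rename vertices, or one of the three Reidemeister moves, each of which is governed by one vector of
  the space that is supported on the one, two or three vertices of the move.

  The invariant is Manturov's parity bracket. A vertex is even if its degree in the Gauss diagram is
  even. A state smooths every even vertex in one of the two ways and keeps the odd vertices. The
  bracket counts, modulo 2, the transversal states for which the graph on the odd vertices becomes
  \<open>W5\<close> after deletion of pairs of twins (the trace of second moves). It is invariant because the
  states that differ only at the vertices of a move cancel in pairs, or correspond to the states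
  after the move (\<open>equivclp_same\<close>). All degrees of \<open>W5\<close> are odd and \<open>W5\<close> has no twins, so it has a
  single state and a non-zero bracket (\<open>wheel_bracket\<close>).

  Hence each graph \<open>H\<close> in the class has a transversal choice of directions whose graph contains \<open>W5\<close>
  as an induced subgraph (\<open>bracket_imp_W5_minor\<close>). So \<open>H\<close> has at least six vertices. Moreover, any two
  transversal choices are connected by changes at single vertices, and such a change is a local
  complementation of the graph. Local complementation preserves circle graphs: reflect one of the
  two arcs cut off by the chord. So if \<open>H\<close> were the intersection graph of a chord diagram then \<open>W5\<close>
  would be one too. It is not: the hub would present the rim, a pentagon, as the graph of a
  permutation, and the complement of a pentagon would be transitively orientable.
\<close>

text \<open>By default, sums and products of bits are rewritten to logical operations, which would hide the
  linear algebra over the field with two elements.\<close>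

declare add_bit_eq_xor [simp del] mult_bit_eq_and [simp del]

section \<open>Directions at a vertex\<close>

definition sform :: "bit \<times> bit \<Rightarrow> bit \<times> bit \<Rightarrow> bit" where
  "sform a b = fst a * snd b + snd a * fst b"

abbreviation da :: "bit \<times> bit" where "da \<equiv> (1, 0)"
abbreviation db :: "bit \<times> bit" where "db \<equiv> (0, 1)"
abbreviation ds :: "bit \<times> bit" where "ds \<equiv> (1, 1)"

lemma dir_cases:
  fixes k :: "bit \<times> bit"
  obtains "k = 0" | "k = da" | "k = db" | "k = ds"
proof (cases k)
  case (Pair x y)
  then show ?thesis using that by (cases x; cases y) (auto simp: zero_prod_def)
qed

lemma sform_simps [simp]:
  "sform 0 a = 0" "sform a 0 = 0" "sform a a = 0"
  "sform (a + b) c = sform a c + sform b c"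
  "sform c (a + b) = sform c a + sform c b"
  by (auto simp: sform_def algebra_simps)

lemma dir_add [simp]:
  "da + db = ds" "da + ds = db" "db + da = ds" "db + ds = da" "ds + da = db" "ds + db = da"
  "a + a = (0 :: bit \<times> bit)"
  by (auto simp: zero_prod_def prod_eq_iff)

lemma dir_neq [simp]: "da \<noteq> 0" "db \<noteq> 0" "ds \<noteq> 0" "0 \<noteq> da" "0 \<noteq> db" "0 \<noteq> ds"
  by (auto simp: zero_prod_def)

lemma sform_concrete [simp]:
  "sform da db = 1" "sform db da = 1" "sform da ds = 1" "sform ds da = 1" "sform db ds = 1" "sform ds db = 1"
  by (auto simp: sform_def)

lemma dir_add_assoc [simp]: "a + (a + b) = (b :: bit \<times> bit)"
  by (simp flip: add.assoc)

lemma dir_add_eq_0 [simp]: "a + b = (0 :: bit \<times> bit) \<longleftrightarrow> a = b"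
  by (metis dir_add(7) dir_add_assoc add_0_right)

lemma sform_eq_0_iff: "p \<noteq> 0 \<Longrightarrow> sform a p = 0 \<longleftrightarrow> a = 0 \<or> a = p"
  by (cases a rule: dir_cases; cases p rule: dir_cases) auto

lemma dir_closed: "a = 0 \<or> a = p \<Longrightarrow> b = 0 \<or> b = p \<Longrightarrow> a + b = 0 \<or> a + b = (p :: bit \<times> bit)"
  by auto

text \<open>A quadratic refinement of the alternating form. It vanishes on both smoothings and is 1 on the
  straight direction. Its sum over the vertices is therefore linear on an isotropic space, and it counts
  the straight entries of a vector modulo 2.\<close>

definition quad :: "bit \<times> bit \<Rightarrow> bit" where "quad a = fst a * snd a"

lemma quad_simps [simp]: "quad 0 = 0" "quad da = 0" "quad db = 0" "quad ds = 1"
  by (auto simp: quad_def)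

lemma quad_add: "quad (a + b) = quad a + quad b + sform a b"
  by (simp add: quad_def sform_def algebra_simps)

section \<open>Isotropic systems and their fundamental graphs\<close>

lemma card_bit_functions:
  assumes "finite V" shows "card (PiE V (\<lambda>_. UNIV :: bit set)) = 2 ^ card V"
proof -
  have "x \<in> {0, 1}" for x :: bit by (cases x) auto
  then have "CARD(bit) = card {0, 1 :: bit}" by (intro arg_cong[where f = card] UNIV_eq_I[symmetric]) auto
  then have "CARD(bit) = 2" by simp
  then show ?thesis using assms by (simp add: card_PiE)
qed

text \<open>A vector aligned with \<open>p\<close> at a vertex is orthogonal to \<open>p\<close> there. The fundamental vector of \<open>i\<close>
  is the vector that violates this at \<open>i\<close> only; its support off \<open>i\<close> is the neighbourhood of \<open>i\<close> in the
  fundamental graph.\<close>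

definition aligned :: "(nat \<Rightarrow> bit \<times> bit) \<Rightarrow> nat set \<Rightarrow> (nat \<Rightarrow> bit \<times> bit) \<Rightarrow> bool" where
  "aligned p T x \<longleftrightarrow> (\<forall>v\<in>T. x v = 0 \<or> x v = p v)"

definition fundamental :: "(nat \<Rightarrow> bit \<times> bit) \<Rightarrow> nat set \<Rightarrow> nat \<Rightarrow> (nat \<Rightarrow> bit \<times> bit) \<Rightarrow> bool" where
  "fundamental p V i x \<longleftrightarrow> x i \<noteq> 0 \<and> x i \<noteq> p i \<and> aligned p (V - {i}) x"

definition transversal :: "nat set \<Rightarrow> (nat \<Rightarrow> bit \<times> bit) set \<Rightarrow> (nat \<Rightarrow> bit \<times> bit) \<Rightarrow> bool" where
  "transversal V L p \<longleftrightarrow> (\<forall>x\<in>L. aligned p V x \<longrightarrow> x = (\<lambda>_. 0))"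

definition fund :: "nat set \<Rightarrow> (nat \<Rightarrow> bit \<times> bit) set \<Rightarrow> (nat \<Rightarrow> bit \<times> bit) \<Rightarrow> nat \<Rightarrow> nat \<Rightarrow> bool" where
  "fund V L p i j \<longleftrightarrow> (\<exists>x\<in>L. fundamental p V i x \<and> x j \<noteq> 0)"

locale isotropic_system =
  fixes V :: "nat set" and L :: "(nat \<Rightarrow> bit \<times> bit) set"
  assumes fin: "finite V"
    and outside: "\<And>x v. x \<in> L \<Longrightarrow> v \<notin> V \<Longrightarrow> x v = 0"
    and zero: "(\<lambda>_. 0) \<in> L"
    and add: "\<And>x y. x \<in> L \<Longrightarrow> y \<in> L \<Longrightarrow> (\<lambda>v. x v + y v) \<in> L"
    and isotropic: "\<And>x y. x \<in> L \<Longrightarrow> y \<in> L \<Longrightarrow> (\<Sum>v\<in>V. sform (x v) (y v)) = 0"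
    and card_L: "card L = 2 ^ card V"
begin

text \<open>Pairing with \<open>p\<close> at each vertex is an injective map between finite sets of the same size, hence
  surjective.\<close>

lemma ex_dual:
  assumes t: "transversal V L p" and p: "\<And>v. p v \<noteq> 0"
  shows "\<exists>x\<in>L. \<forall>v\<in>V. sform (x v) (p v) = f v"
proof -
  let ?F = "\<lambda>x. restrict (\<lambda>v. sform (x v) (p v)) V"
  have inj: "inj_on ?F L"
  proof (rule inj_onI)
    fix x y assume xy: "x \<in> L" "y \<in> L" "?F x = ?F y"
    have "sform (x v + y v) (p v) = 0" if "v \<in> V" for v
      using fun_cong[OF xy(3), of v] that by (cases "sform (y v) (p v)") auto
    then have "aligned p V (\<lambda>v. x v + y v)"
      unfolding aligned_def using sform_eq_0_iff[OF p] by blast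
    then have "(\<lambda>v. x v + y v) = (\<lambda>_. 0)"
      using t add[OF xy(1,2)] unfolding transversal_def by blast
    then have "x v + y v = 0" for v by (rule fun_cong)
    then show "x = y" by (intro ext) (simp only: dir_add_eq_0)
  qed
  note cP = card_bit_functions[OF fin]
  have fP: "finite (PiE V (\<lambda>_. UNIV :: bit set))"
    using cP by (metis card.infinite power_not_zero zero_neq_numeral)
  have "?F ` L \<subseteq> PiE V (\<lambda>_. UNIV)" by auto
  moreover have "card (?F ` L) = card (PiE V (\<lambda>_. UNIV :: bit set))"
    using card_image[OF inj] card_L cP by simp
  ultimately have "?F ` L = PiE V (\<lambda>_. UNIV)" using fP by (simp add: card_subset_eq)
  moreover have "restrict f V \<in> PiE V (\<lambda>_. UNIV)" by auto
  ultimately obtain x where x: "x \<in> L" "restrict f V = ?F x" by blast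
  have "sform (x v) (p v) = f v" if "v \<in> V" for v using fun_cong[OF x(2), of v] that by simp
  then show ?thesis using x(1) by blast
qed

lemma ex_fundamental:
  assumes t: "transversal V L p" and p: "\<And>v. p v \<noteq> 0" and i: "i \<in> V"
  obtains x where "x \<in> L" "fundamental p V i x"
proof -
  from ex_dual[OF t p, where f="\<lambda>v. of_bool (v = i)"] obtain x
    where x: "x \<in> L" "\<forall>v\<in>V. sform (x v) (p v) = of_bool (v = i)" by blast
  have "x i \<noteq> 0 \<and> x i \<noteq> p i" using x(2) i sform_eq_0_iff[OF p, of "x i" i] by auto
  moreover have "aligned p (V - {i}) x"
    unfolding aligned_def
  proof
    fix v assume "v \<in> V - {i}"
    then have "sform (x v) (p v) = 0" using x(2) by auto
    then show "x v = 0 \<or> x v = p v" using sform_eq_0_iff[OF p] by blast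
  qed
  ultimately show ?thesis using that x unfolding fundamental_def by blast
qed

lemma transversal_zero:
  assumes "transversal V L p" "x \<in> L" "aligned p V x" shows "x = (\<lambda>_. 0)"
  using assms unfolding transversal_def by blast

lemma fundamental_eq_off:
  assumes t: "transversal V L p" and x: "x \<in> L" "fundamental p V i x"
    and y: "y \<in> L" "fundamental p V i y" and eq: "x i = y i \<or> x i + y i = p i"
  shows "x = y"
proof -
  have al: "aligned p V (\<lambda>v. x v + y v)"
    unfolding aligned_def
  proof
    fix v assume "v \<in> V"
    then show "x v + y v = 0 \<or> x v + y v = p v"
      using x(2) y(2) eq dir_closed[of "x v" "p v" "y v"] unfolding fundamental_def aligned_def
      by (cases "v = i") auto
  qed
  then have "(\<lambda>v. x v + y v) = (\<lambda>_. 0)" using transversal_zero[OF t add[OF x(1) y(1)]] by blast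
  then have "x v + y v = 0" for v by (rule fun_cong)
  then show ?thesis by (intro ext) (simp only: dir_add_eq_0)
qed

lemma third_direction_sum: "a \<noteq> 0 \<Longrightarrow> a \<noteq> p \<Longrightarrow> b \<noteq> 0 \<Longrightarrow> b \<noteq> p \<Longrightarrow> p \<noteq> 0 \<Longrightarrow> a = b \<or> a + b = (p :: bit \<times> bit)"
  by (cases a rule: dir_cases; cases b rule: dir_cases; cases p rule: dir_cases) auto

lemma fundamental_unique:
  assumes t: "transversal V L p" and p: "\<And>v. p v \<noteq> 0" and x: "x \<in> L" "fundamental p V i x"
    and y: "y \<in> L" "fundamental p V i y"
  shows "x = y"
  using fundamental_eq_off[OF t x y] third_direction_sum[of "x i" "p i" "y i"] x y p unfolding fundamental_def by blast

lemma fund_iff: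
  assumes "transversal V L p" and "\<And>v. p v \<noteq> 0" and "x \<in> L" "fundamental p V i x"
  shows "fund V L p i j \<longleftrightarrow> x j \<noteq> 0"
  using assms fundamental_unique unfolding fund_def by blast

lemma sum_pair:
  fixes f :: "nat \<Rightarrow> bit"
  assumes "i \<in> V" "j \<in> V" "i \<noteq> j" "\<And>v. v \<in> V \<Longrightarrow> v \<noteq> i \<Longrightarrow> v \<noteq> j \<Longrightarrow> f v = 0"
  shows "sum f V = f i + f j"
proof -
  have "sum f V = sum f {i, j}" using assms fin by (intro sum.mono_neutral_right) auto
  then show ?thesis using assms by simp
qed

lemma sform_aligned: "a = 0 \<or> a = p \<Longrightarrow> b = 0 \<or> b = p \<Longrightarrow> sform a b = 0"
  by auto

lemma sform_cross: "b \<noteq> 0 \<Longrightarrow> b \<noteq> p \<Longrightarrow> a = 0 \<or> a = p \<Longrightarrow> p \<noteq> 0 \<Longrightarrow> sform a b = 1 \<longleftrightarrow> a \<noteq> 0"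
  by (cases a rule: dir_cases; cases b rule: dir_cases; cases p rule: dir_cases) auto

lemma sform_commute: "sform a b = sform b a"
  by (simp add: sform_def algebra_simps)

text \<open>The fundamental vectors of \<open>i\<close> and \<open>j\<close> are orthogonal to each other, and only the vertices \<open>i\<close> and
  \<open>j\<close> contribute to their product.\<close>

lemma fund_sym:
  assumes t: "transversal V L p" and p: "\<And>v. p v \<noteq> 0" and ij: "i \<in> V" "j \<in> V" "i \<noteq> j"
  shows "fund V L p i j \<longleftrightarrow> fund V L p j i"
proof -
  obtain x where x: "x \<in> L" "fundamental p V i x" using ex_fundamental[OF t p ij(1)] by blast
  obtain y where y: "y \<in> L" "fundamental p V j y" using ex_fundamental[OF t p ij(2)] by blast
  have "(\<Sum>v\<in>V. sform (x v) (y v)) = sform (x i) (y i) + sform (x j) (y j)"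
  proof (rule sum_pair[OF ij])
    fix v assume "v \<in> V" "v \<noteq> i" "v \<noteq> j"
    then have "x v = 0 \<or> x v = p v" "y v = 0 \<or> y v = p v"
      using x(2) y(2) unfolding fundamental_def aligned_def by auto
    then show "sform (x v) (y v) = 0" by (rule sform_aligned)
  qed
  then have "sform (x i) (y i) + sform (x j) (y j) = 0"
    using isotropic[OF x(1) y(1)] by simp
  then have eq: "sform (x j) (y j) = sform (y i) (x i)"
    by (simp add: sform_commute[of "y i"]) (cases "sform (x i) (y i)"; cases "sform (x j) (y j)"; simp)
  have "x j = 0 \<or> x j = p j" "y i = 0 \<or> y i = p i" using x(2) y(2) ij unfolding fundamental_def aligned_def by auto
  moreover have "y j \<noteq> 0" "y j \<noteq> p j" "x i \<noteq> 0" "x i \<noteq> p i" using x(2) y(2) unfolding fundamental_def by auto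
  ultimately have "x j \<noteq> 0 \<longleftrightarrow> y i \<noteq> 0"
    using sform_cross[of "y j" "p j" "x j"] sform_cross[of "x i" "p i" "y i"] p eq by metis
  then show ?thesis using fund_iff[OF t p x] fund_iff[OF t p y] by blast
qed

definition q :: "(nat \<Rightarrow> bit \<times> bit) \<Rightarrow> bit" where "q x = (\<Sum>v\<in>V. quad (x v))"

lemma q_add: "x \<in> L \<Longrightarrow> y \<in> L \<Longrightarrow> q (\<lambda>v. x v + y v) = q x + q y"
  using isotropic[of x y] by (simp add: q_def quad_add sum.distrib)

end

section \<open>Comparing two isotropic systems\<close>

lemma aligned_split: "D \<subseteq> V \<Longrightarrow> aligned p V x \<longleftrightarrow> aligned p D x \<and> aligned p (V - D) x"
  unfolding aligned_def by blast

text \<open>All comparisons of states in what follows come from this principle. Suppose that the vectors of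
  \<open>L\<close> aligned with \<open>p\<close> on \<open>D\<close> and the vectors of \<open>L'\<close> aligned with \<open>p'\<close> on \<open>D'\<close> look alike
  outside \<open>D\<close> and \<open>D'\<close>, and that zero only corresponds to zero. Then both choices are transversal or
  neither is, and they have the same graph outside \<open>D\<close> and \<open>D'\<close>. For an actual move it remains to
  compare finitely many entries at the vertices in \<open>D\<close>.\<close>

lemma transfer:
  fixes \<pi> :: "nat \<Rightarrow> nat"
  assumes D: "D \<subseteq> V" "D' \<subseteq> V'" and im: "\<pi> ` (V - D) = V' - D'" and inj: "inj_on \<pi> (V - D)"
    and fwd: "\<And>x. x \<in> L \<Longrightarrow> aligned p D x \<Longrightarrow> \<exists>x'\<in>L'. aligned p' D' x' \<and>
      (\<forall>t\<in>V - D. (x' (\<pi> t) = 0 \<longleftrightarrow> x t = 0) \<and> (x' (\<pi> t) = p' (\<pi> t) \<longleftrightarrow> x t = p t)) \<and>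
      (x' = (\<lambda>_. 0) \<longrightarrow> x = (\<lambda>_. 0))"
    and bwd: "\<And>x'. x' \<in> L' \<Longrightarrow> aligned p' D' x' \<Longrightarrow> \<exists>x\<in>L. aligned p D x \<and>
      (\<forall>t\<in>V - D. (x' (\<pi> t) = 0 \<longleftrightarrow> x t = 0) \<and> (x' (\<pi> t) = p' (\<pi> t) \<longleftrightarrow> x t = p t)) \<and>
      (x = (\<lambda>_. 0) \<longrightarrow> x' = (\<lambda>_. 0))"
  shows "transversal V L p \<longleftrightarrow> transversal V' L' p'"
    and "\<And>i j. i \<in> V - D \<Longrightarrow> j \<in> V - D \<Longrightarrow> fund V L p i j \<longleftrightarrow> fund V' L' p' (\<pi> i) (\<pi> j)"
proof -
  define sim where "sim x x' \<longleftrightarrow>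
    (\<forall>t\<in>V - D. (x' (\<pi> t) = 0 \<longleftrightarrow> x t = 0) \<and> (x' (\<pi> t) = p' (\<pi> t) \<longleftrightarrow> x t = p t))"
    for x x' :: "nat \<Rightarrow> bit \<times> bit"
  have al: "aligned p (V - D) x \<longleftrightarrow> aligned p' (V' - D') x'" if "sim x x'" for x x'
    using that unfolding sim_def aligned_def im[symmetric] by auto
  have al_i: "aligned p (V - D - {i}) x \<longleftrightarrow> aligned p' (V' - D' - {\<pi> i}) x'"
    if "sim x x'" "i \<in> V - D" for x x' i
  proof -
    have "V' - D' - {\<pi> i} = \<pi> ` (V - D - {i})" unfolding im[symmetric] using inj that(2)
      by (auto simp: inj_on_def)
    then show ?thesis using that unfolding sim_def aligned_def by auto
  qed
  show "transversal V L p \<longleftrightarrow> transversal V' L' p'"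
  proof
    assume t: "transversal V L p"
    show "transversal V' L' p'"
      unfolding transversal_def
    proof (intro ballI impI)
      fix x' assume x': "x' \<in> L'" "aligned p' V' x'"
      then obtain x where x: "x \<in> L" "aligned p D x" "sim x x'" "x = (\<lambda>_. 0) \<longrightarrow> x' = (\<lambda>_. 0)"
        using bwd[OF x'(1)] aligned_split[OF D(2)] unfolding sim_def by blast
      then show "x' = (\<lambda>_. 0)"
        using t x'(2) al[OF x(3)] aligned_split[OF D(1)] aligned_split[OF D(2)]
        unfolding transversal_def by blast
    qed
  next
    assume t: "transversal V' L' p'"
    show "transversal V L p"
      unfolding transversal_def
    proof (intro ballI impI)
      fix x assume x: "x \<in> L" "aligned p V x"
      then obtain x' where x': "x' \<in> L'" "aligned p' D' x'" "sim x x'" "x' = (\<lambda>_. 0) \<longrightarrow> x = (\<lambda>_. 0)"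
        using fwd[OF x(1)] aligned_split[OF D(1)] unfolding sim_def by blast
      then show "x = (\<lambda>_. 0)"
        using t x(2) al[OF x'(3)] aligned_split[OF D(1)] aligned_split[OF D(2)]
        unfolding transversal_def by blast
    qed
  qed
  fix i j assume i: "i \<in> V - D" and j: "j \<in> V - D"
  have sp: "fundamental p V i x \<longleftrightarrow> x i \<noteq> 0 \<and> x i \<noteq> p i \<and> aligned p D x \<and> aligned p (V - D - {i}) x" for x
    using i D unfolding fundamental_def aligned_def by blast
  have "\<pi> i \<in> V' - D'" using i im by blast
  then have sp': "fundamental p' V' (\<pi> i) x \<longleftrightarrow> x (\<pi> i) \<noteq> 0 \<and> x (\<pi> i) \<noteq> p' (\<pi> i) \<and> aligned p' D' x
      \<and> aligned p' (V' - D' - {\<pi> i}) x" for x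
    using D unfolding fundamental_def aligned_def by blast
  have f: "fundamental p V i x \<and> x j \<noteq> 0 \<longleftrightarrow> fundamental p' V' (\<pi> i) x' \<and> x' (\<pi> j) \<noteq> 0"
    if "sim x x'" "aligned p D x" "aligned p' D' x'" for x x'
    using that i j unfolding sp sp' al_i[OF that(1) i] unfolding sim_def by simp
  show "fund V L p i j \<longleftrightarrow> fund V' L' p' (\<pi> i) (\<pi> j)"
  proof
    assume "fund V L p i j"
    then obtain x where x: "x \<in> L" "fundamental p V i x" "x j \<noteq> 0" unfolding fund_def by blast
    then obtain x' where x': "x' \<in> L'" "aligned p' D' x'" "sim x x'"
      using fwd[OF x(1)] unfolding sp sim_def by blast
    then show "fund V' L' p' (\<pi> i) (\<pi> j)" using x f[OF x'(3)] unfolding fund_def sp by blast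
  next
    assume "fund V' L' p' (\<pi> i) (\<pi> j)"
    then obtain x' where x': "x' \<in> L'" "fundamental p' V' (\<pi> i) x'" "x' (\<pi> j) \<noteq> 0" unfolding fund_def by blast
    then obtain x where x: "x \<in> L" "aligned p D x" "sim x x'"
      using bwd[OF x'(1)] unfolding sp' sim_def by blast
    then show "fund V L p i j" using x' f[OF x(3)] unfolding fund_def sp' by blast
  qed
qed

lemma transfer_id:
  assumes D: "D \<subseteq> V" "D' \<subseteq> V'" and VV: "V - D = V' - D'" and pp: "\<And>t. t \<in> V - D \<Longrightarrow> p' t = p t"
    and fwd: "\<And>x. x \<in> L \<Longrightarrow> aligned p D x \<Longrightarrow> \<exists>x'\<in>L'. aligned p' D' x' \<and> (\<forall>t\<in>V - D. x' t = x t) \<and>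
      (x' = (\<lambda>_. 0) \<longrightarrow> x = (\<lambda>_. 0))"
    and bwd: "\<And>x'. x' \<in> L' \<Longrightarrow> aligned p' D' x' \<Longrightarrow> \<exists>x\<in>L. aligned p D x \<and> (\<forall>t\<in>V - D. x' t = x t) \<and>
      (x = (\<lambda>_. 0) \<longrightarrow> x' = (\<lambda>_. 0))"
  shows "transversal V L p \<longleftrightarrow> transversal V' L' p'"
    and "\<And>i j. i \<in> V - D \<Longrightarrow> j \<in> V - D \<Longrightarrow> fund V L p i j \<longleftrightarrow> fund V' L' p' i j"
proof -
  have f: "\<exists>x'\<in>L'. aligned p' D' x' \<and>
      (\<forall>t\<in>V - D. (x' (id t) = 0 \<longleftrightarrow> x t = 0) \<and> (x' (id t) = p' (id t) \<longleftrightarrow> x t = p t)) \<and>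
      (x' = (\<lambda>_. 0) \<longrightarrow> x = (\<lambda>_. 0))" if h: "x \<in> L" "aligned p D x" for x
  proof -
    obtain x' where x': "x' \<in> L'" "aligned p' D' x'" "\<forall>t\<in>V - D. x' t = x t" "x' = (\<lambda>_. 0) \<longrightarrow> x = (\<lambda>_. 0)"
      using fwd[OF h] by blast
    show ?thesis by (intro bexI[OF _ x'(1)] conjI ballI x') (simp_all add: x'(3) pp)
  qed
  have b: "\<exists>x\<in>L. aligned p D x \<and>
      (\<forall>t\<in>V - D. (x' (id t) = 0 \<longleftrightarrow> x t = 0) \<and> (x' (id t) = p' (id t) \<longleftrightarrow> x t = p t)) \<and>
      (x = (\<lambda>_. 0) \<longrightarrow> x' = (\<lambda>_. 0))" if h: "x' \<in> L'" "aligned p' D' x'" for x'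
  proof -
    obtain x where x: "x \<in> L" "aligned p D x" "\<forall>t\<in>V - D. x' t = x t" "x = (\<lambda>_. 0) \<longrightarrow> x' = (\<lambda>_. 0)"
      using bwd[OF h] by blast
    show ?thesis by (intro bexI[OF _ x(1)] conjI ballI x) (simp_all add: x(3) pp flip: x(3))
  qed
  have im: "id ` (V - D) = V' - D'" using VV by simp
  show "transversal V L p \<longleftrightarrow> transversal V' L' p'"
    by (rule transfer(1)[where \<pi> = id and L = L and L' = L' and D = D and D' = D', OF D im inj_on_id]) (fact f b)+
  fix i j assume ij: "i \<in> V - D" "j \<in> V - D"
  have "fund V L p i j \<longleftrightarrow> fund V' L' p' (id i) (id j)"
    by (rule transfer(2)[where \<pi> = id and L = L and L' = L' and D = D and D' = D', OF D im inj_on_id _ _ ij])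
      (fact f b)+
  then show "fund V L p i j \<longleftrightarrow> fund V' L' p' i j" unfolding id_apply .
qed

section \<open>Twin reduction\<close>

text \<open>This covers true twins and false twins alike, as the second move acts on Gauss diagrams by deleting either.\<close>

definition twins :: "nat set \<Rightarrow> (nat \<Rightarrow> nat \<Rightarrow> bool) \<Rightarrow> nat \<Rightarrow> nat \<Rightarrow> bool" where
  "twins U R u v \<longleftrightarrow> u \<in> U \<and> v \<in> U \<and> u \<noteq> v \<and> (\<forall>t\<in>U - {u, v}. R t u \<longleftrightarrow> R t v)"

inductive reduces_to_W5 :: "nat set \<Rightarrow> (nat \<Rightarrow> nat \<Rightarrow> bool) \<Rightarrow> bool" where
  iso: "bij_betw f (verts W5) U \<Longrightarrow>
    (\<And>i j. i \<in> verts W5 \<Longrightarrow> j \<in> verts W5 \<Longrightarrow> i \<noteq> j \<Longrightarrow> R (f i) (f j) \<longleftrightarrow> adj W5 i j) \<Longrightarrow> reduces_to_W5 U R"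
| twins: "twins U R u v \<Longrightarrow> reduces_to_W5 (U - {u, v}) R \<Longrightarrow> reduces_to_W5 U R"

lemma reduces_iso:
  assumes "reduces_to_W5 U R" "bij_betw g U U'"
    "\<And>i j. i \<in> U \<Longrightarrow> j \<in> U \<Longrightarrow> i \<noteq> j \<Longrightarrow> R' (g i) (g j) \<longleftrightarrow> R i j"
  shows "reduces_to_W5 U' R'"
  using assms
proof (induction arbitrary: U' rule: reduces_to_W5.induct)
  case (iso f U R)
  have fU: "f i \<in> U" if "i \<in> verts W5" for i using iso(1) that unfolding bij_betw_def by blast
  have "f i \<noteq> f j" if "i \<in> verts W5" "j \<in> verts W5" "i \<noteq> j" for i j
    using iso(1) that unfolding bij_betw_def inj_on_def by blast
  then show ?case
    using iso(2,4) fU by (intro reduces_to_W5.iso[OF bij_betw_trans[OF iso(1,3)]]) auto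
next
  case (twins U R u v)
  have inj: "inj_on g U" and im: "g ` U = U'" using twins(4) unfolding bij_betw_def by auto
  have uv: "u \<in> U" "v \<in> U" "u \<noteq> v" "\<And>t. t \<in> U \<Longrightarrow> t \<noteq> u \<Longrightarrow> t \<noteq> v \<Longrightarrow> R t u \<longleftrightarrow> R t v"
    using twins(1) unfolding twins_def by auto
  have im2: "g ` (U - {u, v}) = U' - {g u, g v}" using inj im uv by (auto simp: inj_on_def)
  have "bij_betw g (U - {u, v}) (U' - {g u, g v})"
    using im2 inj unfolding bij_betw_def by (auto simp: inj_on_def)
  then have "reduces_to_W5 (U' - {g u, g v}) R'" using twins(3,5) by blast
  moreover have "twins U' R' (g u) (g v)"
    unfolding twins_def
  proof (intro conjI ballI)
    show "g u \<in> U'" "g v \<in> U'" "g u \<noteq> g v" using uv im inj by (auto simp: inj_on_def)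
    fix t assume "t \<in> U' - {g u, g v}"
    then obtain s where "s \<in> U" "s \<noteq> u" "s \<noteq> v" "t = g s" using im2 by blast
    then show "R' t (g u) \<longleftrightarrow> R' t (g v)" using uv twins(5) by simp
  qed
  ultimately show ?case by (rule reduces_to_W5.twins[rotated])
qed

lemma reduces_cong:
  assumes "\<And>i j. i \<in> U \<Longrightarrow> j \<in> U \<Longrightarrow> i \<noteq> j \<Longrightarrow> R i j \<longleftrightarrow> R' i j"
  shows "reduces_to_W5 U R \<longleftrightarrow> reduces_to_W5 U R'"
  using reduces_iso[of U R id U R'] reduces_iso[of U R' id U R] assms by auto

lemma W5_no_twins:
  assumes "i \<in> verts W5" "j \<in> verts W5" "i \<noteq> j"
  shows "\<exists>t\<in>verts W5 - {i, j}. adj W5 t i \<noteq> adj W5 t j"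
proof -
  have V: "verts W5 = {0, 1, 2, 3, 4, 5}" by (auto simp: W5_def)
  have "\<exists>t\<in>{0, 1, 2, 3, 4, 5}. t \<noteq> i \<and> t \<noteq> j \<and> adj W5 t i \<noteq> adj W5 t j"
    using assms unfolding V by (elim insertE emptyE) (simp_all add: W5_def)
  then show ?thesis unfolding V by blast
qed

text \<open>Twin reduction is confluent, so it does not matter which pair is deleted first. Disjoint pairs can be
  deleted in either order. Two pairs that share a vertex leave isomorphic graphs, because the other two
  vertices are then twins of each other. No pair can be deleted from \<open>W5\<close>.\<close>

lemma reduces_twins_iff:
  assumes "twins U R a b" "\<And>i j. i \<in> U \<Longrightarrow> j \<in> U \<Longrightarrow> R i j \<longleftrightarrow> R j i"
  shows "reduces_to_W5 U R \<longleftrightarrow> reduces_to_W5 (U - {a, b}) R"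
proof
  assume "reduces_to_W5 U R"
  then show "reduces_to_W5 (U - {a, b}) R"
    using assms
  proof (induction arbitrary: a b rule: reduces_to_W5.induct)
    case (iso f U R)
    have im: "f ` verts W5 = U" and inj: "inj_on f (verts W5)" using iso(1) unfolding bij_betw_def by auto
    obtain i j where ij: "i \<in> verts W5" "j \<in> verts W5" "a = f i" "b = f j"
      using iso(3) im unfolding twins_def by blast
    then have "i \<noteq> j" using iso(3) unfolding twins_def by blast
    then obtain t where t: "t \<in> verts W5" "t \<noteq> i" "t \<noteq> j" "adj W5 t i \<noteq> adj W5 t j"
      using W5_no_twins[OF ij(1,2)] by blast
    then have "f t \<in> U - {a, b}" using ij im inj by (auto simp: inj_on_def)
    then have "R (f t) a \<longleftrightarrow> R (f t) b" using iso(3) unfolding twins_def by blast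
    then show ?case using t iso(2) ij by simp
  next
    case (twins U R u v)
    have uv: "u \<in> U" "v \<in> U" "u \<noteq> v" "\<And>t. t \<in> U \<Longrightarrow> t \<noteq> u \<Longrightarrow> t \<noteq> v \<Longrightarrow> R t u \<longleftrightarrow> R t v"
      using twins(1) unfolding twins_def by auto
    have ab: "a \<in> U" "b \<in> U" "a \<noteq> b" "\<And>t. t \<in> U \<Longrightarrow> t \<noteq> a \<Longrightarrow> t \<noteq> b \<Longrightarrow> R t a \<longleftrightarrow> R t b"
      using twins(4) unfolding twins_def by auto
    have one: "reduces_to_W5 (U - {c, e}) R"
      if cd: "reduces_to_W5 (U - {c, d}) R" "c \<in> U" "d \<in> U" "e \<in> U" "c \<noteq> d" "c \<noteq> e" "d \<noteq> e"
        "\<And>t. t \<in> U \<Longrightarrow> t \<noteq> c \<Longrightarrow> t \<noteq> d \<Longrightarrow> R t c \<longleftrightarrow> R t d"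
        "\<And>t. t \<in> U \<Longrightarrow> t \<noteq> c \<Longrightarrow> t \<noteq> e \<Longrightarrow> R t c \<longleftrightarrow> R t e" for c d e
    proof (rule reduces_iso[OF cd(1)])
      let ?g = "\<lambda>t. if t = e then d else t"
      show "bij_betw ?g (U - {c, d}) (U - {c, e})"
        using cd unfolding bij_betw_def inj_on_def by (auto simp: image_iff)
      fix i j assume "i \<in> U - {c, d}" "j \<in> U - {c, d}" "i \<noteq> j"
      then show "R (?g i) (?g j) \<longleftrightarrow> R i j" using cd twins(5) by auto
    qed
    consider "{u, v} = {a, b}" | "u \<noteq> a" "u \<noteq> b" "v \<noteq> a" "v \<noteq> b" | "u = a" "v \<noteq> b" | "u = b" "v \<noteq> a"
      | "v = a" "u \<noteq> b" | "v = b" "u \<noteq> a" by blast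
    then show ?case
    proof cases
      case 1
      then show ?thesis using twins(2) by simp
    next
      case 2
      have "twins (U - {u, v}) R a b" using ab 2 unfolding twins_def by auto
      then have "reduces_to_W5 (U - {u, v} - {a, b}) R" using twins(3,5) by blast
      moreover have "U - {u, v} - {a, b} = U - {a, b} - {u, v}" by blast
      moreover have "twins (U - {a, b}) R u v" using uv 2 unfolding twins_def by auto
      ultimately show ?thesis using reduces_to_W5.twins by metis
    next
      case 3
      then show ?thesis using one[of u v b] uv ab twins(2) by (auto simp: insert_commute)
    next
      case 4
      then show ?thesis using one[of u v a] uv ab twins(2) by (auto simp: insert_commute)
    next
      case 5
      then show ?thesis using one[of v u b] uv ab twins(2) by (auto simp: insert_commute)
    next
      case 6
      then show ?thesis using one[of v u a] uv ab twins(2) by (auto simp: insert_commute)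
    qed
  qed
next
  show "reduces_to_W5 (U - {a, b}) R \<Longrightarrow> reduces_to_W5 U R"
    using reduces_to_W5.twins assms(1) by blast
qed

lemma reduces_imp_embedding:
  assumes "reduces_to_W5 U R"
  obtains f where "inj_on f (verts W5)" "f ` verts W5 \<subseteq> U"
    "\<And>i j. i \<in> verts W5 \<Longrightarrow> j \<in> verts W5 \<Longrightarrow> i \<noteq> j \<Longrightarrow> R (f i) (f j) \<longleftrightarrow> adj W5 i j"
proof -
  have "\<exists>f. inj_on f (verts W5) \<and> f ` verts W5 \<subseteq> U \<and>
    (\<forall>i\<in>verts W5. \<forall>j\<in>verts W5. i \<noteq> j \<longrightarrow> (R (f i) (f j) \<longleftrightarrow> adj W5 i j))"
    using assms
  proof induction
    case (iso f U R)
    then show ?case unfolding bij_betw_def by blast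
  qed blast
  then show ?thesis using that by blast
qed

section \<open>States\<close>

text \<open>The set \<open>S\<close> will be the set of even vertices. The value \<open>ds\<close> keeps a vertex as a crossing; off the
  vertex set it is a default that makes the set of states finite.\<close>

definition states :: "nat set \<Rightarrow> (nat \<Rightarrow> bit \<times> bit) set" where
  "states S = {p. (\<forall>v\<in>S. p v = da \<or> p v = db) \<and> (\<forall>v. v \<notin> S \<longrightarrow> p v = ds)}"

definition count_states :: "nat set \<Rightarrow> ((nat \<Rightarrow> bit \<times> bit) \<Rightarrow> bool) \<Rightarrow> nat" where
  "count_states S P = card {p \<in> states S. P p}"

lemma states_neq_0: "p \<in> states S \<Longrightarrow> p v \<noteq> 0"
  unfolding states_def by (metis (mono_tags, lifting) dir_neq(1,2,3) mem_Collect_eq)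

lemma states_remove:
  assumes "v \<in> S"
  shows "states S = (\<lambda>p. p(v := da)) ` states (S - {v}) \<union> (\<lambda>p. p(v := db)) ` states (S - {v})"
proof (intro equalityI subsetI)
  fix p assume p: "p \<in> states S"
  then have "p(v := ds) \<in> states (S - {v})" "p v = da \<or> p v = db"
    using assms unfolding states_def by auto
  moreover have "p = (p(v := ds))(v := p v)" by simp
  ultimately show "p \<in> (\<lambda>p. p(v := da)) ` states (S - {v}) \<union> (\<lambda>p. p(v := db)) ` states (S - {v})"
    by (metis UnI1 UnI2 image_eqI)
next
  have "p(v := k) \<in> states S" if "p \<in> states (S - {v})" "k = da \<or> k = db" for p k
    using that assms unfolding states_def by (simp del: split_paired_All)
  then show "p \<in> states S"
    if "p \<in> (\<lambda>p. p(v := da)) ` states (S - {v}) \<union> (\<lambda>p. p(v := db)) ` states (S - {v})" for p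
    using that by blast
qed

lemma states_empty: "states {} = {\<lambda>_. ds}"
  unfolding states_def by auto

lemma finite_states: "finite S \<Longrightarrow> finite (states S)"
proof (induction S rule: finite_induct)
  case (insert v S)
  then show ?case using states_remove[of v "insert v S"] by simp
qed (simp add: states_empty)

lemma inj_states_upd: "v \<in> S \<Longrightarrow> inj_on (\<lambda>p. p(v := k)) (states (S - {v}))"
proof (rule inj_onI)
  fix x y assume "x \<in> states (S - {v})" "y \<in> states (S - {v})" and e: "x(v := k) = y(v := k)"
  then have "x v = y v" unfolding states_def by auto
  moreover have "x t = y t" if "t \<noteq> v" for t using fun_cong[OF e, of t] that by simp
  ultimately show "x = y" by (metis ext)
qed

lemma count_states_split:
  assumes "finite S" "v \<in> S"
  shows "count_states S P = count_states (S - {v}) (\<lambda>p. P (p(v := da))) + count_states (S - {v}) (\<lambda>p. P (p(v := db)))"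
proof -
  let ?A = "\<lambda>k. (\<lambda>p. p(v := k)) ` {p \<in> states (S - {v}). P (p(v := k))}"
  have "{p \<in> states S. P p} = ?A da \<union> ?A db" using states_remove[OF assms(2)] by auto
  moreover have "?A da \<inter> ?A db = {}" by (auto dest!: fun_cong[of _ _ v])
  moreover have "finite (?A k)" for k using finite_states[of "S - {v}"] assms by simp
  moreover have "card (?A k) = count_states (S - {v}) (\<lambda>p. P (p(v := k)))" for k
    unfolding count_states_def by (intro card_image inj_on_subset[OF inj_states_upd[OF assms(2)]]) blast
  ultimately show ?thesis by (simp add: count_states_def card_Un_disjoint)
qed

lemma count_states_cong: "(\<And>p. p \<in> states S \<Longrightarrow> P p \<longleftrightarrow> Q p) \<Longrightarrow> count_states S P = count_states S Q"
  unfolding count_states_def by (metis (mono_tags, lifting) Collect_cong)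

lemma count_states_0: "(\<And>p. p \<in> states S \<Longrightarrow> \<not> P p) \<Longrightarrow> count_states S P = 0"
  unfolding count_states_def by (metis (mono_tags, lifting) card.empty empty_Collect_eq)

section \<open>The parity bracket\<close>

text \<open>The fundamental vector of \<open>i\<close> with respect to the straight directions has one entry \<open>ds\<close> for each
  neighbour of \<open>i\<close>, and its entry at \<open>i\<close> is a smoothing. So the sum is the degree of \<open>i\<close> modulo 2.\<close>

definition evens :: "nat set \<Rightarrow> (nat \<Rightarrow> bit \<times> bit) set \<Rightarrow> nat set" where
  "evens V L = {i \<in> V. \<exists>x\<in>L. fundamental (\<lambda>_. ds) V i x \<and> (\<Sum>v\<in>V. quad (x v)) = 0}"

definition alive :: "nat set \<Rightarrow> (nat \<Rightarrow> bit \<times> bit) set \<Rightarrow> nat set \<Rightarrow> (nat \<Rightarrow> bit \<times> bit) \<Rightarrow> bool" where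
  "alive V L S p \<longleftrightarrow> transversal V L p \<and> reduces_to_W5 (V - S) (fund V L p)"

definition parity_bracket :: "nat set \<Rightarrow> (nat \<Rightarrow> bit \<times> bit) set \<Rightarrow> bool" where
  "parity_bracket V L \<longleftrightarrow> odd (count_states (evens V L) (alive V L (evens V L)))"

context isotropic_system
begin

abbreviation "knot \<equiv> transversal V L (\<lambda>_. ds)"

lemma ds_neq: "(\<lambda>_::nat. ds) v \<noteq> 0" by simp

lemma finite_evens: "finite (evens V L)" using fin unfolding evens_def by simp

lemma evens_iff:
  assumes "knot" "x \<in> L" "fundamental (\<lambda>_. ds) V i x" "i \<in> V"
  shows "i \<in> evens V L \<longleftrightarrow> q x = 0"
  using fundamental_unique[OF assms(1) ds_neq assms(2,3)] assms unfolding evens_def q_def by blast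

lemma orth:
  assumes "r \<in> L" "x \<in> L" "T \<subseteq> V" "\<And>t. t \<in> V - T \<Longrightarrow> sform (x t) (r t) = 0"
  shows "(\<Sum>t\<in>T. sform (x t) (r t)) = 0"
proof -
  have "(\<Sum>t\<in>V. sform (x t) (r t)) = (\<Sum>t\<in>T. sform (x t) (r t))"
    using assms fin by (intro sum.mono_neutral_right) auto
  then show ?thesis using isotropic[OF assms(2,1)] by simp
qed

text \<open>A vector \<open>r\<close> aligned with \<open>p\<close> off \<open>U\<close> whose support meets \<open>U\<close> in \<open>u\<close> and \<open>v\<close> only makes
  these twins: the fundamental vector of any other vertex is orthogonal to \<open>r\<close>, so its entries at \<open>u\<close> and \<open>v\<close> vanish
  simultaneously.\<close>

lemma twins_fund:
  assumes t: "transversal V L p" and p: "\<And>v. p v \<noteq> 0" and U: "U \<subseteq> V" and r: "r \<in> L"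
    and uv: "u \<in> U" "v \<in> U" "u \<noteq> v" "r u \<noteq> 0" "r u \<noteq> p u" "r v \<noteq> 0" "r v \<noteq> p v"
    and al: "aligned p (V - U) r" and off: "\<And>t. t \<in> U \<Longrightarrow> t \<noteq> u \<Longrightarrow> t \<noteq> v \<Longrightarrow> r t = 0"
  shows "twins U (fund V L p) u v"
  unfolding twins_def
proof (intro conjI ballI)
  fix s assume s: "s \<in> U - {u, v}"
  then obtain x where x: "x \<in> L" "fundamental p V s x" using ex_fundamental[OF t p] U by blast
  have "(\<Sum>t\<in>{u, v}. sform (x t) (r t)) = 0"
  proof (rule orth[OF r x(1)])
    show "{u, v} \<subseteq> V" using uv U by blast
    fix t assume t: "t \<in> V - {u, v}"
    show "sform (x t) (r t) = 0"
    proof (cases "t \<in> U")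
      case True
      then show ?thesis using off t by simp
    next
      case False
      then have "x t = 0 \<or> x t = p t" "r t = 0 \<or> r t = p t"
        using t s x(2) al unfolding fundamental_def aligned_def by auto
      then show ?thesis by (rule sform_aligned)
    qed
  qed
  then have eq: "sform (x u) (r u) + sform (x v) (r v) = 0" using uv by simp
  have "x u = 0 \<or> x u = p u" "x v = 0 \<or> x v = p v"
    using s x(2) uv U unfolding fundamental_def aligned_def by auto
  then have "sform (x u) (r u) = 1 \<longleftrightarrow> x u \<noteq> 0" "sform (x v) (r v) = 1 \<longleftrightarrow> x v \<noteq> 0"
    using sform_cross uv p by blast+
  then have "x u \<noteq> 0 \<longleftrightarrow> x v \<noteq> 0"
    using eq by (cases "sform (x u) (r u)"; cases "sform (x v) (r v)") simp_all
  then show "fund V L p s u \<longleftrightarrow> fund V L p s v" using fund_iff[OF t p x] by blast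
qed (use uv in auto)

lemma reduces_fund_twins:
  assumes "transversal V L p" "\<And>v. p v \<noteq> 0" "U \<subseteq> V" "twins U (fund V L p) u v"
  shows "reduces_to_W5 U (fund V L p) \<longleftrightarrow> reduces_to_W5 (U - {u, v}) (fund V L p)"
  using assms(3) by (intro reduces_twins_iff[OF assms(4)]) (metis fund_sym[OF assms(1,2)] subsetD)

lemma alive_cong:
  assumes "transversal V L p \<longleftrightarrow> transversal V' L' p'" "V - S = V' - S'"
    "\<And>i j. i \<in> V - S \<Longrightarrow> j \<in> V - S \<Longrightarrow> fund V L p i j \<longleftrightarrow> fund V' L' p' i j"
  shows "alive V L S p \<longleftrightarrow> alive V' L' S' p'"
  using assms reduces_cong[of "V - S" "fund V L p" "fund V' L' p'"] unfolding alive_def by metis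

end

section \<open>The first move: an isolated vertex\<close>

text \<open>Here the deleted vertex supports a vector of its own. The smoothing \<open>da\<close> splits off a circle and
  contributes nothing; the smoothing \<open>db\<close> has the same effect as deletion of the vertex.\<close>

locale first_move = isotropic_system +
  fixes v V' L'
  assumes v: "v \<in> V" and r: "(\<lambda>t. if t = v then da else 0) \<in> L"
    and V': "V' = V - {v}" and L': "L' = {x \<in> L. x v = 0}"
    and I': "isotropic_system V' L'"
begin

lemma orth_v: "x \<in> L \<Longrightarrow> x v = 0 \<or> x v = da"
  using orth[OF r, of x "{v}"] v sform_eq_0_iff[of da "x v"] by simp

lemma knot_iff: "knot \<longleftrightarrow> transversal V' L' (\<lambda>_. ds)"
proof (rule transfer_id(1)[where D = "{v}" and D' = "{}"])
  fix x assume x: "x \<in> L" "aligned (\<lambda>_. ds) {v} x"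
  then have "x v = 0" using orth_v[OF x(1)] unfolding aligned_def by auto
  then show "\<exists>x'\<in>L'. aligned (\<lambda>_. ds) {} x' \<and> (\<forall>t\<in>V - {v}. x' t = x t) \<and> (x' = (\<lambda>_. 0) \<longrightarrow> x = (\<lambda>_. 0))"
    using x L' by (intro bexI[of _ x]) (auto simp: aligned_def)
qed (use v V' L' in \<open>auto simp: aligned_def\<close>)

lemma bracket_iff:
  assumes k: knot
  shows "parity_bracket V L \<longleftrightarrow> parity_bracket V' L'"
proof -
  interpret I': isotropic_system V' L' by (rule I')
  let ?r = "\<lambda>t. if t = v then da else 0"
  have k': "transversal V' L' (\<lambda>_. ds)" using k knot_iff by simp
  have q: "q x = I'.q x" if "x v = 0" for x
  proof -
    have "q x = quad (x v) + (\<Sum>t\<in>V'. quad (x t))"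
      unfolding q_def V' using fin v by (simp add: sum.remove[of V v])
    then show ?thesis unfolding I'.q_def using that by simp
  qed
  have "fundamental (\<lambda>_. ds) V v ?r" unfolding fundamental_def aligned_def by auto
  moreover have "q ?r = 0" unfolding q_def by (intro sum.neutral) auto
  ultimately have ev: "v \<in> evens V L" using evens_iff[OF k r] v by blast
  have "i \<in> evens V L \<longleftrightarrow> i \<in> evens V' L'" if i: "i \<in> V'" for i
  proof -
    obtain x where x: "x \<in> L" "fundamental (\<lambda>_. ds) V i x"
      using ex_fundamental[OF k ds_neq, of i] i V' by auto
    have "x v = 0" using x(2) orth_v[OF x(1)] i v V' unfolding fundamental_def aligned_def by auto
    then have x': "x \<in> L'" "fundamental (\<lambda>_. ds) V' i x"
      using x V' L' unfolding fundamental_def aligned_def by auto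
    show ?thesis
      using evens_iff[OF k x] I'.evens_iff[OF k' x' i] q[of x] \<open>x v = 0\<close> i V' by simp
  qed
  then have evens': "evens V' L' = evens V L - {v}"
    using ev v V' unfolding evens_def by blast
  let ?S = "evens V L"
  have "count_states ?S (alive V L ?S) = count_states (?S - {v}) (\<lambda>p. alive V L ?S (p(v := da)))
      + count_states (?S - {v}) (\<lambda>p. alive V L ?S (p(v := db)))"
    by (rule count_states_split[OF finite_evens ev])
  also have "count_states (?S - {v}) (\<lambda>p. alive V L ?S (p(v := da))) = 0"
  proof (rule count_states_0)
    fix p
    have "aligned (p(v := da)) V ?r" unfolding aligned_def by auto
    moreover have "?r \<noteq> (\<lambda>_. 0)" by (auto dest: fun_cong[of _ _ v])
    ultimately show "\<not> alive V L ?S (p(v := da))" using r unfolding alive_def transversal_def by blast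
  qed
  also have "count_states (?S - {v}) (\<lambda>p. alive V L ?S (p(v := db))) = count_states (?S - {v}) (alive V' L' (?S - {v}))"
  proof (rule count_states_cong)
    fix p assume p: "p \<in> states (?S - {v})"
    have fwd: "\<exists>x'\<in>L'. aligned p {} x' \<and> (\<forall>t\<in>V - {v}. x' t = x t) \<and> (x' = (\<lambda>_. 0) \<longrightarrow> x = (\<lambda>_. 0))"
      if "x \<in> L" "aligned (p(v := db)) {v} x" for x
    proof -
      have "x v = 0" using orth_v[OF that(1)] that(2) unfolding aligned_def by auto
      then show ?thesis using that L' by (intro bexI[of _ x]) (auto simp: aligned_def)
    qed
    have bwd: "\<exists>x\<in>L. aligned (p(v := db)) {v} x \<and> (\<forall>t\<in>V - {v}. x' t = x t) \<and> (x = (\<lambda>_. 0) \<longrightarrow> x' = (\<lambda>_. 0))"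
      if "x' \<in> L'" for x' using that L' by (intro bexI[of _ x']) (auto simp: aligned_def)
    have a: "{v} \<subseteq> V" "{} \<subseteq> V'" "V - {v} = V' - {}" "\<And>t. t \<in> V - {v} \<Longrightarrow> p t = (p(v := db)) t"
      using v V' by auto
    show "alive V L ?S (p(v := db)) \<longleftrightarrow> alive V' L' (?S - {v}) p"
    proof (rule alive_cong)
      show "transversal V L (p(v := db)) \<longleftrightarrow> transversal V' L' p"
        using transfer_id(1)[OF a fwd bwd] .
      show "V - ?S = V' - (?S - {v})" using V' ev by auto
      show "fund V L (p(v := db)) i j \<longleftrightarrow> fund V' L' p i j" if "i \<in> V - ?S" "j \<in> V - ?S" for i j
        using transfer_id(2)[OF a fwd bwd] that ev by blast
    qed
  qed
  finally show ?thesis unfolding parity_bracket_def evens' by simp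
qed

end

section \<open>The second move: a pair of twins\<close>

text \<open>If the two vertices of a second move are even, the smoothings \<open>da, da\<close> split off a circle, the
  two mixed smoothings agree and cancel modulo 2, and \<open>db, db\<close> has the same effect as deletion of both. If they
  are odd, they stay twins in each state. The vector with
  entries \<open>db, db\<close> and zeros elsewhere would be lost with the two vertices; \<open>db_free\<close>, which holds for the
  space of every graph, excludes it.\<close>

locale second_move = isotropic_system +
  fixes u v V' L'
  assumes uv: "u \<in> V" "v \<in> V" "u \<noteq> v" and r: "(\<lambda>t. if t = u \<or> t = v then da else 0) \<in> L"
    and V': "V' = V - {u, v}"
    and L': "L' = (\<lambda>x t. if t = u \<or> t = v then 0 else x t) ` {x \<in> L. x u = x v \<and> (x u = 0 \<or> x u = db)}"
    and db_free: "transversal V L (\<lambda>_. db)"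
    and I': "isotropic_system V' L'"
begin

abbreviation "r2 \<equiv> \<lambda>t. if t = u \<or> t = v then da else (0 :: bit \<times> bit)"
abbreviation "clr x \<equiv> \<lambda>t. if t = u \<or> t = v then 0 else (x t :: bit \<times> bit)"

lemma orth_uv: "x \<in> L \<Longrightarrow> sform (x u) da = sform (x v) da"
  using orth[OF r, of x "{u, v}"] uv
  by simp (cases "sform (x u) da"; cases "sform (x v) da"; simp)

lemma shift:
  assumes "x \<in> L" shows "(\<lambda>t. if t = u \<or> t = v then x t + da else x t) \<in> L"
proof -
  have "(\<lambda>t. x t + r2 t) = (\<lambda>t. if t = u \<or> t = v then x t + da else x t)" by auto
  then show ?thesis using add[OF assms r] by simp
qed

text \<open>A vector with straight entries at both vertices becomes one with entries \<open>db\<close> when the vector of the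
  move is added, and this does not affect the other entries.\<close>

lemma cut_mem:
  assumes x: "x \<in> L" and c: "x u = 0 \<or> x u = ds" "x v = 0 \<or> x v = ds"
  shows "clr x \<in> L'"
proof -
  have "x u = x v" using orth_uv[OF x] c by auto
  then consider "x u = 0" "x v = 0" | "x u = ds" "x v = ds" using c by auto
  then show ?thesis
  proof cases
    case 1
    then show ?thesis using x unfolding L' by (intro image_eqI[of _ _ x]) auto
  next
    case 2
    then show ?thesis using shift[OF x] uv unfolding L'
      by (intro image_eqI[of _ _ "\<lambda>t. if t = u \<or> t = v then x t + da else x t"]) auto
  qed
qed

lemma cut_lift:
  assumes "y \<in> L'"
  obtains x where "x \<in> L" "x u = 0 \<or> x u = ds" "x v = 0 \<or> x v = ds" "y = clr x"
proof -
  obtain x where x: "x \<in> L" "x u = x v" "x u = 0 \<or> x u = db" "y = clr x" using assms unfolding L' by blast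
  show thesis
  proof (cases "x u = 0")
    case True
    then show ?thesis using that[of x] x by simp
  next
    case False
    then have "x u = db" "x v = db" using x by auto
    moreover have "y = clr (\<lambda>t. if t = u \<or> t = v then x t + da else x t)" unfolding x(4) by auto
    ultimately show ?thesis by (intro that[OF shift[OF x(1)]]) simp_all
  qed
qed

lemma cut_kernel:
  assumes x: "x \<in> L" "x u = x v" "x u \<noteq> da" and c: "clr x = (\<lambda>_. 0)"
  shows "x = (\<lambda>_. 0)"
proof -
  have off: "x t = 0" if "t \<noteq> u" "t \<noteq> v" for t using fun_cong[OF c, of t] that by simp
  have dbz: "y = (\<lambda>_. 0)" if "y \<in> L" "\<And>t. y t = 0 \<or> y t = db" for y
  proof (rule transversal_zero[OF db_free that(1)])
    show "aligned (\<lambda>_. db) V y" unfolding aligned_def using that(2) by simp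
  qed
  show ?thesis
  proof (cases "x u = ds")
    case True
    let ?y = "\<lambda>t. if t = u \<or> t = v then x t + da else x t"
    have "?y = (\<lambda>_. 0)" using shift[OF x(1)] off True x by (intro dbz) auto
    then have "?y u = 0" by (rule fun_cong)
    then show ?thesis using True by simp
  next
    case False
    then have "x u = 0 \<or> x u = db" using x(3) by (cases "x u" rule: dir_cases) auto
    then show ?thesis using x off by (intro dbz) metis+
  qed
qed

lemma transfer_odd:
  assumes pu: "p u = ds" "p v = ds"
  shows "transversal V L p \<longleftrightarrow> transversal V' L' p"
    and "\<And>i j. i \<in> V - {u, v} \<Longrightarrow> j \<in> V - {u, v} \<Longrightarrow> fund V L p i j \<longleftrightarrow> fund V' L' p i j"
proof -
  have fwd: "\<exists>x'\<in>L'. aligned p {} x' \<and> (\<forall>t\<in>V - {u, v}. x' t = x t) \<and> (x' = (\<lambda>_. 0) \<longrightarrow> x = (\<lambda>_. 0))"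
    if x: "x \<in> L" "aligned p {u, v} x" for x
  proof (intro bexI[of _ "clr x"] conjI)
    have c: "x u = 0 \<or> x u = ds" "x v = 0 \<or> x v = ds" using x(2) pu unfolding aligned_def by auto
    then show "clr x \<in> L'" by (rule cut_mem[OF x(1)])
    have "x u = x v" "x u \<noteq> da" using orth_uv[OF x(1)] c by auto
    then show "clr x = (\<lambda>_. 0) \<longrightarrow> x = (\<lambda>_. 0)" using cut_kernel[OF x(1)] by blast
  qed (auto simp: aligned_def)
  have bwd: "\<exists>x\<in>L. aligned p {u, v} x \<and> (\<forall>t\<in>V - {u, v}. x' t = x t) \<and> (x = (\<lambda>_. 0) \<longrightarrow> x' = (\<lambda>_. 0))"
    if x': "x' \<in> L'" for x'
  proof -
    obtain x where "x \<in> L" "x u = 0 \<or> x u = ds" "x v = 0 \<or> x v = ds" "x' = clr x" using cut_lift[OF x'] by blast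
    then show ?thesis using pu by (intro bexI[of _ x]) (auto simp: aligned_def)
  qed
  have a: "{u, v} \<subseteq> V" "{} \<subseteq> V'" "V - {u, v} = V' - {}" "\<And>t. t \<in> V - {u, v} \<Longrightarrow> p t = p t"
    using uv V' by auto
  show "transversal V L p \<longleftrightarrow> transversal V' L' p" using transfer_id(1)[OF a fwd bwd] .
  show "fund V L p i j \<longleftrightarrow> fund V' L' p i j" if "i \<in> V - {u, v}" "j \<in> V - {u, v}" for i j
    using transfer_id(2)[OF a fwd bwd that] .
qed

lemma knot_iff: "knot \<longleftrightarrow> transversal V' L' (\<lambda>_. ds)"
  by (rule transfer_odd(1)) simp_all

lemma transfer_db:
  assumes pu: "p u = ds" "p v = ds"
  shows "transversal V L (p(u := db, v := db)) \<longleftrightarrow> transversal V' L' p"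
    and "\<And>i j. i \<in> V - {u, v} \<Longrightarrow> j \<in> V - {u, v} \<Longrightarrow> fund V L (p(u := db, v := db)) i j \<longleftrightarrow> fund V' L' p i j"
proof -
  let ?p = "p(u := db, v := db)"
  have fwd: "\<exists>x'\<in>L'. aligned p {} x' \<and> (\<forall>t\<in>V - {u, v}. x' t = x t) \<and> (x' = (\<lambda>_. 0) \<longrightarrow> x = (\<lambda>_. 0))"
    if x: "x \<in> L" "aligned ?p {u, v} x" for x
  proof (intro bexI[of _ "clr x"] conjI)
    have c: "x u = 0 \<or> x u = db" "x v = 0 \<or> x v = db" using x(2) uv unfolding aligned_def by auto
    then have e: "x u = x v" using orth_uv[OF x(1)] by auto
    then show "clr x \<in> L'" using x(1) c unfolding L' by blast
    have "x u \<noteq> da" using c(1) by auto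
    then show "clr x = (\<lambda>_. 0) \<longrightarrow> x = (\<lambda>_. 0)" using cut_kernel[OF x(1) e] by blast
  qed (auto simp: aligned_def)
  have bwd: "\<exists>x\<in>L. aligned ?p {u, v} x \<and> (\<forall>t\<in>V - {u, v}. x' t = x t) \<and> (x = (\<lambda>_. 0) \<longrightarrow> x' = (\<lambda>_. 0))"
    if x': "x' \<in> L'" for x'
  proof -
    obtain x where "x \<in> L" "x u = x v" "x u = 0 \<or> x u = db" "x' = clr x" using x' unfolding L' by blast
    then show ?thesis using pu by (intro bexI[of _ x]) (auto simp: aligned_def)
  qed
  have a: "{u, v} \<subseteq> V" "{} \<subseteq> V'" "V - {u, v} = V' - {}" "\<And>t. t \<in> V - {u, v} \<Longrightarrow> p t = ?p t"
    using uv V' by auto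
  show "transversal V L ?p \<longleftrightarrow> transversal V' L' p" using transfer_id(1)[OF a fwd bwd] .
  show "fund V L ?p i j \<longleftrightarrow> fund V' L' p i j" if "i \<in> V - {u, v}" "j \<in> V - {u, v}" for i j
    using transfer_id(2)[OF a fwd bwd that] .
qed

lemma transfer_mixed:
  shows "transversal V L (p(u := da, v := db)) \<longleftrightarrow> transversal V L (p(u := db, v := da))"
    and "\<And>i j. i \<in> V - {u, v} \<Longrightarrow> j \<in> V - {u, v} \<Longrightarrow>
      fund V L (p(u := da, v := db)) i j \<longleftrightarrow> fund V L (p(u := db, v := da)) i j"
proof -
  let ?p1 = "p(u := da, v := db)" and ?p2 = "p(u := db, v := da)"
  have fwd: "\<exists>x'\<in>L. aligned ?p2 {u, v} x' \<and> (\<forall>t\<in>V - {u, v}. x' t = x t) \<and> (x' = (\<lambda>_. 0) \<longrightarrow> x = (\<lambda>_. 0))"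
    if x: "x \<in> L" "aligned ?p1 {u, v} x" for x
  proof -
    have c: "x u = 0 \<or> x u = da" "x v = 0 \<or> x v = db" using x(2) uv unfolding aligned_def by auto
    then have e: "x v = 0" using orth_uv[OF x(1)] by auto
    let ?y = "\<lambda>t. if t = u \<or> t = v then x t + da else x t"
    show ?thesis
    proof (cases "x u = 0")
      case True
      then show ?thesis using x e by (intro bexI[of _ x]) (auto simp: aligned_def)
    next
      case False
      have "?y \<noteq> (\<lambda>_. 0)" using e by (auto dest: fun_cong[of _ _ v])
      then show ?thesis using shift[OF x(1)] c e False uv by (intro bexI[of _ ?y]) (auto simp: aligned_def)
    qed
  qed
  have bwd: "\<exists>x'\<in>L. aligned ?p1 {u, v} x' \<and> (\<forall>t\<in>V - {u, v}. x t = x' t) \<and> (x' = (\<lambda>_. 0) \<longrightarrow> x = (\<lambda>_. 0))"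
    if x: "x \<in> L" "aligned ?p2 {u, v} x" for x
  proof -
    have c: "x u = 0 \<or> x u = db" "x v = 0 \<or> x v = da" using x(2) uv unfolding aligned_def by auto
    then have e: "x u = 0" using orth_uv[OF x(1)] by auto
    let ?y = "\<lambda>t. if t = u \<or> t = v then x t + da else x t"
    show ?thesis
    proof (cases "x v = 0")
      case True
      then show ?thesis using x e by (intro bexI[of _ x]) (auto simp: aligned_def)
    next
      case False
      have "?y \<noteq> (\<lambda>_. 0)" using e by (auto dest: fun_cong[of _ _ u])
      then show ?thesis using shift[OF x(1)] c e False uv by (intro bexI[of _ ?y]) (auto simp: aligned_def)
    qed
  qed
  have a: "{u, v} \<subseteq> V" "{u, v} \<subseteq> V" "V - {u, v} = V - {u, v}" "\<And>t. t \<in> V - {u, v} \<Longrightarrow> ?p2 t = ?p1 t"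
    using uv by auto
  show "transversal V L ?p1 \<longleftrightarrow> transversal V L ?p2" using transfer_id(1)[OF a fwd bwd] .
  show "fund V L ?p1 i j \<longleftrightarrow> fund V L ?p2 i j" if "i \<in> V - {u, v}" "j \<in> V - {u, v}" for i j
    using transfer_id(2)[OF a fwd bwd that] .
qed

lemma evens_after:
  assumes k: knot
  shows "evens V' L' = evens V L - {u, v}" and "u \<in> evens V L \<longleftrightarrow> v \<in> evens V L"
proof -
  interpret I': isotropic_system V' L' by (rule I')
  have k': "transversal V' L' (\<lambda>_. ds)" using k knot_iff by simp
  have qr: "q r2 = 0" unfolding q_def by (intro sum.neutral) auto
  have qcut: "q x = I'.q (clr x)" if "x u = x v" for x
  proof -
    have "q x = quad (x u) + quad (x v) + (\<Sum>t\<in>V'. quad (x t))"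
      unfolding q_def V' using fin uv
      by (subst sum.remove[of V u]) (auto simp: sum.remove[of "V - {u}" v] Diff_insert2[symmetric] add.assoc)
    also have "quad (x u) + quad (x v) = 0" using that by (cases "quad (x v)") auto
    also have "(\<Sum>t\<in>V'. quad (x t)) = I'.q (clr x)" unfolding I'.q_def by (intro sum.cong) (auto simp: V')
    finally show ?thesis by simp
  qed
  have "i \<in> evens V L \<longleftrightarrow> i \<in> evens V' L'" if i: "i \<in> V'" for i
  proof -
    have iV: "i \<in> V" "i \<noteq> u" "i \<noteq> v" using i V' by auto
    obtain x where x: "x \<in> L" "fundamental (\<lambda>_. ds) V i x"
      using ex_fundamental[OF k ds_neq iV(1)] by auto
    have c: "x u = 0 \<or> x u = ds" "x v = 0 \<or> x v = ds"
      using x(2) iV uv unfolding fundamental_def aligned_def by auto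
    then have e: "x u = x v" using orth_uv[OF x(1)] by auto
    have x': "clr x \<in> L'" "fundamental (\<lambda>_. ds) V' i (clr x)"
      using cut_mem[OF x(1) c] x(2) iV unfolding V' fundamental_def aligned_def by auto
    show ?thesis
      using evens_iff[OF k x iV(1)] I'.evens_iff[OF k' x' i] qcut[OF e] by simp
  qed
  then show "evens V' L' = evens V L - {u, v}"
    using V' unfolding evens_def by blast
  obtain x where x: "x \<in> L" "fundamental (\<lambda>_. ds) V u x"
    using ex_fundamental[OF k ds_neq uv(1)] by auto
  have c: "x v = 0 \<or> x v = ds" "x u \<noteq> 0" "x u \<noteq> ds"
    using x(2) uv unfolding fundamental_def aligned_def by auto
  let ?y = "\<lambda>t. x t + r2 t"
  have "?y v \<noteq> 0" "?y v \<noteq> ds" "?y u = 0 \<or> ?y u = ds"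
    using c orth_uv[OF x(1)] by (auto, (cases "x u" rule: dir_cases; auto)+)
  then have y: "?y \<in> L" "fundamental (\<lambda>_. ds) V v ?y"
    using add[OF x(1) r] x(2) unfolding fundamental_def aligned_def by auto
  show "u \<in> evens V L \<longleftrightarrow> v \<in> evens V L"
    using evens_iff[OF k x uv(1)] evens_iff[OF k y uv(2)] q_add[OF x(1) r] qr by simp
qed

lemma bracket_iff:
  assumes k: knot
  shows "parity_bracket V L \<longleftrightarrow> parity_bracket V' L'"
proof -
  interpret I': isotropic_system V' L' by (rule I')
  let ?S = "evens V L"
  note ev = evens_after(1)[OF k]
  show ?thesis
  proof (cases "u \<in> ?S")
    case True
    then have S: "u \<in> ?S" "v \<in> ?S" using evens_after(2)[OF k] by auto
    let ?T = "?S - {v} - {u}"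
    have ST: "V - ?S = V' - ?T" using V' S by blast
    have fT: "finite (?S - {v})" "u \<in> ?S - {v}" using finite_evens S uv by auto
    have "count_states ?S (alive V L ?S) =
        count_states ?T (\<lambda>p. alive V L ?S (p(u := da, v := da))) + count_states ?T (\<lambda>p. alive V L ?S (p(u := db, v := da)))
      + (count_states ?T (\<lambda>p. alive V L ?S (p(u := da, v := db))) + count_states ?T (\<lambda>p. alive V L ?S (p(u := db, v := db))))"
      unfolding count_states_split[OF finite_evens S(2)] by (simp only: count_states_split[OF fT])
    also have "count_states ?T (\<lambda>p. alive V L ?S (p(u := da, v := da))) = 0"
    proof (rule count_states_0)
      fix p
      have "aligned (p(u := da, v := da)) V r2" unfolding aligned_def by auto
      moreover have "r2 \<noteq> (\<lambda>_. 0)" by (auto dest: fun_cong[of _ _ v])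
      ultimately show "\<not> alive V L ?S (p(u := da, v := da))" using r unfolding alive_def transversal_def by blast
    qed
    also have "count_states ?T (\<lambda>p. alive V L ?S (p(u := db, v := da))) = count_states ?T (\<lambda>p. alive V L ?S (p(u := da, v := db)))"
      using transfer_mixed S by (intro count_states_cong alive_cong) auto
    also have "count_states ?T (\<lambda>p. alive V L ?S (p(u := db, v := db))) = count_states ?T (alive V' L' ?T)"
    proof (rule count_states_cong)
      fix p assume "p \<in> states ?T"
      then have "p u = ds" "p v = ds" unfolding states_def by auto
      from transfer_db[OF this] show "alive V L ?S (p(u := db, v := db)) \<longleftrightarrow> alive V' L' ?T p"
        using S by (intro alive_cong[OF _ ST]) auto
    qed
    finally show ?thesis unfolding parity_bracket_def ev by (auto simp: Diff_insert2[symmetric] insert_commute)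
  next
    case False
    then have S: "u \<notin> ?S" "v \<notin> ?S" using evens_after(2)[OF k] by auto
    have "count_states ?S (alive V L ?S) = count_states ?S (alive V' L' ?S)"
    proof (rule count_states_cong)
      fix p assume p: "p \<in> states ?S"
      then have pu: "p u = ds" "p v = ds" using S unfolding states_def by auto
      note tr = transfer_odd(1)[OF pu] and fu = transfer_odd(2)[OF pu]
      have tw: "twins (V - ?S) (fund V L p) u v" if "transversal V L p"
        using S uv pu by (intro twins_fund[OF that states_neq_0[OF p] _ r]) (auto simp: aligned_def)
      have "V - ?S - {u, v} = V' - ?S" using V' by blast
      then have "reduces_to_W5 (V - ?S) (fund V L p) \<longleftrightarrow> reduces_to_W5 (V' - ?S) (fund V' L' p)"
        if t: "transversal V L p"
        using reduces_fund_twins[OF t states_neq_0[OF p] _ tw[OF t]]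
          reduces_cong[of "V' - ?S" "fund V L p" "fund V' L' p"] fu V' by auto
      then show "alive V L ?S p \<longleftrightarrow> alive V' L' ?S p" using tr unfolding alive_def by blast
    qed
    moreover have "evens V' L' = ?S" using ev S by auto
    ultimately show ?thesis unfolding parity_bracket_def by simp
  qed
qed

end

section \<open>The third move: a triangle\<close>

definition twist :: "bit \<times> bit \<Rightarrow> bit \<times> bit" where
  "twist k = (if sform k ds = 1 then ds else 0)"

text \<open>The third move is the transvection along the vector with entries \<open>ds\<close> at the three vertices.\<close>

definition transvect :: "nat \<Rightarrow> nat \<Rightarrow> nat \<Rightarrow> (nat \<Rightarrow> bit \<times> bit) \<Rightarrow> nat \<Rightarrow> bit \<times> bit" where
  "transvect u v w x = (\<lambda>t. if t = u \<or> t = v \<or> t = w then x t + twist (x u + x v + x w) else x t)"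

lemma twist_simps [simp]:
  "twist 0 = 0" "twist da = ds" "twist db = ds" "twist ds = 0"
  by (simp_all add: twist_def)

lemma twist_cases: "twist k = 0 \<or> twist k = ds" by (simp add: twist_def)

lemma twist_add_da: "twist (k + da) = twist k + ds"
  by (cases k rule: dir_cases) auto

text \<open>A finite condition on the entries at the three vertices. It says that a vector with entries in
  \<open>{0, a}\<close>, \<open>{0, b}\<close>, \<open>{0, c}\<close> that is orthogonal to the vector \<open>d, d, d\<close> of the move acquires
  entries in \<open>{0, a'}\<close>, \<open>{0, b'}\<close>, \<open>{0, c'}\<close> under the transvection, if necessary after addition of
  that vector. The transvection turns \<open>d, d, d\<close> into \<open>d', d', d'\<close> and adds the same element \<open>e\<close> at all
  three vertices. The addition must not be applied to \<open>d, d, d\<close> itself, since this might give zero.\<close>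

definition triple_step where
  "triple_step d d' a b c a' b' c' \<longleftrightarrow>
    (\<forall>k1\<in>{0, a}. \<forall>k2\<in>{0, b}. \<forall>k3\<in>{0, c}. sform (k1 + k2 + k3) d = 0 \<longrightarrow>
      (let e = twist (k1 + k2 + k3) in
        k1 + e \<in> {0, a'} \<and> k2 + e \<in> {0, b'} \<and> k3 + e \<in> {0, c'} \<or>
        \<not> (k1 = d \<and> k2 = d \<and> k3 = d) \<and>
        k1 + e + d' \<in> {0, a'} \<and> k2 + e + d' \<in> {0, b'} \<and> k3 + e + d' \<in> {0, c'}))"

lemma twist_add_twist: "twist (k + twist k) = twist k"
  by (cases k rule: dir_cases) auto

lemma transvect_transvect:
  assumes "u \<noteq> v" "u \<noteq> w" "v \<noteq> w" shows "transvect u v w (transvect u v w x) = x"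
proof
  fix t
  have e: "transvect u v w x u + transvect u v w x v + transvect u v w x w
      = x u + x v + x w + twist (x u + x v + x w)"
    using assms by (simp add: transvect_def ac_simps)
  show "transvect u v w (transvect u v w x) t = x t"
    unfolding transvect_def[of u v w "transvect u v w x"] e twist_add_twist
    by (auto simp: transvect_def add.assoc)
qed

locale third_move = isotropic_system +
  fixes u v w L'
  assumes uvw: "u \<in> V" "v \<in> V" "w \<in> V" "u \<noteq> v" "u \<noteq> w" "v \<noteq> w"
    and r: "(\<lambda>t. if t = u \<or> t = v \<or> t = w then da else 0) \<in> L"
    and L': "L' = transvect u v w ` L"
    and I': "isotropic_system V L'"
begin

abbreviation "r3 \<equiv> \<lambda>t. if t = u \<or> t = v \<or> t = w then da else (0 :: bit \<times> bit)"

abbreviation "tau \<equiv> transvect u v w"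

lemma orth_L: "x \<in> L \<Longrightarrow> sform (x u + x v + x w) da = 0"
  using orth[OF r, of x "{u, v, w}"] uvw by (simp add: add.assoc)

lemma shift:
  assumes "x \<in> L" shows "(\<lambda>t. if t = u \<or> t = v \<or> t = w then x t + da else x t) \<in> L"
proof -
  have "(\<lambda>t. x t + r3 t) = (\<lambda>t. if t = u \<or> t = v \<or> t = w then x t + da else x t)" by auto
  then show ?thesis using add[OF assms r] by simp
qed

lemma tau_apply:
  "tau x u = x u + twist (x u + x v + x w)" "tau x v = x v + twist (x u + x v + x w)"
  "tau x w = x w + twist (x u + x v + x w)" "t \<noteq> u \<Longrightarrow> t \<noteq> v \<Longrightarrow> t \<noteq> w \<Longrightarrow> tau x t = x t"
  by (simp_all add: transvect_def)

lemma tau_sum: "tau x u + tau x v + tau x w = x u + x v + x w + twist (x u + x v + x w)"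
  unfolding tau_apply by (simp add: ac_simps)

lemma tau_tau: "tau (tau x) = x"
  using uvw by (intro transvect_transvect)

lemma tau_0: "tau (\<lambda>_. 0) = (\<lambda>_. 0)"
  by (rule ext) (simp add: transvect_def)

lemma tau_eq_0: "tau x = (\<lambda>_. 0) \<longleftrightarrow> x = (\<lambda>_. 0)"
  using tau_tau[of x] tau_0 by metis

lemma orth_L':
  assumes "x' \<in> L'" shows "sform (x' u + x' v + x' w) db = 0"
proof -
  obtain x where x: "x \<in> L" "x' = tau x" using assms unfolding L' by blast
  show ?thesis
    using orth_L[OF x(1)] unfolding x(2) tau_sum
    by (cases "x u + x v + x w" rule: dir_cases) auto
qed

text \<open>The counterpart of \<open>x\<close> after the move is its image, or the image of its sum with the vector of the
  move. The latter adds \<open>da\<close> and, since it changes the twist, \<open>ds\<close>, so \<open>db\<close> in total.\<close>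

lemma choose_fwd:
  assumes x: "x \<in> L" and e: "e = twist (x u + x v + x w)"
    and P: "P (x u + e) (x v + e) (x w + e) \<or>
      \<not> (x u = da \<and> x v = da \<and> x w = da) \<and> P (x u + e + db) (x v + e + db) (x w + e + db)"
  shows "\<exists>x'\<in>L'. P (x' u) (x' v) (x' w) \<and> (\<forall>t. t \<noteq> u \<longrightarrow> t \<noteq> v \<longrightarrow> t \<noteq> w \<longrightarrow> x' t = x t) \<and>
    (x' = (\<lambda>_. 0) \<longrightarrow> x = (\<lambda>_. 0))"
  using P
proof
  assume "P (x u + e) (x v + e) (x w + e)"
  then show ?thesis using x e tau_eq_0[of x] unfolding L'
    by (intro bexI[of _ "tau x"]) (simp_all add: tau_apply)
next
  let ?y = "\<lambda>t. if t = u \<or> t = v \<or> t = w then x t + da else x t"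
  assume P: "\<not> (x u = da \<and> x v = da \<and> x w = da) \<and> P (x u + e + db) (x v + e + db) (x w + e + db)"
  have "?y u + ?y v + ?y w = (x u + x v + x w) + da" by (simp add: ac_simps)
  then have "twist (?y u + ?y v + ?y w) = e + ds"
    unfolding e by (simp only: twist_add_da)
  moreover have "k + da + (e + ds) = k + e + db" for k by (simp add: ac_simps)
  ultimately have "tau ?y u = x u + e + db" "tau ?y v = x v + e + db" "tau ?y w = x w + e + db"
    by (simp_all add: tau_apply(1,2,3))
  moreover have "?y \<noteq> (\<lambda>_. 0)"
  proof
    assume "?y = (\<lambda>_. 0)"
    then have "?y t = 0" for t by (rule fun_cong)
    from this[of u] this[of v] this[of w] show False using P by simp
  qed
  ultimately show ?thesis using shift[OF x] P tau_eq_0[of ?y] unfolding L'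
    by (intro bexI[of _ "tau ?y"]) (simp_all add: tau_apply(4))
qed

lemma choose_bwd:
  assumes x': "x' \<in> L'" and e: "e = twist (x' u + x' v + x' w)"
    and P: "P (x' u + e) (x' v + e) (x' w + e) \<or>
      \<not> (x' u = db \<and> x' v = db \<and> x' w = db) \<and> P (x' u + e + da) (x' v + e + da) (x' w + e + da)"
  shows "\<exists>x\<in>L. P (x u) (x v) (x w) \<and> (\<forall>t. t \<noteq> u \<longrightarrow> t \<noteq> v \<longrightarrow> t \<noteq> w \<longrightarrow> x' t = x t) \<and>
    (x = (\<lambda>_. 0) \<longrightarrow> x' = (\<lambda>_. 0))"
proof -
  have y: "tau x' \<in> L" using x' unfolding L' by (auto simp: tau_tau)
  show ?thesis using P
  proof
    assume "P (x' u + e) (x' v + e) (x' w + e)"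
    then show ?thesis using y e tau_eq_0[of x']
      by (intro bexI[of _ "tau x'"]) (simp_all add: tau_apply)
  next
    let ?y = "\<lambda>t. if t = u \<or> t = v \<or> t = w then tau x' t + da else tau x' t"
    assume P: "\<not> (x' u = db \<and> x' v = db \<and> x' w = db) \<and> P (x' u + e + da) (x' v + e + da) (x' w + e + da)"
    have "?y \<noteq> (\<lambda>_. 0)"
    proof
      assume "?y = (\<lambda>_. 0)"
      then have "?y t = 0" for t by (rule fun_cong)
      from this[of u] this[of v] this[of w]
      have "x' u + e = da" "x' v + e = da" "x' w + e = da" by (simp_all add: tau_apply e)
      then have k: "x' u = da + e" "x' v = da + e" "x' w = da + e"
        by (metis add.assoc add.commute dir_add_assoc)+
      then have "x' u + x' v + x' w = da + e" by (simp add: ac_simps)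
      then have "e = ds" using e twist_cases[of "x' u + x' v + x' w"] by auto
      then show False using P k by simp
    qed
    then show ?thesis using shift[OF y] P
      by (intro bexI[of _ ?y]) (simp_all add: tau_apply e)
  qed
qed

lemma triple_transfer:
  assumes a: "\<And>t. t \<noteq> u \<Longrightarrow> t \<noteq> v \<Longrightarrow> t \<noteq> w \<Longrightarrow> p' t = p t"
    and f: "triple_step da db (p u) (p v) (p w) (p' u) (p' v) (p' w)"
    and b: "triple_step db da (p' u) (p' v) (p' w) (p u) (p v) (p w)"
  shows "transversal V L p \<longleftrightarrow> transversal V L' p'"
    and "\<And>i j. i \<in> V - {u, v, w} \<Longrightarrow> j \<in> V - {u, v, w} \<Longrightarrow> fund V L p i j \<longleftrightarrow> fund V L' p' i j"
proof -
  let ?D = "{u, v, w}"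
  have al: "aligned p ?D x \<longleftrightarrow> x u \<in> {0, p u} \<and> x v \<in> {0, p v} \<and> x w \<in> {0, p w}" for p x
    unfolding aligned_def by auto
  have fwd: "\<exists>x'\<in>L'. aligned p' ?D x' \<and> (\<forall>t\<in>V - ?D. x' t = x t) \<and> (x' = (\<lambda>_. 0) \<longrightarrow> x = (\<lambda>_. 0))"
    if x: "x \<in> L" "aligned p ?D x" for x
  proof -
    have "\<exists>x'\<in>L'. (x' u \<in> {0, p' u} \<and> x' v \<in> {0, p' v} \<and> x' w \<in> {0, p' w}) \<and>
      (\<forall>t. t \<noteq> u \<longrightarrow> t \<noteq> v \<longrightarrow> t \<noteq> w \<longrightarrow> x' t = x t) \<and> (x' = (\<lambda>_. 0) \<longrightarrow> x = (\<lambda>_. 0))"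
      using f x(2) orth_L[OF x(1)] unfolding al Let_def triple_step_def
      by (intro choose_fwd[OF x(1) refl, where P = "\<lambda>k1 k2 k3. k1 \<in> {0, p' u} \<and> k2 \<in> {0, p' v} \<and> k3 \<in> {0, p' w}"]) blast
    then show ?thesis unfolding al by blast
  qed
  have bwd: "\<exists>x\<in>L. aligned p ?D x \<and> (\<forall>t\<in>V - ?D. x' t = x t) \<and> (x = (\<lambda>_. 0) \<longrightarrow> x' = (\<lambda>_. 0))"
    if x': "x' \<in> L'" "aligned p' ?D x'" for x'
  proof -
    have "\<exists>x\<in>L. (x u \<in> {0, p u} \<and> x v \<in> {0, p v} \<and> x w \<in> {0, p w}) \<and>
      (\<forall>t. t \<noteq> u \<longrightarrow> t \<noteq> v \<longrightarrow> t \<noteq> w \<longrightarrow> x' t = x t) \<and> (x = (\<lambda>_. 0) \<longrightarrow> x' = (\<lambda>_. 0))"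
      using b x'(2) orth_L'[OF x'(1)] unfolding al Let_def triple_step_def
      by (intro choose_bwd[OF x'(1) refl, where P = "\<lambda>k1 k2 k3. k1 \<in> {0, p u} \<and> k2 \<in> {0, p v} \<and> k3 \<in> {0, p w}"]) blast
    then show ?thesis unfolding al by blast
  qed
  have D: "?D \<subseteq> V" "?D \<subseteq> V" "V - ?D = V - ?D" "\<And>t. t \<in> V - ?D \<Longrightarrow> p' t = p t" using uvw a by auto
  show "transversal V L p \<longleftrightarrow> transversal V L' p'" using transfer_id(1)[OF D fwd bwd] .
  show "fund V L p i j \<longleftrightarrow> fund V L' p' i j" if "i \<in> V - ?D" "j \<in> V - ?D" for i j
    using transfer_id(2)[OF D fwd bwd that] .
qed

text \<open>If exactly one vertex \<open>u\<close> of the triangle is even, then one of its smoothings makes the graphs before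
  and after the move differ by an exchange of the other two vertices only.\<close>

lemma swapped_transfer:
  fixes p
  defines "\<pi> \<equiv> Transposition.transpose v w"
  assumes p: "p v = ds" "p w = ds"
  shows "transversal V L (p(u := db)) \<longleftrightarrow> transversal V L' (p(u := da))"
    and "\<And>i j. i \<in> V - {u} \<Longrightarrow> j \<in> V - {u} \<Longrightarrow> fund V L (p(u := db)) i j \<longleftrightarrow> fund V L' (p(u := da)) (\<pi> i) (\<pi> j)"
proof -
  have kf: "k1 \<in> {0, db} \<Longrightarrow> sform (k1 + k2 + k3) da = 0 \<Longrightarrow>
      (k1 + twist (k1 + k2 + k3) \<in> {0, da} \<and> k2 + twist (k1 + k2 + k3) = k3 \<and> k3 + twist (k1 + k2 + k3) = k2) \<or>
      \<not> (k1 = da \<and> k2 = da \<and> k3 = da) \<and>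
      (k1 + twist (k1 + k2 + k3) + db \<in> {0, da} \<and> k2 + twist (k1 + k2 + k3) + db = k3 \<and>
        k3 + twist (k1 + k2 + k3) + db = k2)" for k1 k2 k3
    by (cases k2 rule: dir_cases; cases k3 rule: dir_cases) auto
  have kb: "k1 \<in> {0, da} \<Longrightarrow> sform (k1 + k2 + k3) db = 0 \<Longrightarrow>
      (k1 + twist (k1 + k2 + k3) \<in> {0, db} \<and> k2 + twist (k1 + k2 + k3) = k3 \<and> k3 + twist (k1 + k2 + k3) = k2) \<or>
      \<not> (k1 = db \<and> k2 = db \<and> k3 = db) \<and>
      (k1 + twist (k1 + k2 + k3) + da \<in> {0, db} \<and> k2 + twist (k1 + k2 + k3) + da = k3 \<and>
        k3 + twist (k1 + k2 + k3) + da = k2)" for k1 k2 k3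
    by (cases k2 rule: dir_cases; cases k3 rule: dir_cases) auto
  have \<pi>: "\<pi> v = w" "\<pi> w = v" "\<And>t. t \<noteq> v \<Longrightarrow> t \<noteq> w \<Longrightarrow> \<pi> t = t"
    unfolding \<pi>_def by simp_all
  have sim: "\<forall>t\<in>V - {u}. (x' (\<pi> t) = 0 \<longleftrightarrow> x t = 0) \<and> (x' (\<pi> t) = (p(u := da)) (\<pi> t) \<longleftrightarrow> x t = (p(u := db)) t)"
    if "x' v = x w" "x' w = x v" "\<And>t. t \<noteq> u \<Longrightarrow> t \<noteq> v \<Longrightarrow> t \<noteq> w \<Longrightarrow> x' t = x t" for x x'
  proof
    fix t assume t: "t \<in> V - {u}"
    consider "t = v" | "t = w" | "t \<noteq> v" "t \<noteq> w" by blast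
    then show "(x' (\<pi> t) = 0 \<longleftrightarrow> x t = 0) \<and> (x' (\<pi> t) = (p(u := da)) (\<pi> t) \<longleftrightarrow> x t = (p(u := db)) t)"
    proof cases
      case 1
      then show ?thesis using uvw by (simp add: \<pi>(1) that(2) p)
    next
      case 2
      then show ?thesis using uvw by (simp add: \<pi>(2) that(1) p)
    next
      case 3
      then show ?thesis using t that(3)[of t] by (simp add: \<pi>(3)[OF 3])
    qed
  qed
  have fwd: "\<exists>x'\<in>L'. aligned (p(u := da)) {u} x' \<and>
      (\<forall>t\<in>V - {u}. (x' (\<pi> t) = 0 \<longleftrightarrow> x t = 0) \<and> (x' (\<pi> t) = (p(u := da)) (\<pi> t) \<longleftrightarrow> x t = (p(u := db)) t)) \<and>
      (x' = (\<lambda>_. 0) \<longrightarrow> x = (\<lambda>_. 0))"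
    if x: "x \<in> L" "aligned (p(u := db)) {u} x" for x
  proof -
    have k: "x u \<in> {0, db}" using x(2) unfolding aligned_def by auto
    have "\<exists>x'\<in>L'. (x' u \<in> {0, da} \<and> x' v = x w \<and> x' w = x v) \<and>
      (\<forall>t. t \<noteq> u \<longrightarrow> t \<noteq> v \<longrightarrow> t \<noteq> w \<longrightarrow> x' t = x t) \<and> (x' = (\<lambda>_. 0) \<longrightarrow> x = (\<lambda>_. 0))"
      by (rule choose_fwd[OF x(1) refl, where P = "\<lambda>k1 k2 k3. k1 \<in> {0, da} \<and> k2 = x w \<and> k3 = x v", OF kf[OF k orth_L[OF x(1)]]])
    then obtain x' where "x' \<in> L'" "x' u \<in> {0, da}" "x' v = x w" "x' w = x v"
      "\<And>t. t \<noteq> u \<Longrightarrow> t \<noteq> v \<Longrightarrow> t \<noteq> w \<Longrightarrow> x' t = x t" "x' = (\<lambda>_. 0) \<longrightarrow> x = (\<lambda>_. 0)" by blast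
    then show ?thesis using sim[of x' x] by (intro bexI[of _ x'] conjI) (simp_all add: aligned_def)
  qed
  have bwd: "\<exists>x\<in>L. aligned (p(u := db)) {u} x \<and>
      (\<forall>t\<in>V - {u}. (x' (\<pi> t) = 0 \<longleftrightarrow> x t = 0) \<and> (x' (\<pi> t) = (p(u := da)) (\<pi> t) \<longleftrightarrow> x t = (p(u := db)) t)) \<and>
      (x = (\<lambda>_. 0) \<longrightarrow> x' = (\<lambda>_. 0))"
    if x': "x' \<in> L'" "aligned (p(u := da)) {u} x'" for x'
  proof -
    have k: "x' u \<in> {0, da}" using x'(2) unfolding aligned_def by auto
    have "\<exists>x\<in>L. (x u \<in> {0, db} \<and> x v = x' w \<and> x w = x' v) \<and>
      (\<forall>t. t \<noteq> u \<longrightarrow> t \<noteq> v \<longrightarrow> t \<noteq> w \<longrightarrow> x' t = x t) \<and> (x = (\<lambda>_. 0) \<longrightarrow> x' = (\<lambda>_. 0))"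
      by (rule choose_bwd[OF x'(1) refl, where P = "\<lambda>k1 k2 k3. k1 \<in> {0, db} \<and> k2 = x' w \<and> k3 = x' v", OF kb[OF k orth_L'[OF x'(1)]]])
    then obtain x where "x \<in> L" "x u \<in> {0, db}" "x v = x' w" "x w = x' v"
      "\<And>t. t \<noteq> u \<Longrightarrow> t \<noteq> v \<Longrightarrow> t \<noteq> w \<Longrightarrow> x' t = x t" "x = (\<lambda>_. 0) \<longrightarrow> x' = (\<lambda>_. 0)" by blast
    then show ?thesis using sim[of x' x] by (intro bexI[of _ x] conjI) (simp_all add: aligned_def)
  qed
  have "\<pi> ` (V - {u}) = V - {u}"
    unfolding \<pi>_def using uvw by (intro transpose_image_eq) auto
  moreover have "inj_on \<pi> (V - {u})" unfolding \<pi>_def by (rule inj_on_transpose)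
  ultimately have D: "{u} \<subseteq> V" "{u} \<subseteq> V" "\<pi> ` (V - {u}) = V - {u}" "inj_on \<pi> (V - {u})" using uvw by auto
  show "transversal V L (p(u := db)) \<longleftrightarrow> transversal V L' (p(u := da))"
    by (rule transfer(1)[where \<pi> = \<pi> and D = "{u}" and D' = "{u}", OF D]) (fact fwd bwd)+
  show "fund V L (p(u := db)) i j \<longleftrightarrow> fund V L' (p(u := da)) (\<pi> i) (\<pi> j)" if "i \<in> V - {u}" "j \<in> V - {u}" for i j
    by (rule transfer(2)[where \<pi> = \<pi> and D = "{u}" and D' = "{u}", OF D _ _ that]) (fact fwd bwd)+
qed

lemma fundamental_tau:
  assumes "fundamental (\<lambda>_. ds) V i x" shows "fundamental (\<lambda>_. ds) V i (tau x)"
proof -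
  have "k + twist m = 0 \<or> k + twist m = ds \<longleftrightarrow> k = 0 \<or> k = ds" for k m
    using twist_cases[of m] by (cases k rule: dir_cases) auto
  then have "tau x t = 0 \<or> tau x t = ds \<longleftrightarrow> x t = 0 \<or> x t = ds" for t
    unfolding transvect_def by simp
  then show ?thesis using assms unfolding fundamental_def aligned_def by blast
qed

lemma knot_iff: "knot \<longleftrightarrow> transversal V L' (\<lambda>_. ds)"
  by (rule triple_transfer(1)) (simp_all add: triple_step_def)

lemma q_tau: "q (tau x) = q x"
proof -
  have split: "q y = quad (y u) + (quad (y v) + (quad (y w) + (\<Sum>t\<in>V - {u} - {v} - {w}. quad (y t))))" for y
    unfolding q_def using fin uvw
    by (subst sum.remove[of V u], simp, simp, subst sum.remove[of "V - {u}" v], simp, simp,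
      subst sum.remove[of "V - {u} - {v}" w]) simp_all
  have A: "(\<Sum>t\<in>V - {u} - {v} - {w}. quad (tau x t)) = (\<Sum>t\<in>V - {u} - {v} - {w}. quad (x t))"
    by (intro sum.cong) (simp_all add: tau_apply)
  have B: "quad (a + twist (a + b + c)) + (quad (b + twist (a + b + c)) + quad (c + twist (a + b + c)))
      = quad a + (quad b + quad c)" for a b c
    by (cases a rule: dir_cases; cases b rule: dir_cases; cases c rule: dir_cases) simp_all
  show ?thesis unfolding split A tau_apply(1,2,3)
    using B[of "x u" "x v" "x w"] by (simp only: add.assoc[symmetric])
qed

lemma evens_eq:
  assumes k: knot shows "evens V L' = evens V L"
proof -
  interpret I': isotropic_system V L' by (rule I')
  have k': "transversal V L' (\<lambda>_. ds)" using k knot_iff by simp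
  have "i \<in> evens V L \<longleftrightarrow> i \<in> evens V L'" if i: "i \<in> V" for i
  proof -
    obtain x where x: "x \<in> L" "fundamental (\<lambda>_. ds) V i x"
      using ex_fundamental[OF k ds_neq i] by auto
    then have x': "tau x \<in> L'" "fundamental (\<lambda>_. ds) V i (tau x)" using fundamental_tau L' by auto
    show ?thesis using evens_iff[OF k x i] I'.evens_iff[OF k' x' i] q_tau[of x]
      unfolding q_def I'.q_def by simp
  qed
  then show ?thesis unfolding evens_def by blast
qed

text \<open>The sum of the three fundamental vectors is the vector of the move, on which the linear form \<open>q\<close>
  vanishes. So the number of odd vertices among the three is even.\<close>

lemma evens_count:
  assumes k: knot
  shows "u \<in> evens V L \<longleftrightarrow> (v \<in> evens V L \<longleftrightarrow> w \<in> evens V L)"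
proof -
  obtain x where x: "x \<in> L" "fundamental (\<lambda>_. ds) V u x" using ex_fundamental[OF k ds_neq uvw(1)] by auto
  obtain y where y: "y \<in> L" "fundamental (\<lambda>_. ds) V v y" using ex_fundamental[OF k ds_neq uvw(2)] by auto
  obtain z where z: "z \<in> L" "fundamental (\<lambda>_. ds) V w z" using ex_fundamental[OF k ds_neq uvw(3)] by auto
  have c1: "b = 0 \<or> b = ds \<Longrightarrow> c = 0 \<or> c = ds \<Longrightarrow> a + b + c = 0 \<or> a + b + c = ds"
    if "a = 0 \<or> a = ds" for a b c :: "bit \<times> bit" using that by auto
  have c2: "b = 0 \<or> b = ds \<Longrightarrow> c = 0 \<or> c = ds \<Longrightarrow> a + b + c + da = 0 \<or> a + b + c + da = ds"
    if "a \<noteq> 0" "a \<noteq> ds" for a b c :: "bit \<times> bit" using that by (cases a rule: dir_cases) auto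
  let ?s = "\<lambda>t. x t + y t + z t"
  have s: "?s \<in> L" using add[OF add[OF x(1) y(1)] z(1)] by simp
  have "(\<lambda>t. ?s t + r3 t) = (\<lambda>_. 0)"
  proof (rule transversal_zero[OF k add[OF s r]])
    show "aligned (\<lambda>_. ds) V (\<lambda>t. ?s t + r3 t)"
      unfolding aligned_def
    proof
      fix t assume t: "t \<in> V"
      have e: "t \<noteq> u \<Longrightarrow> x t = 0 \<or> x t = ds" "t \<noteq> v \<Longrightarrow> y t = 0 \<or> y t = ds" "t \<noteq> w \<Longrightarrow> z t = 0 \<or> z t = ds"
        "x u \<noteq> 0" "x u \<noteq> ds" "y v \<noteq> 0" "y v \<noteq> ds" "z w \<noteq> 0" "z w \<noteq> ds"
        using t x(2) y(2) z(2) unfolding fundamental_def aligned_def by auto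
      consider "t = u" | "t = v" | "t = w" | "t \<noteq> u" "t \<noteq> v" "t \<noteq> w" by blast
      then show "?s t + r3 t = 0 \<or> ?s t + r3 t = ds"
      proof cases
        case 1
        then show ?thesis using c2[of "x t" "y t" "z t"] e uvw by simp
      next
        case 2
        then show ?thesis using c2[of "y t" "x t" "z t"] e uvw by (simp add: ac_simps)
      next
        case 3
        then show ?thesis using c2[of "z t" "x t" "y t"] e uvw by (simp add: ac_simps)
      next
        case 4
        then show ?thesis using c1[of "x t" "y t" "z t"] e by simp
      qed
    qed
  qed
  then have "?s t + r3 t = 0" for t by (rule fun_cong)
  then have "?s = r3" by (intro ext) (simp only: dir_add_eq_0)
  moreover have "q r3 = 0" unfolding q_def by (intro sum.neutral) auto
  ultimately have "q ?s = 0" by simp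
  then have "q x + q y + q z = 0" using q_add[OF add[OF x(1) y(1)] z(1)] q_add[OF x(1) y(1)] by simp
  then show ?thesis
    using evens_iff[OF k x uvw(1)] evens_iff[OF k y uvw(2)] evens_iff[OF k z uvw(3)]
    by (cases "q x"; cases "q y"; cases "q z") simp_all
qed

text \<open>Of the eight states at the triangle, \<open>da, da, da\<close> does not count before the move and
  \<open>db, db, db\<close> does not count after it. The three states before the move with a single \<open>db\<close> all agree
  with \<open>da, da, da\<close> after it, the state \<open>db, db, db\<close> before the move agrees with all three states
  after it that have a single \<open>da\<close>, and the three with a single \<open>da\<close> before
  it correspond to the three with a single \<open>db\<close> after it. Modulo 2 the totals agree.\<close>

lemma bracket_all_even:
  assumes k: knot and S: "u \<in> evens V L" "v \<in> evens V L" "w \<in> evens V L"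
  shows "parity_bracket V L \<longleftrightarrow> parity_bracket V L'"
proof -
  let ?S = "evens V L"
  let ?T = "?S - {w} - {v} - {u}"
  define g where "g a b c = count_states ?T (\<lambda>p. alive V L ?S (p(u := a, v := b, w := c)))" for a b c
  define g' where "g' a b c = count_states ?T (\<lambda>p. alive V L' ?S (p(u := a, v := b, w := c)))" for a b c
  have f1: "finite ?S" "w \<in> ?S" "finite (?S - {w})" "v \<in> ?S - {w}" "finite (?S - {w} - {v})" "u \<in> ?S - {w} - {v}"
    using finite_evens S uvw by auto
  have split: "count_states ?S P = count_states ?T (\<lambda>p. P (p(u := da, v := da, w := da))) + count_states ?T (\<lambda>p. P (p(u := db, v := da, w := da)))
     + (count_states ?T (\<lambda>p. P (p(u := da, v := db, w := da))) + count_states ?T (\<lambda>p. P (p(u := db, v := db, w := da))))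
     + (count_states ?T (\<lambda>p. P (p(u := da, v := da, w := db))) + count_states ?T (\<lambda>p. P (p(u := db, v := da, w := db)))
     + (count_states ?T (\<lambda>p. P (p(u := da, v := db, w := db))) + count_states ?T (\<lambda>p. P (p(u := db, v := db, w := db)))))" for P
    unfolding count_states_split[OF f1(1,2)] by (simp only: count_states_split[OF f1(3,4)] count_states_split[OF f1(5,6)])
  have eq: "g a b c = g' a' b' c'"
    if "triple_step da db a b c a' b' c'" "triple_step db da a' b' c' a b c"
    for a b c a' b' c'
    unfolding g_def g'_def
  proof (rule count_states_cong)
    fix p :: "nat \<Rightarrow> bit \<times> bit"
    let ?p = "p(u := a, v := b, w := c)" and ?p' = "p(u := a', v := b', w := c')"
    have e: "?p u = a" "?p v = b" "?p w = c" "?p' u = a'" "?p' v = b'" "?p' w = c'"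
      "\<And>t. t \<noteq> u \<Longrightarrow> t \<noteq> v \<Longrightarrow> t \<noteq> w \<Longrightarrow> ?p' t = ?p t" using uvw by auto
    have st: "triple_step da db (?p u) (?p v) (?p w) (?p' u) (?p' v) (?p' w)"
      "triple_step db da (?p' u) (?p' v) (?p' w) (?p u) (?p v) (?p w)"
      unfolding e(1-6) by (fact that)+
    have "transversal V L ?p \<longleftrightarrow> transversal V L' ?p'"
      by (rule triple_transfer(1)) (fact e(7) st)+
    moreover have "fund V L ?p i j \<longleftrightarrow> fund V L' ?p' i j" if ij: "i \<in> V - ?S" "j \<in> V - ?S" for i j
      by (rule triple_transfer(2)) (fact e(7) st | use ij S in blast)+
    ultimately show "alive V L ?S ?p \<longleftrightarrow> alive V L' ?S ?p'" by (intro alive_cong) auto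
  qed
  have "g da da da = 0"
    unfolding g_def
  proof (rule count_states_0)
    fix p
    have "aligned (p(u := da, v := da, w := da)) V r3" unfolding aligned_def by auto
    moreover have "r3 \<noteq> (\<lambda>_. 0)" by (auto dest: fun_cong[of _ _ v])
    ultimately show "\<not> alive V L ?S (p(u := da, v := da, w := da))" using r unfolding alive_def transversal_def by blast
  qed
  moreover have "g' db db db = 0"
    unfolding g'_def
  proof (rule count_states_0)
    fix p
    have "tau r3 \<in> L'" using r L' by blast
    moreover have "aligned (p(u := db, v := db, w := db)) V (tau r3)" unfolding aligned_def by (auto simp: transvect_def)
    moreover have "tau r3 \<noteq> (\<lambda>_. 0)" unfolding tau_eq_0 by (auto dest: fun_cong[of _ _ v])
    ultimately show "\<not> alive V L' ?S (p(u := db, v := db, w := db))" unfolding alive_def transversal_def by blast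
  qed
  moreover have "g da da db = g' da da da" "g da db da = g' da da da" "g db da da = g' da da da"
    "g da db db = g' db da da" "g db da db = g' da db da" "g db db da = g' da da db"
    "g db db db = g' db db da" "g db db db = g' db da db" "g db db db = g' da db db"
    by (rule eq; simp add: triple_step_def)+
  ultimately show ?thesis
    unfolding parity_bracket_def evens_eq[OF k] split g_def[symmetric] g'_def[symmetric] by simp presburger
qed

text \<open>One smoothing of the even vertex turns the other two into twins, both before and after the move, and
  deleting them leaves the same graph. For the other smoothing see \<open>swapped_transfer\<close>.\<close>

lemma bracket_one_even:
  assumes k: knot and S: "u \<in> evens V L" "v \<notin> evens V L" "w \<notin> evens V L"
  shows "parity_bracket V L \<longleftrightarrow> parity_bracket V L'"
proof -
  interpret I': isotropic_system V L' by (rule I')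
  let ?S = "evens V L"
  let ?U = "V - ?S"
  have f1: "finite ?S" "u \<in> ?S" using finite_evens S by auto
  have 1: "alive V L ?S (p(u := da)) \<longleftrightarrow> alive V L' ?S (p(u := db))" if p: "p \<in> states (?S - {u})" for p
  proof -
    have pv: "p v = ds" "p w = ds" using p S unfolding states_def by auto
    have p0: "(p(u := da)) t \<noteq> 0" "(p(u := db)) t \<noteq> 0" for t using states_neq_0[OF p, of t] by simp_all
    let ?p = "p(u := da)" and ?p' = "p(u := db)"
    have e: "?p u = da" "?p v = ds" "?p w = ds" "?p' u = db" "?p' v = ds" "?p' w = ds"
      "\<And>t. t \<noteq> u \<Longrightarrow> t \<noteq> v \<Longrightarrow> t \<noteq> w \<Longrightarrow> ?p' t = ?p t" using uvw pv by auto
    have st: "triple_step da db (?p u) (?p v) (?p w) (?p' u) (?p' v) (?p' w)"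
      "triple_step db da (?p' u) (?p' v) (?p' w) (?p u) (?p v) (?p w)"
      unfolding e(1-6) by (simp_all add: triple_step_def)
    have tr: "transversal V L ?p \<longleftrightarrow> transversal V L' ?p'"
      by (rule triple_transfer(1)) (fact e(7) st)+
    have fu: "fund V L ?p i j \<longleftrightarrow> fund V L' ?p' i j" if ij: "i \<in> V - {u, v, w}" "j \<in> V - {u, v, w}" for i j
      by (rule triple_transfer(2)) (fact e(7) st ij)+
    have r': "tau r3 \<in> L'" using r L' by blast
    have rv: "tau r3 t = (if t = u \<or> t = v \<or> t = w then db else 0)" for t by (simp add: transvect_def)
    have tw: "twins ?U (fund V L ?p) v w" if "transversal V L ?p"
      using S uvw pv by (intro twins_fund[OF that p0(1) _ r]) (auto simp: aligned_def)
    have tw': "twins ?U (fund V L' ?p') v w" if "transversal V L' ?p'"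
      using S uvw pv by (intro I'.twins_fund[OF that p0(2) _ r']) (auto simp: aligned_def rv)
    have "reduces_to_W5 (?U - {v, w}) (fund V L ?p) \<longleftrightarrow> reduces_to_W5 (?U - {v, w}) (fund V L' ?p')"
      using S fu by (intro reduces_cong) auto
    then show ?thesis
      using tr reduces_fund_twins[OF _ p0(1) _ tw] I'.reduces_fund_twins[OF _ p0(2) _ tw']
      unfolding alive_def by blast
  qed
  have 2: "alive V L ?S (p(u := db)) \<longleftrightarrow> alive V L' ?S (p(u := da))" if p: "p \<in> states (?S - {u})" for p
  proof -
    have pv: "p v = ds" "p w = ds" using p S unfolding states_def by auto
    let ?\<pi> = "Transposition.transpose v w"
    note tr = swapped_transfer[OF pv]
    have im: "?\<pi> ` ?U = ?U" using uvw S by (intro transpose_image_eq) auto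
    then have bij: "bij_betw ?\<pi> ?U ?U" unfolding bij_betw_def by simp
    have fu: "fund V L (p(u := db)) i j \<longleftrightarrow> fund V L' (p(u := da)) (?\<pi> i) (?\<pi> j)" if "i \<in> ?U" "j \<in> ?U" for i j
      using tr(2)[of i j] that S by auto
    have "reduces_to_W5 ?U (fund V L (p(u := db))) \<longleftrightarrow> reduces_to_W5 ?U (fund V L' (p(u := da)))"
    proof
      assume "reduces_to_W5 ?U (fund V L (p(u := db)))"
      then show "reduces_to_W5 ?U (fund V L' (p(u := da)))" by (rule reduces_iso[OF _ bij]) (simp add: fu)
    next
      assume "reduces_to_W5 ?U (fund V L' (p(u := da)))"
      then show "reduces_to_W5 ?U (fund V L (p(u := db)))"
      proof (rule reduces_iso[OF _ bij])
        fix i j assume "i \<in> ?U" "j \<in> ?U"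
        then have "?\<pi> i \<in> ?U" "?\<pi> j \<in> ?U" using im by blast+
        then show "fund V L (p(u := db)) (?\<pi> i) (?\<pi> j) \<longleftrightarrow> fund V L' (p(u := da)) i j" using fu by simp
      qed
    qed
    then show ?thesis using tr(1) unfolding alive_def by blast
  qed
  show ?thesis
    unfolding parity_bracket_def evens_eq[OF k] count_states_split[OF f1]
    using count_states_cong[of "?S - {u}", OF 1] count_states_cong[of "?S - {u}", OF 2] by (simp add: add.commute)
qed

end

lemma third_move_perm:
  assumes "third_move V L u v w L'" shows "third_move V L v u w L'" "third_move V L w u v L'"
proof -
  interpret third_move V L u v w L' by (rule assms)
  have e: "transvect v u w = transvect u v w" "transvect w u v = transvect u v w"
    unfolding transvect_def by (auto simp: ac_simps fun_eq_iff)
  have e': "(\<lambda>t. if t = v \<or> t = u \<or> t = w then da else 0) = r3" "(\<lambda>t. if t = w \<or> t = u \<or> t = v then da else 0) = r3"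
    by auto
  show "third_move V L v u w L'" "third_move V L w u v L'"
    by (intro third_move.intro third_move_axioms.intro isotropic_system_axioms;
      simp only: e e' r uvw uvw(4-6)[symmetric] I'; simp only: L' not_False_eq_True uvw uvw(4-6)[symmetric])+
qed

lemma (in third_move) bracket_iff:
  assumes k: knot shows "parity_bracket V L \<longleftrightarrow> parity_bracket V L'"
proof -
  note t = third_move_perm[OF third_move_axioms]
  consider "u \<in> evens V L" "v \<in> evens V L" "w \<in> evens V L"
    | "u \<in> evens V L" "v \<notin> evens V L" "w \<notin> evens V L"
    | "v \<in> evens V L" "u \<notin> evens V L" "w \<notin> evens V L"
    | "w \<in> evens V L" "u \<notin> evens V L" "v \<notin> evens V L"
    using evens_count[OF k] by blast
  then show ?thesis
  proof cases
    case 1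
    then show ?thesis by (rule bracket_all_even[OF k])
  next
    case 2
    then show ?thesis by (rule bracket_one_even[OF k])
  next
    case 3
    then show ?thesis by (rule third_move.bracket_one_even[OF t(1) k])
  next
    case 4
    then show ?thesis by (rule third_move.bracket_one_even[OF t(2) k])
  qed
qed

section \<open>Relabelling and exchange of the two smoothings\<close>

text \<open>The bracket is only meaningful for knots, so it is compared under this condition.\<close>

definition same_invariants where
  "same_invariants V L V' L' \<longleftrightarrow>
    (transversal V L (\<lambda>_. ds) \<longleftrightarrow> transversal V' L' (\<lambda>_. ds)) \<and>
    (transversal V L (\<lambda>_. ds) \<longrightarrow> (parity_bracket V L \<longleftrightarrow> parity_bracket V' L'))"

lemma same_invariants_sym: "same_invariants V L V' L' \<Longrightarrow> same_invariants V' L' V L"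
  unfolding same_invariants_def by blast

lemma same_invariants_trans [trans]:
  "same_invariants V L V' L' \<Longrightarrow> same_invariants V' L' V'' L'' \<Longrightarrow> same_invariants V L V'' L''"
  unfolding same_invariants_def by blast

lemma (in first_move) same: "same_invariants V L V' L'"
  using knot_iff bracket_iff unfolding same_invariants_def by blast

lemma (in second_move) same: "same_invariants V L V' L'"
  using knot_iff bracket_iff unfolding same_invariants_def by blast

lemma (in third_move) same: "same_invariants V L V L'"
  using knot_iff bracket_iff unfolding same_invariants_def by blast

lemma swap_simps [simp]:
  "prod.swap a = 0 \<longleftrightarrow> a = (0 :: bit \<times> bit)" "prod.swap (0 :: bit \<times> bit) = 0"
  "prod.swap a + prod.swap b = prod.swap (a + b :: bit \<times> bit)"
  "sform (prod.swap a) (prod.swap b) = sform a b" "quad (prod.swap a) = quad a"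
  by (auto simp: sform_def quad_def zero_prod_def prod_eq_iff algebra_simps)

definition swap_if :: "bool \<Rightarrow> bit \<times> bit \<Rightarrow> bit \<times> bit" where
  "swap_if c a = (if c then prod.swap a else a)"

lemma swap_if_simps [simp]:
  "swap_if c (swap_if c a) = a" "swap_if c a = 0 \<longleftrightarrow> a = 0" "swap_if c a = swap_if c b \<longleftrightarrow> a = b"
  "swap_if c a + swap_if c b = swap_if c (a + b)" "sform (swap_if c a) (swap_if c b) = sform a b"
  "quad (swap_if c a) = quad a" "swap_if c 0 = 0" "swap_if c ds = ds"
  by (auto simp: swap_if_def) (metis swap_swap)+

lemma swap_if_smoothing: "a = da \<or> a = db \<Longrightarrow> swap_if c a = da \<or> swap_if c a = db"
  by (auto simp: swap_if_def)

lemma swap_if_eq_ds: "swap_if c a = ds \<longleftrightarrow> a = ds"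
  by (metis swap_if_simps(1,8))

text \<open>The map \<open>g\<close> carries each vector along the bijection \<open>f\<close> of vertices and exchanges the two smoothings
  at the vertices in \<open>W\<close>. This permutes the states, because a state ranges over both smoothings.\<close>

locale relabelling = isotropic_system +
  fixes f :: "nat \<Rightarrow> nat" and V' W :: "nat set"
    and g :: "(nat \<Rightarrow> bit \<times> bit) \<Rightarrow> nat \<Rightarrow> bit \<times> bit" and L' :: "(nat \<Rightarrow> bit \<times> bit) set"
  assumes bij: "bij_betw f V V'" and L': "L' = g ` L"
    and g: "\<And>x t. x \<in> L \<Longrightarrow> t \<in> V \<Longrightarrow> g x (f t) = swap_if (t \<in> W) (x t)"
    and g0: "\<And>x s. x \<in> L \<Longrightarrow> s \<notin> V' \<Longrightarrow> g x s = 0"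
begin

lemma im: "f ` V = V'" and inj: "inj_on f V"
  using bij unfolding bij_betw_def by auto

lemma eqI: "x \<in> L \<Longrightarrow> y \<in> L \<Longrightarrow> (\<And>t. t \<in> V \<Longrightarrow> x t = y t) \<Longrightarrow> x = y"
  using outside by (metis ext)

lemma eqI': "x \<in> L \<Longrightarrow> (\<And>s. s \<notin> V' \<Longrightarrow> y s = 0) \<Longrightarrow> (\<And>t. t \<in> V \<Longrightarrow> y (f t) = swap_if (t \<in> W) (x t)) \<Longrightarrow> y = g x"
  using g g0 im by (metis (no_types, lifting) ext imageE)

lemma g_eq_0: "x \<in> L \<Longrightarrow> g x = (\<lambda>_. 0) \<longleftrightarrow> x = (\<lambda>_. 0)"
proof
  assume x: "x \<in> L" "g x = (\<lambda>_. 0)"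
  show "x = (\<lambda>_. 0)" using g[OF x(1)] x(2) by (intro eqI[OF x(1) zero]) (metis swap_if_simps(2))
next
  assume x: "x \<in> L" "x = (\<lambda>_. 0)"
  show "g x = (\<lambda>_. 0)" using x by (intro eqI'[symmetric]) auto
qed

lemma sum_f: "(\<Sum>s\<in>V'. h s) = (\<Sum>t\<in>V. h (f t))"
  unfolding im[symmetric] using inj by (simp add: sum.reindex)

lemma isotropic': "isotropic_system V' L'"
proof
  show "finite V'" using fin im by blast
  show "x t = 0" if "x \<in> L'" "t \<notin> V'" for x t using that g0 unfolding L' by blast
  show "(\<lambda>_. 0) \<in> L'" using zero g_eq_0[OF zero] unfolding L' by (metis image_eqI)
  show "(\<lambda>t. x t + y t) \<in> L'" if xy: "x \<in> L'" "y \<in> L'" for x y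
  proof -
    obtain a b where ab: "a \<in> L" "b \<in> L" "x = g a" "y = g b" using xy unfolding L' by blast
    have "(\<lambda>t. x t + y t) = g (\<lambda>t. a t + b t)"
      using ab g g0 by (intro eqI' add) auto
    then show ?thesis using add[OF ab(1,2)] unfolding L' by blast
  qed
  show "(\<Sum>t\<in>V'. sform (x t) (y t)) = 0" if xy: "x \<in> L'" "y \<in> L'" for x y
  proof -
    obtain a b where ab: "a \<in> L" "b \<in> L" "x = g a" "y = g b" using xy unfolding L' by blast
    then show ?thesis unfolding sum_f using isotropic[OF ab(1,2)] by (simp add: g cong: sum.cong)
  qed
  have "inj_on g L"
  proof (rule inj_onI)
    fix x y assume xy: "x \<in> L" "y \<in> L" "g x = g y"
    then show "x = y" using g by (intro eqI) (metis swap_if_simps(3))+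
  qed
  then show "card L' = 2 ^ card V'" unfolding L' using card_L bij_betw_same_card[OF bij] by (simp add: card_image)
qed

lemma transfer_f:
  assumes p: "\<And>t. t \<in> V \<Longrightarrow> p' (f t) = swap_if (t \<in> W) (p t)"
  shows "transversal V L p \<longleftrightarrow> transversal V' L' p'"
    and "\<And>i j. i \<in> V \<Longrightarrow> j \<in> V \<Longrightarrow> fund V L p i j \<longleftrightarrow> fund V' L' p' (f i) (f j)"
proof -
  have D: "{} \<subseteq> V" "{} \<subseteq> V'" "f ` (V - {}) = V' - {}" "inj_on f (V - {})" using im inj by auto
  have fwd: "\<exists>x'\<in>L'. aligned p' {} x' \<and>
      (\<forall>t\<in>V - {}. (x' (f t) = 0 \<longleftrightarrow> x t = 0) \<and> (x' (f t) = p' (f t) \<longleftrightarrow> x t = p t)) \<and>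
      (x' = (\<lambda>_. 0) \<longrightarrow> x = (\<lambda>_. 0))" if "x \<in> L" "aligned p {} x" for x
    using that g_eq_0 unfolding L' by (intro bexI[of _ "g x"]) (auto simp: aligned_def g p)
  have bwd: "\<exists>x\<in>L. aligned p {} x \<and>
      (\<forall>t\<in>V - {}. (x' (f t) = 0 \<longleftrightarrow> x t = 0) \<and> (x' (f t) = p' (f t) \<longleftrightarrow> x t = p t)) \<and>
      (x = (\<lambda>_. 0) \<longrightarrow> x' = (\<lambda>_. 0))" if x': "x' \<in> L'" "aligned p' {} x'" for x'
  proof -
    obtain x where "x \<in> L" "x' = g x" using x' unfolding L' by blast
    then show ?thesis using g_eq_0 by (intro bexI[of _ x]) (auto simp: aligned_def g p)
  qed
  show "transversal V L p \<longleftrightarrow> transversal V' L' p'"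
    by (rule transfer(1)[where \<pi> = f and D = "{}" and D' = "{}", OF D]) (fact fwd bwd)+
  show "fund V L p i j \<longleftrightarrow> fund V' L' p' (f i) (f j)" if "i \<in> V" "j \<in> V" for i j
    by (rule transfer(2)[where \<pi> = f and D = "{}" and D' = "{}", OF D]) (fact fwd bwd | use that in simp)+
qed

lemma same: "same_invariants V L V' L'"
proof -
  interpret I': isotropic_system V' L' by (rule isotropic')
  have kk: "knot \<longleftrightarrow> transversal V' L' (\<lambda>_. ds)" by (rule transfer_f(1)) simp
  moreover have "parity_bracket V L \<longleftrightarrow> parity_bracket V' L'" if k: knot
  proof -
    have k': "transversal V' L' (\<lambda>_. ds)" using kk k by simp
    have e: "i \<in> evens V L \<longleftrightarrow> f i \<in> evens V' L'" if i: "i \<in> V" for i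
    proof -
      obtain x where x: "x \<in> L" "fundamental (\<lambda>_. ds) V i x"
        using ex_fundamental[OF k ds_neq i] by auto
      have "V' - {f i} = f ` (V - {i})" using i inj unfolding im[symmetric] by (auto simp: inj_on_def)
      then have x': "g x \<in> L'" "fundamental (\<lambda>_. ds) V' (f i) (g x)"
        using x i unfolding fundamental_def aligned_def L' by (auto simp: g swap_if_eq_ds)
      have "I'.q (g x) = q x"
        unfolding I'.q_def q_def sum_f by (intro sum.cong) (simp_all add: g x)
      moreover have "f i \<in> V'" using i im by blast
      ultimately show ?thesis using evens_iff[OF k x i] I'.evens_iff[OF k' x'] by simp
    qed
    let ?S = "evens V L"
    have SV: "?S \<subseteq> V" "evens V' L' \<subseteq> V'" unfolding evens_def by auto
    then have ev: "evens V' L' = f ` ?S" using e im by blast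
    define push where "push p s = (let t = inv_into V f s in if s \<in> V' then swap_if (t \<in> W) (p t) else ds)" for p :: "nat \<Rightarrow> bit \<times> bit" and s
    define pull where "pull p t = (if t \<in> V then swap_if (t \<in> W) (p (f t)) else ds)" for p :: "nat \<Rightarrow> bit \<times> bit" and t
    have push_f: "push p (f t) = swap_if (t \<in> W) (p t)" if "t \<in> V" for p t
      using that im inj unfolding push_def Let_def by auto
    have fS: "f t \<in> f ` ?S \<longleftrightarrow> t \<in> ?S" if "t \<in> V" for t using that SV inj by (auto simp: inj_on_def)
    have pp: "pull (push p) = p" if "p \<in> states ?S" for p
    proof
      fix t
      show "pull (push p) t = p t" using that SV push_f[of t p] unfolding pull_def states_def by auto
    qed
    have pp': "push (pull p) = p" if "p \<in> states (f ` ?S)" for p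
    proof
      fix s
      show "push (pull p) s = p s"
      proof (cases "s \<in> V'")
        case True
        then obtain t where t: "t \<in> V" "s = f t" using im by blast
        then show ?thesis using push_f[of t] by (simp add: pull_def)
      next
        case False
        then have "s \<notin> f ` ?S" using SV im by blast
        then show ?thesis using False that unfolding push_def Let_def states_def by auto
      qed
    qed
    have st: "push p \<in> states (f ` ?S)" if p: "p \<in> states ?S" for p
      unfolding states_def mem_Collect_eq
    proof (intro conjI ballI allI impI)
      fix s assume "s \<in> f ` ?S"
      then obtain t where t: "t \<in> ?S" "s = f t" by blast
      then have "push p s = swap_if (t \<in> W) (p t)" using push_f[of t p] SV by auto
      moreover have "p t = da \<or> p t = db" using p t(1) unfolding states_def by blast
      ultimately show "push p s = da \<or> push p s = db" using swap_if_smoothing by metis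
    next
      fix s assume s: "s \<notin> f ` ?S"
      show "push p s = ds"
      proof (cases "s \<in> V'")
        case True
        then obtain t where t: "t \<in> V" "s = f t" using im by blast
        then show ?thesis using p push_f[of t p] s unfolding states_def by auto
      qed (simp add: push_def Let_def)
    qed
    have st': "pull p \<in> states ?S" if p: "p \<in> states (f ` ?S)" for p
    proof -
      have "pull p t = da \<or> pull p t = db" if "t \<in> ?S" for t
        using p that SV swap_if_smoothing[of "p (f t)"] unfolding states_def pull_def by auto
      moreover have "p (f t) = ds" if "t \<in> V" "t \<notin> ?S" for t using p that fS unfolding states_def by blast
      ultimately show ?thesis using SV unfolding states_def by (simp add: pull_def)
    qed
    have al: "alive V L ?S p \<longleftrightarrow> alive V' L' (f ` ?S) (push p)" for p
    proof -
      note tf = transfer_f[of "push p" p, OF push_f]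
      have "f ` (V - ?S) = V' - f ` ?S" using SV inj im by (auto simp: inj_on_def)
      then have b: "bij_betw f (V - ?S) (V' - f ` ?S)" using inj unfolding bij_betw_def by (auto simp: inj_on_def)
      let ?f' = "inv_into (V - ?S) f"
      have b': "bij_betw ?f' (V' - f ` ?S) (V - ?S)" by (rule bij_betw_inv_into[OF b])
      have "reduces_to_W5 (V - ?S) (fund V L p) \<longleftrightarrow> reduces_to_W5 (V' - f ` ?S) (fund V' L' (push p))"
      proof
        assume "reduces_to_W5 (V - ?S) (fund V L p)"
        then show "reduces_to_W5 (V' - f ` ?S) (fund V' L' (push p))"
          by (rule reduces_iso[OF _ b]) (simp add: tf(2))
      next
        assume "reduces_to_W5 (V' - f ` ?S) (fund V' L' (push p))"
        then show "reduces_to_W5 (V - ?S) (fund V L p)"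
        proof (rule reduces_iso[OF _ b'])
          fix i j assume ij: "i \<in> V' - f ` ?S" "j \<in> V' - f ` ?S"
          then have "?f' i \<in> V" "?f' j \<in> V" "f (?f' i) = i" "f (?f' j) = j"
            using b b' bij_betw_inv_into_right[OF b] by (auto dest: bij_betwE)
          then show "fund V L p (?f' i) (?f' j) \<longleftrightarrow> fund V' L' (push p) i j"
            using tf(2)[of "?f' i" "?f' j"] by simp
        qed
      qed
      then show ?thesis using tf(1) unfolding alive_def by simp
    qed
    have "bij_betw push {p \<in> states ?S. alive V L ?S p} {p \<in> states (f ` ?S). alive V' L' (f ` ?S) p}"
    proof (rule bij_betw_byWitness[where f' = pull])
      show "push ` {p \<in> states ?S. alive V L ?S p} \<subseteq> {p \<in> states (f ` ?S). alive V' L' (f ` ?S) p}"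
        using st al by blast
      show "pull ` {p \<in> states (f ` ?S). alive V' L' (f ` ?S) p} \<subseteq> {p \<in> states ?S. alive V L ?S p}"
        using st' al pp' by auto
    qed (use pp pp' in auto)
    then show ?thesis unfolding parity_bracket_def ev count_states_def by (simp add: bij_betw_same_card)
  qed
  ultimately show ?thesis unfolding same_invariants_def by blast
qed

end

text \<open>The permutation \<open>\<pi>\<close> of the vertices will be the identity or a transposition.\<close>

definition recoord :: "nat set \<Rightarrow> (nat \<Rightarrow> nat) \<Rightarrow> (nat \<Rightarrow> bit \<times> bit) \<Rightarrow> nat \<Rightarrow> bit \<times> bit" where
  "recoord W \<pi> x t = swap_if (\<pi> t \<in> W) (x (\<pi> t))"

lemma recoord_same:
  assumes "isotropic_system V L" and inv: "\<And>t. \<pi> (\<pi> t) = t" and V: "\<And>t. t \<in> V \<Longrightarrow> \<pi> t \<in> V"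
  shows "same_invariants V L V (recoord W \<pi> ` L)" and "isotropic_system V (recoord W \<pi> ` L)"
proof -
  interpret isotropic_system V L by (rule assms(1))
  have off: "\<pi> t \<notin> V" if "t \<notin> V" for t using V[of "\<pi> t"] that inv by auto
  have "\<pi> ` V = V" using V inv by (metis image_subsetI imageI subsetI subset_antisym)
  moreover have "inj_on \<pi> V" by (metis inj_onI inv)
  ultimately interpret relabelling V L \<pi> V W "recoord W \<pi>" "recoord W \<pi> ` L"
    by unfold_locales (auto simp: bij_betw_def recoord_def inv off outside)
  show "same_invariants V L V (recoord W \<pi> ` L)" by (rule same)
  show "isotropic_system V (recoord W \<pi> ` L)" by (rule isotropic')
qed

lemma recoord_inj:
  assumes "\<And>t. \<pi> (\<pi> t) = t" and "recoord W \<pi> x = recoord W \<pi> y" shows "x = y"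
proof
  fix t
  show "x t = y t" using fun_cong[OF assms(2), of "\<pi> t"] by (simp add: recoord_def assms(1))
qed

section \<open>The isotropic system of a framed graph\<close>

definition entry :: "framed_graph \<Rightarrow> nat \<Rightarrow> nat \<Rightarrow> bit" where
  "entry G v w = (if v = w then framing G v else of_bool (adj G v w))"

definition graph_space :: "framed_graph \<Rightarrow> (nat \<Rightarrow> bit \<times> bit) set" where
  "graph_space G = {x. (\<forall>v. v \<notin> verts G \<longrightarrow> x v = 0) \<and>
    (\<forall>v\<in>verts G. snd (x v) = (\<Sum>w\<in>verts G. entry G v w * fst (x w)))}"

definition graph_vec :: "framed_graph \<Rightarrow> (nat \<Rightarrow> bit) \<Rightarrow> nat \<Rightarrow> bit \<times> bit" where
  "graph_vec G X v = (if v \<in> verts G then (X v, \<Sum>w\<in>verts G. entry G v w * X w) else 0)"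

lemma graph_vec_mem: "graph_vec G X \<in> graph_space G"
  unfolding graph_space_def graph_vec_def by simp

lemma graph_space_snd:
  "x \<in> graph_space G \<Longrightarrow> v \<in> verts G \<Longrightarrow> snd (x v) = (\<Sum>w\<in>verts G. entry G v w * fst (x w))"
  unfolding graph_space_def by blast

lemma graph_space_off: "x \<in> graph_space G \<Longrightarrow> v \<notin> verts G \<Longrightarrow> x v = 0"
  unfolding graph_space_def by blast

lemma graph_spaceI:
  "(\<And>v. v \<notin> verts G \<Longrightarrow> x v = 0) \<Longrightarrow>
   (\<And>v. v \<in> verts G \<Longrightarrow> snd (x v) = (\<Sum>w\<in>verts G. entry G v w * fst (x w))) \<Longrightarrow> x \<in> graph_space G"
  unfolding graph_space_def by blast

lemma entry_sym: "framed_simple_graph G \<Longrightarrow> entry G v w = entry G w v"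
  unfolding entry_def framed_simple_graph_def by auto

lemma graph_space_isotropic:
  assumes G: "framed_simple_graph G"
  shows "isotropic_system (verts G) (graph_space G)"
proof
  let ?V = "verts G"
  show fin: "finite ?V" using G unfolding framed_simple_graph_def by blast
  show "x v = 0" if "x \<in> graph_space G" "v \<notin> ?V" for x v using graph_space_off that by blast
  show "(\<lambda>_. 0) \<in> graph_space G" by (rule graph_spaceI) simp_all
  show "(\<lambda>v. x v + y v) \<in> graph_space G" if xy: "x \<in> graph_space G" "y \<in> graph_space G" for x y
    using graph_space_off[OF xy(1)] graph_space_off[OF xy(2)] graph_space_snd[OF xy(1)] graph_space_snd[OF xy(2)]
    by (intro graph_spaceI) (simp_all add: sum.distrib algebra_simps)
  show "(\<Sum>v\<in>?V. sform (x v) (y v)) = 0" if xy: "x \<in> graph_space G" "y \<in> graph_space G" for x y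
  proof -
    have "(\<Sum>v\<in>?V. sform (x v) (y v)) = (\<Sum>v\<in>?V. \<Sum>w\<in>?V. entry G v w * fst (x v) * fst (y w))
        + (\<Sum>v\<in>?V. \<Sum>w\<in>?V. entry G v w * fst (x w) * fst (y v))"
      unfolding sform_def sum.distrib[symmetric]
      by (intro sum.cong refl) (simp add: graph_space_snd[OF xy(1)] graph_space_snd[OF xy(2)]
        sum_distrib_left sum_distrib_right ac_simps)
    also have "(\<Sum>v\<in>?V. \<Sum>w\<in>?V. entry G v w * fst (x w) * fst (y v))
        = (\<Sum>v\<in>?V. \<Sum>w\<in>?V. entry G v w * fst (x v) * fst (y w))"
      by (subst sum.swap) (simp add: entry_sym[OF G])
    finally show ?thesis by (metis (no_types) add_cancel_right_right bit_2_eq_0 mult_2 mult_zero_left)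
  qed
  have "bij_betw (graph_vec G) (PiE ?V (\<lambda>_. UNIV)) (graph_space G)"
    unfolding bij_betw_def
  proof
    show "inj_on (graph_vec G) (PiE ?V (\<lambda>_. UNIV))"
    proof (rule inj_onI)
      fix X Y assume XY: "X \<in> PiE ?V (\<lambda>_. UNIV)" "Y \<in> PiE ?V (\<lambda>_. UNIV)" "graph_vec G X = graph_vec G Y"
      show "X = Y"
      proof
        fix v
        show "X v = Y v"
        proof (cases "v \<in> ?V")
          case True
          then show ?thesis using fun_cong[OF XY(3), of v] unfolding graph_vec_def by simp
        next
          case False
          then show ?thesis using XY(1,2) by (metis PiE_arb)
        qed
      qed
    qed
    show "graph_vec G ` PiE ?V (\<lambda>_. UNIV) = graph_space G"
    proof
      show "graph_vec G ` PiE ?V (\<lambda>_. UNIV) \<subseteq> graph_space G" using graph_vec_mem by blast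
      show "graph_space G \<subseteq> graph_vec G ` PiE ?V (\<lambda>_. UNIV)"
      proof
        fix x assume x: "x \<in> graph_space G"
        have "x = graph_vec G (restrict (\<lambda>v. fst (x v)) ?V)"
        proof
          fix v
          show "x v = graph_vec G (restrict (\<lambda>v. fst (x v)) ?V) v"
          proof (cases "v \<in> ?V")
            case True
            have "(\<Sum>w\<in>?V. entry G v w * restrict (\<lambda>v. fst (x v)) ?V w) = snd (x v)"
              unfolding graph_space_snd[OF x True] by (intro sum.cong) simp_all
            then show ?thesis unfolding graph_vec_def using True by (intro prod_eqI) simp_all
          next
            case False
            then show ?thesis using graph_space_off[OF x False] by (simp add: graph_vec_def)
          qed
        qed
        then show "x \<in> graph_vec G ` PiE ?V (\<lambda>_. UNIV)" by (rule image_eqI[where f = "graph_vec G"]) simp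
      qed
    qed
  qed
  then show "card (graph_space G) = 2 ^ card ?V" using card_bit_functions[OF fin] by (metis bij_betw_same_card)
qed

text \<open>A vector with first components zero is zero.\<close>

lemma graph_space_db_free: "transversal (verts G) (graph_space G) (\<lambda>_. db)"
  unfolding transversal_def
proof (intro ballI impI)
  fix x assume x: "x \<in> graph_space G" "aligned (\<lambda>_. db) (verts G) x"
  have "fst (x v) = 0" for v
    using x graph_space_off[of x G v] unfolding aligned_def by (cases "v \<in> verts G") auto
  then have "snd (x v) = 0" if "v \<in> verts G" for v
    using graph_space_snd[OF x(1) that] by simp
  then show "x = (\<lambda>_. 0)"
    using \<open>\<And>v. fst (x v) = 0\<close> graph_space_off[OF x(1)] by (metis ext prod_eqI fst_zero snd_zero)
qed

lemma bit_add_self [simp]: "a + a = (0 :: bit)" "a + (a + b) = (b :: bit)"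
  by (cases a; simp)+

text \<open>Both spaces have \<open>2 ^ n\<close> elements, so an injective map into the second space is onto it.\<close>

lemma graph_space_image_eq:
  assumes G: "framed_simple_graph G" "framed_simple_graph H" and c: "card (verts G) = card (verts H)"
    and inj: "inj_on f (graph_space G)" and sub: "\<And>x. x \<in> graph_space G \<Longrightarrow> f x \<in> graph_space H"
  shows "f ` graph_space G = graph_space H"
proof (rule card_subset_eq)
  interpret G: isotropic_system "verts G" "graph_space G" by (rule graph_space_isotropic[OF G(1)])
  interpret H: isotropic_system "verts H" "graph_space H" by (rule graph_space_isotropic[OF G(2)])
  show "finite (graph_space H)" using H.card_L by (metis card.infinite power_not_zero zero_neq_numeral)
  show "f ` graph_space G \<subseteq> graph_space H" using sub by blast
  show "card (f ` graph_space G) = card (graph_space H)" using G.card_L H.card_L c inj by (simp add: card_image)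
qed

section \<open>Invariance under the moves\<close>

abbreviation "same_graph_invariants G H \<equiv>
  same_invariants (verts G) (graph_space G) (verts H) (graph_space H)"

lemma same_if_iso:
  assumes G: "framed_simple_graph G" and H: "framed_simple_graph H" and i: "graph_iso G H"
  shows "same_graph_invariants G H"
proof -
  obtain f where f: "bij_betw f (verts G) (verts H)"
    "\<And>u v. u \<in> verts G \<Longrightarrow> v \<in> verts G \<Longrightarrow> adj H (f u) (f v) \<longleftrightarrow> adj G u v"
    "\<And>v. v \<in> verts G \<Longrightarrow> framing H (f v) = framing G v" using i unfolding graph_iso_def by blast
  have inj: "inj_on f (verts G)" and im: "f ` verts G = verts H" using f(1) unfolding bij_betw_def by auto
  define g where "g x s = (if s \<in> verts H then x (inv_into (verts G) f s) else 0)" for x :: "nat \<Rightarrow> bit \<times> bit" and s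
  have gf: "g x (f t) = x t" if "t \<in> verts G" for x t using that inj im unfolding g_def by auto
  have e: "entry H (f u) (f v) = entry G u v" if "u \<in> verts G" "v \<in> verts G" for u v
    using that f inj unfolding entry_def by (auto simp: inj_on_def)
  interpret G: isotropic_system "verts G" "graph_space G" by (rule graph_space_isotropic[OF G])
  have "g ` graph_space G = graph_space H"
  proof (rule graph_space_image_eq[OF G H bij_betw_same_card[OF f(1)]])
    show "inj_on g (graph_space G)"
    proof (rule inj_onI)
      fix x y assume xy: "x \<in> graph_space G" "y \<in> graph_space G" "g x = g y"
      show "x = y"
      proof
        fix t
        show "x t = y t" using gf[of t x] gf[of t y] xy(3) graph_space_off[OF xy(1), of t] graph_space_off[OF xy(2), of t] by (cases "t \<in> verts G") auto
      qed
    qed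
    fix x assume x: "x \<in> graph_space G"
    show "g x \<in> graph_space H"
    proof (rule graph_spaceI)
      fix s assume "s \<in> verts H"
      then obtain t where t: "t \<in> verts G" "s = f t" using im by blast
      have "(\<Sum>w\<in>verts H. entry H s w * fst (g x w)) = (\<Sum>w\<in>verts G. entry H s (f w) * fst (g x (f w)))"
        unfolding im[symmetric] using inj by (simp add: sum.reindex)
      also have "\<dots> = (\<Sum>w\<in>verts G. entry G t w * fst (x w))"
        by (intro sum.cong) (simp_all add: gf e t)
      finally show "snd (g x s) = (\<Sum>w\<in>verts H. entry H s w * fst (g x w))"
        using graph_space_snd[OF x t(1)] gf[OF t(1)] t(2) by simp
    qed (simp add: g_def)
  qed
  then interpret relabelling "verts G" "graph_space G" f "verts H" "{}" g "graph_space H"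
    using f(1) gf by unfold_locales (auto simp: g_def swap_if_def)
  show ?thesis by (rule same)
qed

lemma sum_delete_verts:
  fixes h :: "nat \<Rightarrow> bit"
  assumes "finite V" "\<And>t. t \<in> V \<Longrightarrow> t \<in> D \<Longrightarrow> h t = 0"
  shows "sum h (V - D) = sum h V"
  using assms by (intro sum.mono_neutral_left) auto

lemma entry_delete: "t \<notin> D \<Longrightarrow> w \<notin> D \<Longrightarrow> entry (delete_verts G D) t w = entry G t w"
  by (simp add: entry_def delete_verts_def)

lemma framed_delete: "framed_simple_graph G \<Longrightarrow> framed_simple_graph (delete_verts G D)"
  unfolding framed_simple_graph_def delete_verts_def by auto

lemma verts_delete [simp]: "verts (delete_verts G D) = verts G - D"
  by (simp add: delete_verts_def)

lemma delete_vec: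
  assumes G: "framed_simple_graph G" and x: "x \<in> graph_space G" and z: "\<And>t. t \<in> D \<Longrightarrow> fst (x t) = 0"
  shows "(\<lambda>t. if t \<in> D then 0 else x t) \<in> graph_space (delete_verts G D)"
proof (rule graph_spaceI)
  fix v assume v: "v \<in> verts (delete_verts G D)"
  have "(\<Sum>w\<in>verts G - D. entry G v w * fst (x w)) = (\<Sum>w\<in>verts G. entry G v w * fst (x w))"
    using G z by (intro sum_delete_verts) (auto simp: framed_simple_graph_def)
  moreover have "(\<Sum>w\<in>verts G - D. entry (delete_verts G D) v w * fst (if w \<in> D then 0 else x w))
      = (\<Sum>w\<in>verts G - D. entry G v w * fst (x w))"
    using v by (intro sum.cong) (auto simp: entry_delete)
  ultimately show "snd (if v \<in> D then 0 else x v) = (\<Sum>w\<in>verts (delete_verts G D). entry (delete_verts G D) v w * fst (if w \<in> D then 0 else x w))"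
    using v graph_space_snd[OF x, of v] by simp
qed (use graph_space_off[OF x] in auto)

lemma extend_vec:
  assumes G: "framed_simple_graph G" and y: "y \<in> graph_space (delete_verts G D)"
  shows "(\<lambda>t. if t \<in> D \<and> t \<in> verts G then (0, \<Sum>w\<in>verts G. entry G t w * fst (y w)) else y t) \<in> graph_space G"
    (is "?x \<in> _")
proof (rule graph_spaceI)
  have fx: "fst (?x t) = fst (y t)" for t
    using graph_space_off[OF y, of t] by auto
  fix v assume v: "v \<in> verts G"
  show "snd (?x v) = (\<Sum>w\<in>verts G. entry G v w * fst (?x w))"
  proof (cases "v \<in> D")
    case True
    then show ?thesis unfolding fx using v by simp
  next
    case False
    have "(\<Sum>w\<in>verts G - D. entry G v w * fst (y w)) = (\<Sum>w\<in>verts G. entry G v w * fst (y w))"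
      using G graph_space_off[OF y] by (intro sum_delete_verts) (auto simp: framed_simple_graph_def)
    moreover have "(\<Sum>w\<in>verts G - D. entry (delete_verts G D) v w * fst (y w)) = (\<Sum>w\<in>verts G - D. entry G v w * fst (y w))"
      using False by (intro sum.cong) (auto simp: entry_delete)
    ultimately show ?thesis unfolding fx using graph_space_snd[OF y, of v] False v by simp
  qed
qed (use graph_space_off[OF y] in auto)

lemma unit_sum:
  fixes h :: "nat \<Rightarrow> bit"
  assumes "finite V" "T \<subseteq> V"
  shows "(\<Sum>w\<in>V. h w * fst (if w \<in> T then da else (0 :: bit \<times> bit))) = sum h T"
proof -
  have "(\<Sum>w\<in>V. h w * fst (if w \<in> T then da else (0 :: bit \<times> bit))) = (\<Sum>w\<in>T. h w * fst (if w \<in> T then da else (0 :: bit \<times> bit)))"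
    using assms by (intro sum.mono_neutral_right) auto
  also have "\<dots> = sum h T" by (intro sum.cong) auto
  finally show ?thesis .
qed

lemma same_Omega1:
  assumes G: "framed_simple_graph G" and v: "v \<in> verts G" "framing G v = 0" "nbrs G v = {}"
  shows "same_graph_invariants G (delete_verts G {v})"
proof -
  interpret isotropic_system "verts G" "graph_space G" by (rule graph_space_isotropic[OF G])
  let ?r = "\<lambda>t. if t \<in> {v} then da else (0 :: bit \<times> bit)"
  have ev: "entry G v w = 0" "entry G w v = 0" for w
  proof -
    show "entry G v w = 0" using v unfolding entry_def nbrs_def by auto
    then show "entry G w v = 0" using entry_sym[OF G] by simp
  qed
  have r: "?r \<in> graph_space G"
  proof (rule graph_spaceI)
    fix t assume "t \<in> verts G"
    have "(\<Sum>w\<in>verts G. entry G t w * fst (?r w)) = 0"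
      using v(1) fin by (subst unit_sum) (simp_all add: ev)
    then show "snd (?r t) = (\<Sum>w\<in>verts G. entry G t w * fst (?r w))" by simp
  qed (use v in auto)
  have L': "graph_space (delete_verts G {v}) = {x \<in> graph_space G. x v = 0}"
  proof (intro equalityI subsetI)
    fix x assume x: "x \<in> {x \<in> graph_space G. x v = 0}"
    have "(\<lambda>t. if t \<in> {v} then 0 else x t) = x" using x by auto
    then show "x \<in> graph_space (delete_verts G {v})" using delete_vec[OF G, of x "{v}"] x by simp
  next
    fix y assume y: "y \<in> graph_space (delete_verts G {v})"
    have y0: "y v = 0" using graph_space_off[OF y] by simp
    have "(\<lambda>t. if t \<in> {v} \<and> t \<in> verts G then (0, \<Sum>w\<in>verts G. entry G t w * fst (y w)) else y t) = y"
      using y0 by (auto simp: ev zero_prod_def)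
    then show "y \<in> {x \<in> graph_space G. x v = 0}" using extend_vec[OF G y] y0 by simp
  qed
  interpret first_move "verts G" "graph_space G" v "verts (delete_verts G {v})" "graph_space (delete_verts G {v})"
  proof (intro first_move.intro first_move_axioms.intro isotropic_system_axioms)
    show "(\<lambda>t. if t = v then da else 0) \<in> graph_space G" using r by simp
    show "isotropic_system (verts (delete_verts G {v})) (graph_space (delete_verts G {v}))"
      by (intro graph_space_isotropic framed_delete G)
  qed (fact v(1) L' verts_delete)+
  show ?thesis by (rule same)
qed

lemma same_Omega2:
  assumes G: "framed_simple_graph G" and uv: "u \<in> verts G" "v \<in> verts G" "u \<noteq> v"
    and fr: "(\<not> adj G u v \<and> framing G u = 0 \<and> framing G v = 0) \<or> (adj G u v \<and> framing G u = 1 \<and> framing G v = 1)"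
    and tw: "\<And>t. t \<in> verts G - {u, v} \<Longrightarrow> adj G u t \<longleftrightarrow> adj G v t"
  shows "same_graph_invariants G (delete_verts G {u, v})"
proof -
  interpret isotropic_system "verts G" "graph_space G" by (rule graph_space_isotropic[OF G])
  let ?r = "\<lambda>t. if t \<in> {u, v} then da else (0 :: bit \<times> bit)"
  have e: "entry G u t = entry G v t" if "t \<in> verts G" "t \<noteq> u" "t \<noteq> v" for t
    using tw[of t] that unfolding entry_def by auto
  have e2: "entry G t u + entry G t v = 0" if "t \<in> verts G" for t
  proof (cases "t = u \<or> t = v")
    case True
    then show ?thesis using fr entry_sym[OF G, of u v] uv unfolding entry_def by auto
  next
    case False
    then show ?thesis using e[OF that] entry_sym[OF G, of t] by simp
  qed
  have r: "?r \<in> graph_space G"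
  proof (rule graph_spaceI)
    fix t assume t: "t \<in> verts G"
    have "(\<Sum>w\<in>verts G. entry G t w * fst (?r w)) = 0"
      using uv fin e2[OF t] by (subst unit_sum) simp_all
    then show "snd (?r t) = (\<Sum>w\<in>verts G. entry G t w * fst (?r w))" by simp
  qed (use uv in auto)
  let ?clr = "\<lambda>x t. if t = u \<or> t = v then 0 else (x t :: bit \<times> bit)"
  have L': "graph_space (delete_verts G {u, v}) = ?clr ` {x \<in> graph_space G. x u = x v \<and> (x u = 0 \<or> x u = db)}"
  proof (intro equalityI subsetI)
    fix y assume "y \<in> ?clr ` {x \<in> graph_space G. x u = x v \<and> (x u = 0 \<or> x u = db)}"
    then obtain x where x: "x \<in> graph_space G" "x u = x v" "x u = 0 \<or> x u = db" "y = ?clr x" by blast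
    have "fst (x t) = 0" if "t \<in> {u, v}" for t using x(2,3) that by auto
    from delete_vec[OF G x(1), of "{u, v}", OF this] show "y \<in> graph_space (delete_verts G {u, v})"
      unfolding x(4) insert_iff empty_iff by (simp only: simp_thms)
  next
    fix y assume y: "y \<in> graph_space (delete_verts G {u, v})"
    let ?x = "\<lambda>t. if t \<in> {u, v} \<and> t \<in> verts G then (0, \<Sum>w\<in>verts G. entry G t w * fst (y w)) else y t"
    have y0: "y u = 0" "y v = 0" using graph_space_off[OF y] by simp_all
    have "(\<Sum>w\<in>verts G. entry G u w * fst (y w)) = (\<Sum>w\<in>verts G. entry G v w * fst (y w))"
    proof (intro sum.cong refl)
      fix w assume "w \<in> verts G"
      then show "entry G u w * fst (y w) = entry G v w * fst (y w)" using e[of w] y0 by (cases "w = u \<or> w = v") auto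
    qed
    then have "?x u = ?x v" "?x u = 0 \<or> ?x u = db" using uv by (auto simp: zero_prod_def)
    then have "?x \<in> {x \<in> graph_space G. x u = x v \<and> (x u = 0 \<or> x u = db)}"
      by (intro CollectI conjI extend_vec[OF G y])
    moreover have "y = ?clr ?x" using y0 by auto
    ultimately show "y \<in> ?clr ` {x \<in> graph_space G. x u = x v \<and> (x u = 0 \<or> x u = db)}"
      by (intro image_eqI[where f = ?clr])
  qed
  interpret second_move "verts G" "graph_space G" u v "verts (delete_verts G {u, v})" "graph_space (delete_verts G {u, v})"
  proof (intro second_move.intro second_move_axioms.intro isotropic_system_axioms)
    show "(\<lambda>t. if t = u \<or> t = v then da else 0) \<in> graph_space G" using r by simp
    show "isotropic_system (verts (delete_verts G {u, v})) (graph_space (delete_verts G {u, v}))"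
      by (intro graph_space_isotropic framed_delete G)
  qed (fact uv L' verts_delete graph_space_db_free)+
  show ?thesis by (rule same)
qed

text \<open>A local complementation together with the change of framings pivots the matrix on the entry 1 at
  \<open>v\<close>. On the space this exchanges the two components at \<open>v\<close>.\<close>

lemma same_Omega4':
  assumes G: "framed_simple_graph G" and H: "framed_simple_graph H"
    and Hd: "H = flip_framing (local_compl G v) (nbrs G v)"
    and v: "v \<in> verts G" "framing G v = 1"
  shows "same_graph_invariants G H"
proof -
  have fin: "finite (verts G)" using G unfolding framed_simple_graph_def by blast
  have V: "verts H = verts G" unfolding Hd flip_framing_def local_compl_def toggle_adj_def by simp
  have irr: "\<not> adj G t t" and sy: "adj G t w \<longleftrightarrow> adj G w t" for t w
    using G unfolding framed_simple_graph_def by blast+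
  have e1: "entry H t v = entry G t v" "entry H v t = entry G v t" for t
    unfolding Hd entry_def flip_framing_def local_compl_def toggle_adj_def nbrs_def
    by (auto simp: irr)
  have e2: "entry H t w = entry G t w + entry G t v * entry G v w" if "t \<noteq> v" "w \<noteq> v" for t w
    using that unfolding Hd entry_def flip_framing_def local_compl_def toggle_adj_def nbrs_def
    by (auto simp: irr sy[of t v])
  have vv: "entry G v v = 1" using v by (simp add: entry_def)
  let ?f = "recoord {v} id"
  have fx: "?f x t = (if t = v then prod.swap (x t) else x t)" for x t
    by (simp add: recoord_def swap_if_def)
  have "?f ` graph_space G = graph_space H"
  proof (rule graph_space_image_eq[OF G H])
    show "inj_on ?f (graph_space G)" by (rule inj_onI, rule recoord_inj[of id]) simp_all
    fix x assume x: "x \<in> graph_space G"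
    define R where "R t = (\<Sum>w\<in>verts G - {v}. entry G t w * fst (x w))" for t
    have s: "snd (x t) = entry G t v * fst (x v) + R t" if "t \<in> verts G" for t
      unfolding graph_space_snd[OF x that] R_def by (rule sum.remove[OF fin v(1)])
    show "?f x \<in> graph_space H"
    proof (rule graph_spaceI)
      fix t assume t: "t \<in> verts H"
      have "(\<Sum>w\<in>verts H. entry H t w * fst (?f x w)) =
        entry H t v * snd (x v) + (\<Sum>w\<in>verts G - {v}. entry H t w * fst (?f x w))"
        unfolding V by (subst sum.remove[OF fin v(1)]) (simp add: fx)
      also have "(\<Sum>w\<in>verts G - {v}. entry H t w * fst (?f x w)) = (\<Sum>w\<in>verts G - {v}. entry H t w * fst (x w))"
        by (intro sum.cong) (simp_all add: fx)
      also have "\<dots> = (if t = v then R v else R t + entry G t v * R v)"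
      proof (cases "t = v")
        case True
        then show ?thesis by (simp add: e1 R_def)
      next
        case False
        have "(\<Sum>w\<in>verts G - {v}. entry H t w * fst (x w)) =
          (\<Sum>w\<in>verts G - {v}. entry G t w * fst (x w) + entry G t v * (entry G v w * fst (x w)))"
          by (intro sum.cong refl) (simp add: e2[OF False] algebra_simps)
        then show ?thesis using False by (simp add: sum.distrib R_def sum_distrib_left)
      qed
      finally have eq: "(\<Sum>w\<in>verts H. entry H t w * fst (?f x w)) =
        entry H t v * snd (x v) + (if t = v then R v else R t + entry G t v * R v)" .
      show "snd (?f x t) = (\<Sum>w\<in>verts H. entry H t w * fst (?f x w))"
        unfolding eq unfolding fx using s[OF v(1)] s[of t] t V by (cases "t = v") (simp_all add: e1 vv algebra_simps)
    qed (use v(1) V graph_space_off[OF x] in \<open>auto simp: fx\<close>)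
  qed (simp add: V)
  then show ?thesis using recoord_same(1)[OF graph_space_isotropic[OF G], of id "{v}"] V by simp
qed

text \<open>A pivot exchanges the two components at \<open>u\<close> and at \<open>v\<close>. The definition of the move leaves the
  neighbourhoods of \<open>u\<close> and \<open>v\<close> in place, whereas the principal pivot transform of the matrix exchanges
  them; hence the transposition of the two names.\<close>

lemma same_Omega4:
  assumes G: "framed_simple_graph G" and H: "framed_simple_graph H" and Hd: "H = pivot G u v"
    and uv: "u \<in> verts G" "v \<in> verts G" "adj G u v" "framing G u = 0" "framing G v = 0"
  shows "same_graph_invariants G H"
proof -
  have fin: "finite (verts G)" using G unfolding framed_simple_graph_def by blast
  have V: "verts H = verts G" unfolding Hd pivot_def toggle_adj_def by simp
  have irr: "\<not> adj G t t" and sy: "adj G t w \<longleftrightarrow> adj G w t" for t w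
    using G unfolding framed_simple_graph_def by blast+
  have ne: "u \<noteq> v" using uv(3) irr by blast
  have e1: "entry H t w = entry G t w" if "t = u \<or> t = v \<or> w = u \<or> w = v" for t w
    using that unfolding Hd entry_def pivot_def toggle_adj_def nbrs_def by (auto simp: Let_def)
  have e2: "entry H t w = entry G t w + (entry G t u * entry G v w + entry G t v * entry G u w)"
    if "t \<noteq> u" "t \<noteq> v" "w \<noteq> u" "w \<noteq> v" for t w
  proof (cases "t = w")
    case True
    then have "entry H t w = entry G t w" unfolding Hd entry_def pivot_def toggle_adj_def by (simp add: Let_def)
    moreover have "entry G t u * entry G v w + entry G t v * entry G u w = 0"
      using entry_sym[OF G, of t u] entry_sym[OF G, of t v] True by (simp add: algebra_simps)
    ultimately show ?thesis by simp
  next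
    case False
    have "adj H t w \<longleftrightarrow> adj G t w \<noteq> (adj G u t \<and> adj G v w \<and> (\<not> adj G v t \<or> \<not> adj G u w) \<or>
        adj G u w \<and> adj G v t \<and> (\<not> adj G v w \<or> \<not> adj G u t))"
      using that unfolding Hd pivot_def toggle_adj_def nbrs_def Let_def by simp
    moreover have "entry H t w = of_bool (adj H t w)" "entry G t w = of_bool (adj G t w)"
      "entry G t u = of_bool (adj G u t)" "entry G t v = of_bool (adj G v t)"
      "entry G v w = of_bool (adj G v w)" "entry G u w = of_bool (adj G u w)"
      using that False sy[of t u] sy[of t v] by (simp_all add: entry_def)
    ultimately show ?thesis
      by (cases "adj G u t"; cases "adj G v t"; cases "adj G u w"; cases "adj G v w"; cases "adj G t w") simp_all
  qed
  have d: "entry G u u = 0" "entry G v v = 0" "entry G u v = 1" "entry G v u = 1"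
    using uv ne sy by (auto simp: entry_def)
  let ?\<pi> = "Transposition.transpose u v"
  let ?f = "recoord {u, v} ?\<pi>"
  have fx: "?f x u = prod.swap (x v)" "?f x v = prod.swap (x u)"
    "t \<noteq> u \<Longrightarrow> t \<noteq> v \<Longrightarrow> ?f x t = x t" for x t
    using ne by (auto simp: recoord_def swap_if_def)
  have "?f ` graph_space G = graph_space H"
  proof (rule graph_space_image_eq[OF G H])
    show "inj_on ?f (graph_space G)" by (rule inj_onI, rule recoord_inj[of ?\<pi>]) simp_all
    fix x assume x: "x \<in> graph_space G"
    let ?W = "verts G - {u} - {v}"
    have split: "sum h (verts G) = h u + (h v + sum h ?W)" for h :: "nat \<Rightarrow> bit"
      using sum.remove[OF fin uv(1), of h] sum.remove[of "verts G - {u}" v h] fin uv(2) ne by simp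
    define R where "R t = (\<Sum>w\<in>?W. entry G t w * fst (x w))" for t
    have s: "snd (x t) = entry G t u * fst (x u) + (entry G t v * fst (x v) + R t)" if "t \<in> verts G" for t
      unfolding graph_space_snd[OF x that] R_def by (rule split)
    show "?f x \<in> graph_space H"
    proof (rule graph_spaceI)
      fix t assume t: "t \<in> verts H"
      have "(\<Sum>w\<in>verts H. entry H t w * fst (?f x w)) =
        entry G t u * snd (x v) + (entry G t v * snd (x u) + (\<Sum>w\<in>?W. entry H t w * fst (?f x w)))"
        unfolding V split fx(1,2) by (simp add: e1)
      also have "(\<Sum>w\<in>?W. entry H t w * fst (?f x w)) = (\<Sum>w\<in>?W. entry H t w * fst (x w))"
      proof (rule sum.cong[OF refl])
        fix s assume "s \<in> ?W"
        then have "s \<noteq> u" "s \<noteq> v" by auto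
        then have "?f x s = x s" by (rule fx(3))
        then show "entry H t s * fst (?f x s) = entry H t s * fst (x s)" by (simp only:)
      qed
      also have "\<dots> = (if t = u \<or> t = v then R t else R t + (entry G t u * R v + entry G t v * R u))"
      proof (cases "t = u \<or> t = v")
        case True
        then show ?thesis by (simp add: e1 R_def)
      next
        case False
        have "(\<Sum>w\<in>?W. entry H t w * fst (x w)) =
          (\<Sum>w\<in>?W. entry G t w * fst (x w) + (entry G t u * (entry G v w * fst (x w)) + entry G t v * (entry G u w * fst (x w))))"
          using False by (intro sum.cong refl) (simp add: e2 algebra_simps)
        then show ?thesis using False by (simp add: sum.distrib R_def sum_distrib_left)
      qed
      finally have eq: "(\<Sum>w\<in>verts H. entry H t w * fst (?f x w)) =
        entry G t u * snd (x v) + (entry G t v * snd (x u) +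
          (if t = u \<or> t = v then R t else R t + (entry G t u * R v + entry G t v * R u)))" .
      have su: "snd (x u) = fst (x v) + R u" and sv: "snd (x v) = fst (x u) + R v"
        using s[OF uv(1)] s[OF uv(2)] by (simp_all add: d)
      consider "t = u" | "t = v" | "t \<noteq> u" "t \<noteq> v" by blast
      then show "snd (?f x t) = (\<Sum>w\<in>verts H. entry H t w * fst (?f x w))"
      proof cases
        case 1
        show ?thesis unfolding eq unfolding 1 fx su sv d by (simp add: algebra_simps)
      next
        case 2
        show ?thesis unfolding eq unfolding 2 fx su sv d by (simp add: algebra_simps)
      next
        case 3
        have "t \<in> verts G" using t V by simp
        then show ?thesis unfolding eq fx(3)[OF 3] s[OF \<open>t \<in> verts G\<close>] su sv using 3 by (simp add: algebra_simps)
      qed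
    next
      fix t assume t: "t \<notin> verts H"
      then have "t \<noteq> u" "t \<noteq> v" using uv V by auto
      then show "?f x t = 0" using fx(3)[of t x] graph_space_off[OF x, of t] t V by simp
    qed
  qed (simp add: V)
  moreover have "?\<pi> t \<in> verts G" if "t \<in> verts G" for t
    using that uv(1,2) by (auto simp: Transposition.transpose_def)
  ultimately show ?thesis
    using recoord_same(1)[OF graph_space_isotropic[OF G], of ?\<pi> "{u, v}"] V by simp
qed

text \<open>The vector of this move has the entry \<open>da\<close> at \<open>u\<close> and \<open>db\<close> at \<open>v\<close> and \<open>w\<close>. An exchange of the
  components at \<open>v\<close> and \<open>w\<close> brings it into the form required by the transvection. Afterwards the
  components at all three vertices are exchanged, and \<open>v\<close> and \<open>w\<close> trade names.\<close>

lemma same_Omega3: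
  assumes G: "framed_simple_graph G" and H: "framed_simple_graph H"
    and Hd: "H = set_nbrs G u ((nbrs G v - nbrs G w) \<union> (nbrs G w - nbrs G v))"
    and uvw: "u \<in> verts G" "v \<in> verts G" "w \<in> verts G" "distinct [u, v, w]"
    and fr: "framing G u = 0" "framing G v = 0" "framing G w = 0"
    and N: "nbrs G u = {v, w}"
  shows "same_graph_invariants G H"
proof -
  have fin: "finite (verts G)" using G unfolding framed_simple_graph_def by blast
  have V: "verts H = verts G" unfolding Hd set_nbrs_def by simp
  have irr: "\<not> adj G t t" and sy: "adj G t w \<longleftrightarrow> adj G w t" for t w
    using G unfolding framed_simple_graph_def by blast+
  have ne: "u \<noteq> v" "u \<noteq> w" "v \<noteq> w" using uvw(4) by auto
  have Nu: "adj G u t \<longleftrightarrow> t = v \<or> t = w" "adj G t u \<longleftrightarrow> t = v \<or> t = w" for t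
    using N sy[of t u] unfolding nbrs_def by auto
  have gu: "entry G u t = of_bool (t = v \<or> t = w)" "entry G t u = of_bool (t = v \<or> t = w)" for t
    using Nu ne fr by (auto simp: entry_def)
  have gvw: "entry G v v = 0" "entry G w w = 0" "entry G w v = entry G v w"
    using fr entry_sym[OF G] by (auto simp: entry_def)
  have e1: "entry H t s = entry G t s" if "t \<noteq> u" "s \<noteq> u" for t s
    using that unfolding Hd entry_def set_nbrs_def by auto
  have e2: "entry H u t = entry G v t + entry G w t" "entry H t u = entry G v t + entry G w t" if "t \<noteq> u" for t
    using that ne fr unfolding Hd entry_def set_nbrs_def nbrs_def by (auto simp: irr)
  have e3: "entry H u u = 0" using fr unfolding Hd entry_def set_nbrs_def by simp
  let ?\<pi> = "Transposition.transpose v w"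
  let ?tau = "transvect u v w"
  let ?sw = "recoord {v, w} id" and ?rn = "recoord {u, v, w} ?\<pi>"
  let ?f = "\<lambda>x. ?rn (?tau (?sw x))"
  let ?S = "\<lambda>x. twist (x u + prod.swap (x v) + prod.swap (x w))"
  have tw: "twist k = (fst k + snd k, fst k + snd k)" for k
    by (cases k rule: dir_cases) (simp_all, simp_all add: zero_prod_def)
  have fx: "?f x u = prod.swap (x u + ?S x)" "?f x v = x w + ?S x" "?f x w = x v + ?S x"
    "t \<noteq> u \<Longrightarrow> t \<noteq> v \<Longrightarrow> t \<noteq> w \<Longrightarrow> ?f x t = x t" for x t
    using ne by (simp_all add: recoord_def swap_if_def transvect_def tw prod_eq_iff)
  have "?f ` graph_space G = graph_space H"
  proof (rule graph_space_image_eq[OF G H])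
    show "inj_on ?f (graph_space G)"
    proof (rule inj_onI)
      fix x y assume "?f x = ?f y"
      then have "?tau (?sw x) = ?tau (?sw y)" by (rule recoord_inj[rotated]) simp
      then have "?sw x = ?sw y" using transvect_transvect[OF ne] by metis
      then show "x = y" by (rule recoord_inj[rotated]) simp
    qed
    fix x assume x: "x \<in> graph_space G"
    let ?W = "verts G - {u} - {v} - {w}"
    have split: "sum h (verts G) = h u + (h v + (h w + sum h ?W))" for h :: "nat \<Rightarrow> bit"
      using sum.remove[OF fin uvw(1), of h] sum.remove[of "verts G - {u}" v h]
        sum.remove[of "verts G - {u} - {v}" w h] fin uvw(2,3) ne by simp
    define R where "R t = (\<Sum>s\<in>?W. entry G t s * fst (x s))" for t
    have s: "snd (x t) = entry G t u * fst (x u) + (entry G t v * fst (x v) + (entry G t w * fst (x w) + R t))"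
      if "t \<in> verts G" for t
      unfolding graph_space_snd[OF x that] R_def by (rule split)
    define p where "p = entry G v w"
    have "R u = 0" unfolding R_def by (intro sum.neutral) (auto simp: gu)
    then have su: "snd (x u) = fst (x v) + fst (x w)" using s[OF uvw(1)] ne by (simp add: gu)
    have sv: "snd (x v) = fst (x u) + (p * fst (x w) + R v)" and sw: "snd (x w) = fst (x u) + (p * fst (x v) + R w)"
      using s[OF uvw(2)] s[OF uvw(3)] by (simp_all add: gu gvw p_def)
    define c where "c = fst (x u) + (p * fst (x v) + (p * fst (x w) + (R v + R w)))"
    have S: "?S x = (c, c)" unfolding tw c_def by (simp add: su sv sw algebra_simps)
    show "?f x \<in> graph_space H"
    proof (rule graph_spaceI)
      fix t assume t: "t \<in> verts H"
      have fu: "fst (?f x u) = fst (x v) + fst (x w) + c" "snd (?f x u) = fst (x u) + c"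
        and fv: "fst (?f x v) = fst (x w) + c" "snd (?f x v) = snd (x w) + c"
        and fw: "fst (?f x w) = fst (x v) + c" "snd (?f x w) = snd (x v) + c"
        unfolding fx S by (simp_all add: su)
      have "(\<Sum>s\<in>verts H. entry H t s * fst (?f x s)) =
        entry H t u * (fst (x v) + fst (x w) + c) + (entry H t v * (fst (x w) + c) + (entry H t w * (fst (x v) + c) +
          (\<Sum>s\<in>?W. entry H t s * fst (?f x s))))"
        unfolding V split fu fv fw ..
      also have "(\<Sum>s\<in>?W. entry H t s * fst (?f x s)) = (\<Sum>s\<in>?W. entry H t s * fst (x s))"
      proof (rule sum.cong[OF refl])
        fix s assume "s \<in> ?W"
        then have "s \<noteq> u" "s \<noteq> v" "s \<noteq> w" by auto
        then have "?f x s = x s" by (rule fx(4))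
        then show "entry H t s * fst (?f x s) = entry H t s * fst (x s)" by (simp only:)
      qed
      also have "\<dots> = (if t = u then R v + R w else R t)"
      proof (cases "t = u")
        case True
        have "(\<Sum>s\<in>?W. entry H t s * fst (x s)) = (\<Sum>s\<in>?W. entry G v s * fst (x s) + entry G w s * fst (x s))"
          using True by (intro sum.cong refl) (simp add: e2 algebra_simps)
        then show ?thesis using True by (simp add: sum.distrib R_def)
      next
        case False
        then show ?thesis unfolding R_def by (auto simp: e1 intro!: sum.cong)
      qed
      finally have eq: "(\<Sum>s\<in>verts H. entry H t s * fst (?f x s)) =
        entry H t u * (fst (x v) + fst (x w) + c) + (entry H t v * (fst (x w) + c) + (entry H t w * (fst (x v) + c) +
          (if t = u then R v + R w else R t)))" .
      consider "t = u" | "t = v" | "t = w" | "t \<noteq> u" "t \<noteq> v" "t \<noteq> w" by blast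
      then show "snd (?f x t) = (\<Sum>s\<in>verts H. entry H t s * fst (?f x s))"
      proof cases
        case 1
        have "entry H u u = 0" "entry H u v = p" "entry H u w = p" using e3 e2 ne gvw by (simp_all add: p_def)
        then show ?thesis unfolding eq unfolding 1 fu by (simp add: c_def algebra_simps)
      next
        case 2
        have "entry H v u = p" "entry H v v = 0" "entry H v w = p" using e1 e2 ne gvw by (simp_all add: p_def)
        then show ?thesis unfolding eq unfolding 2 fv sw using ne by (simp add: c_def algebra_simps)
      next
        case 3
        have "entry H w u = p" "entry H w v = p" "entry H w w = 0" using e1 e2 ne gvw by (simp_all add: p_def)
        then show ?thesis unfolding eq unfolding 3 fw sv using ne by (simp add: c_def algebra_simps)
      next
        case 4
        have tG: "t \<in> verts G" using t V by simp
        have "entry H t u = entry G t v + entry G t w" "entry H t v = entry G t v" "entry H t w = entry G t w" "entry G t u = 0"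
          using e1 e2 4 ne gu entry_sym[OF G, of t] by simp_all
        then show ?thesis unfolding eq fx(4)[OF 4] s[OF tG] using 4 by (simp add: algebra_simps)
      qed
    next
      fix t assume t: "t \<notin> verts H"
      then have "t \<noteq> u" "t \<noteq> v" "t \<noteq> w" using uvw V by auto
      then show "?f x t = 0" using fx(4)[of t x] graph_space_off[OF x, of t] t V by simp
    qed
  qed (simp add: V)
  then have eq: "graph_space H = ?rn ` ?tau ` ?sw ` graph_space G" by (simp add: image_image)
  let ?V = "verts G" and ?L1 = "?sw ` graph_space G"
  let ?L2 = "?tau ` ?L1"
  have \<pi>V: "?\<pi> t \<in> ?V" if "t \<in> ?V" for t using that uvw by (auto simp: Transposition.transpose_def)
  have "recoord {u, v, w} ?\<pi> (?rn x) = x" for x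
    using ne by (intro ext) (auto simp: recoord_def swap_if_def Transposition.transpose_def)
  \<comment> \<open>the last step is an involution, so the intermediate space inherits isotropy from the final one\<close>
  then have L2: "?L2 = ?rn ` graph_space H" unfolding eq by (simp add: image_image)
  have IH: "isotropic_system ?V (graph_space H)" using graph_space_isotropic[OF H] V by simp
  note 1 = recoord_same[OF graph_space_isotropic[OF G], of id "{v, w}"]
  note 2 = recoord_same[OF IH, of ?\<pi> "{u, v, w}", folded L2]
  let ?r = "\<lambda>t. if t = u then da else if t = v \<or> t = w then db else (0 :: bit \<times> bit)"
  have r: "?r \<in> graph_space G"
  proof (rule graph_spaceI)
    fix t assume "t \<in> verts G"
    have "(\<Sum>s\<in>verts G. entry G t s * fst (?r s)) = (\<Sum>s\<in>verts G. entry G t s * fst (if s \<in> {u} then da else (0 :: bit \<times> bit)))"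
      by (intro sum.cong) auto
    also have "\<dots> = entry G t u" using fin uvw by (subst unit_sum) simp_all
    finally show "snd (?r t) = (\<Sum>s\<in>verts G. entry G t s * fst (?r s))" using ne by (auto simp: gu)
  qed (use uvw in auto)
  have "same_invariants ?V (graph_space G) ?V ?L1" by (rule 1) simp_all
  also have "same_invariants ?V ?L1 ?V ?L2"
  proof (rule third_move.same, intro third_move.intro third_move_axioms.intro)
    show "isotropic_system ?V ?L1" by (rule 1) simp_all
    show "isotropic_system ?V ?L2" by (rule 2) (simp_all add: \<pi>V)
    have "(\<lambda>t. if t = u \<or> t = v \<or> t = w then da else 0) = ?sw ?r"
      using ne by (auto simp: recoord_def swap_if_def fun_eq_iff)
    then show "(\<lambda>t. if t = u \<or> t = v \<or> t = w then da else 0) \<in> ?L1" using r by blast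
  qed (fact uvw(1-3) ne refl)+
  also have "same_invariants ?V ?L2 ?V (graph_space H)"
    by (rule same_invariants_sym, rule 2) (simp_all add: \<pi>V)
  finally show ?thesis unfolding V .
qed

theorem elementary_equiv_same:
  assumes "elementary_equiv G H" shows "same_graph_invariants G H"
proof -
  have G: "framed_simple_graph G" and H: "framed_simple_graph H" and c: "graph_iso G H \<or> graph_move G H"
    using assms unfolding elementary_equiv_def by auto
  from c show ?thesis
  proof
    assume "graph_iso G H"
    then show ?thesis by (rule same_if_iso[OF G H])
  next
    assume "graph_move G H"
    then show ?thesis
    proof cases
      case (Omega1 v)
      then show ?thesis using same_Omega1[OF G] by simp
    next
      case (Omega2 u v)
      then show ?thesis using same_Omega2[OF G] by blast
    next
      case (Omega3 u v w)
      then show ?thesis using same_Omega3[OF G H] by blast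
    next
      case (Omega4 u v)
      then show ?thesis using same_Omega4[OF G H] by blast
    next
      case (Omega4' v)
      then show ?thesis using same_Omega4'[OF G H] by blast
    qed
  qed
qed

theorem equivclp_same:
  assumes "equivclp elementary_equiv G H" shows "same_graph_invariants G H"
  using assms
proof (induction rule: equivclp_induct)
  case base
  show ?case by (simp add: same_invariants_def)
next
  case (step H K)
  then show ?case using elementary_equiv_same same_invariants_sym same_invariants_trans by blast
qed

section \<open>Circle graphs\<close>

text \<open>The chord \<open>u\<close> has the two ends \<open>e u False\<close> and \<open>e u True\<close> on a line. Two chords with four distinct ends
  interlace iff an odd number of the four comparisons between their ends holds.\<close>

definition crossing :: "('a \<Rightarrow> bool \<Rightarrow> real) \<Rightarrow> 'a \<Rightarrow> 'a \<Rightarrow> bool" where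
  "crossing e u v \<longleftrightarrow>
    ((e u False < e v False) \<noteq> (e u False < e v True)) \<noteq> ((e u True < e v False) \<noteq> (e u True < e v True))"

definition circle_graph :: "'a set \<Rightarrow> ('a \<Rightarrow> 'a \<Rightarrow> bool) \<Rightarrow> bool" where
  "circle_graph U R \<longleftrightarrow> (\<exists>e. inj_on (\<lambda>(v, b). e v b) (U \<times> UNIV) \<and>
    (\<forall>u\<in>U. \<forall>v\<in>U. u \<noteq> v \<longrightarrow> (R u v \<longleftrightarrow> crossing e u v)))"

lemma circle_graph_image:
  assumes "circle_graph U R" "inj_on f W" "f ` W \<subseteq> U"
    and "\<And>i j. i \<in> W \<Longrightarrow> j \<in> W \<Longrightarrow> i \<noteq> j \<Longrightarrow> R' i j \<longleftrightarrow> R (f i) (f j)"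
  shows "circle_graph W R'"
proof -
  obtain e where e: "inj_on (\<lambda>(v, b). e v b) (U \<times> UNIV)"
    "\<And>u v. u \<in> U \<Longrightarrow> v \<in> U \<Longrightarrow> u \<noteq> v \<Longrightarrow> R u v \<longleftrightarrow> crossing e u v"
    using assms(1) unfolding circle_graph_def by blast
  have fU: "f i \<in> U" if "i \<in> W" for i using that assms(3) by blast
  have "inj_on (\<lambda>(v, b). e (f v) b) (W \<times> UNIV)"
  proof (rule inj_onI)
    fix x y assume xy: "x \<in> W \<times> (UNIV :: bool set)" "y \<in> W \<times> (UNIV :: bool set)"
      "(case x of (v, b) \<Rightarrow> e (f v) b) = (case y of (v, b) \<Rightarrow> e (f v) b)"
    obtain i b j c where ij: "x = (i, b)" "y = (j, c)" by (metis surj_pair)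
    then have "i \<in> W" "j \<in> W" using xy by auto
    then have "(f i, b) = (f j, c)"
      using inj_onD[OF e(1), of "(f i, b)" "(f j, c)"] fU xy(3) ij by simp
    then show "x = y" using ij assms(2) \<open>i \<in> W\<close> \<open>j \<in> W\<close> by (auto simp: inj_on_def)
  qed
  moreover have "R' i j \<longleftrightarrow> crossing (\<lambda>v. e (f v)) i j" if "i \<in> W" "j \<in> W" "i \<noteq> j" for i j
    using that assms(2,4) e(2)[of "f i" "f j"] fU by (auto simp: crossing_def inj_on_def)
  ultimately show ?thesis unfolding circle_graph_def by (intro exI[of _ "\<lambda>v. e (f v)"]) blast
qed

lemma circle_graph_cong:
  assumes "circle_graph U R" "\<And>i j. i \<in> U \<Longrightarrow> j \<in> U \<Longrightarrow> i \<noteq> j \<Longrightarrow> R' i j \<longleftrightarrow> R i j"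
  shows "circle_graph U R'"
  using circle_graph_image[of U R id U R'] assms by simp

text \<open>Reflect the open interval between the ends of the chord \<open>v\<close>. A comparison of two points is reversed iff
  both lie in this interval. So the parity of the comparisons between the ends of two chords changes iff
  both chords have exactly one end in the interval, that is, iff both cross \<open>v\<close>.\<close>

lemma circle_graph_local_complement:
  assumes c: "circle_graph U R" and v: "v \<in> U"
    and v1: "\<And>i. i \<in> U \<Longrightarrow> i \<noteq> v \<Longrightarrow> R' v i \<longleftrightarrow> R v i"
    and v2: "\<And>i. i \<in> U \<Longrightarrow> i \<noteq> v \<Longrightarrow> R' i v \<longleftrightarrow> R i v"
    and R': "\<And>i j. i \<in> U \<Longrightarrow> j \<in> U \<Longrightarrow> i \<noteq> v \<Longrightarrow> j \<noteq> v \<Longrightarrow> i \<noteq> j \<Longrightarrow> R' i j \<longleftrightarrow> R i j \<noteq> (R v i \<and> R v j)"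
  shows "circle_graph U R'"
proof -
  obtain e where inj: "inj_on (\<lambda>(v, b). e v b) (U \<times> UNIV)"
    and e: "\<And>u v. u \<in> U \<Longrightarrow> v \<in> U \<Longrightarrow> u \<noteq> v \<Longrightarrow> R u v \<longleftrightarrow> crossing e u v"
    using c unfolding circle_graph_def by blast
  define l h where "l = min (e v False) (e v True)" and "h = max (e v False) (e v True)"
  define I where "I t \<longleftrightarrow> l < t \<and> t < h" for t
  define \<rho> where "\<rho> t = (if I t then l + h - t else t)" for t
  have inj_\<rho>: "\<rho> s = \<rho> t \<longleftrightarrow> s = t" for s t unfolding \<rho>_def I_def by auto
  have less: "\<rho> s < \<rho> t \<longleftrightarrow> (s < t) \<noteq> (I s \<and> I t)" if "s \<noteq> t" for s t
    using that unfolding \<rho>_def I_def by auto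
  have I\<rho>: "I (\<rho> t) \<longleftrightarrow> I t" for t unfolding \<rho>_def I_def by auto
  have fix_v: "\<rho> (e v b) = e v b" for b
    unfolding \<rho>_def I_def l_def h_def by (cases b) auto
  have dist: "e i b \<noteq> e j c" if "i \<in> U" "j \<in> U" "i \<noteq> j" for i j b c
    using inj_onD[OF inj, of "(i, b)" "(j, c)"] that by auto
  have I_iff: "I t \<longleftrightarrow> (e v False < t) \<noteq> (e v True < t)" if "t \<noteq> e v False" "t \<noteq> e v True" for t
    using that unfolding I_def l_def h_def by auto
  have cr_v: "crossing e v i \<longleftrightarrow> I (e i False) \<noteq> I (e i True)" if "i \<in> U" "i \<noteq> v" for i
    using dist[OF that(1) v that(2)] unfolding crossing_def by (auto simp: I_iff)
  have cr_v': "crossing e i v \<longleftrightarrow> crossing e v i" if "i \<in> U" "i \<noteq> v" for i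
  proof -
    have "e i b < e v c \<longleftrightarrow> \<not> e v c < e i b" for b c
      using dist[OF that(1) v that(2), of b c] by auto
    then show ?thesis unfolding crossing_def by auto
  qed
  let ?e = "\<lambda>i b. \<rho> (e i b)"
  have "inj_on (\<lambda>(v, b). ?e v b) (U \<times> UNIV)"
    using inj unfolding inj_on_def by (auto simp: inj_\<rho>)
  moreover have "R' i j \<longleftrightarrow> crossing ?e i j" if ij: "i \<in> U" "j \<in> U" "i \<noteq> j" for i j
  proof -
    have nI: "\<not> I (e v b)" for b unfolding I_def l_def h_def by (cases b) auto
    have cr: "crossing ?e i j \<longleftrightarrow> crossing e i j \<noteq>
        ((I (e i False) \<noteq> I (e i True)) \<and> (I (e j False) \<noteq> I (e j True)))"
      unfolding crossing_def using less[OF dist[OF ij]] by auto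
    consider "i = v" | "j = v" | "i \<noteq> v" "j \<noteq> v" by blast
    then show ?thesis
    proof cases
      case 1
      then show ?thesis using cr nI v1[of j] e[of v j] ij by simp
    next
      case 2
      then show ?thesis using cr nI v2[of i] e[of i v] ij by simp
    next
      case 3
      then show ?thesis using cr R'[of i j] e[of i j] e[of v i] e[of v j] cr_v[of i] cr_v[of j] ij v by simp
    qed
  qed
  ultimately show ?thesis unfolding circle_graph_def by (intro exI[of _ ?e]) blast
qed

section \<open>The wheel is not a circle graph\<close>

text \<open>On the non-edges the two orders agree. If three vertices in a row on the complementary pentagon
  \<open>0, 2, 4, 1, 3\<close> were ordered monotonically, the first and the third would be ordered in the same way by
  \<open>P\<close> and \<open>Q\<close>, although they are adjacent. So the direction of \<open>P\<close> alternates around a cycle of odd length.\<close>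

lemma pentagon_not_permutation_graph:
  fixes P Q :: "nat \<Rightarrow> nat \<Rightarrow> bool"
  assumes tot: "\<And>i j. i < 5 \<Longrightarrow> j < 5 \<Longrightarrow> i \<noteq> j \<Longrightarrow> P i j \<noteq> P j i" "\<And>i j. i < 5 \<Longrightarrow> j < 5 \<Longrightarrow> i \<noteq> j \<Longrightarrow> Q i j \<noteq> Q j i"
    and tr: "\<And>i j k. i < 5 \<Longrightarrow> j < 5 \<Longrightarrow> k < 5 \<Longrightarrow> P i j \<Longrightarrow> P j k \<Longrightarrow> P i k"
      "\<And>i j k. i < 5 \<Longrightarrow> j < 5 \<Longrightarrow> k < 5 \<Longrightarrow> Q i j \<Longrightarrow> Q j k \<Longrightarrow> Q i k"
    and adj: "\<And>i j. i < 5 \<Longrightarrow> j < 5 \<Longrightarrow> i \<noteq> j \<Longrightarrow> P i j \<noteq> Q i j \<longleftrightarrow> j = (i + 1) mod 5 \<or> i = (j + 1) mod 5"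
  shows False
proof -
  have alt: "P i j \<noteq> P j k"
    if ijk: "i < 5" "j < 5" "k < 5" "i \<noteq> j" "j \<noteq> k" "i \<noteq> k"
      "P i j = Q i j" "P j k = Q j k" "P i k \<noteq> Q i k" for i j k
    using tot[of i j] tot[of j k] tot[of i k] tr[of i j k] tr[of k j i] ijk by metis
  have "P 0 2 \<noteq> P 2 4"
    using alt[of 0 2 4] adj[of 0 2] adj[of 2 4] adj[of 0 4] by simp
  moreover have "P 2 4 \<noteq> P 4 1"
    using alt[of 2 4 1] adj[of 2 4] adj[of 4 1] adj[of 2 1] by simp
  moreover have "P 4 1 \<noteq> P 1 3"
    using alt[of 4 1 3] adj[of 4 1] adj[of 1 3] adj[of 4 3] by simp
  moreover have "P 1 3 \<noteq> P 3 0"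
    using alt[of 1 3 0] adj[of 1 3] adj[of 3 0] adj[of 1 0] by simp
  moreover have "P 3 0 \<noteq> P 0 2"
    using alt[of 3 0 2] adj[of 3 0] adj[of 0 2] adj[of 3 2] by simp
  ultimately show False by blast
qed

lemma W5_not_circle_graph: "\<not> circle_graph (verts W5) (adj W5)"
proof
  assume "circle_graph (verts W5) (adj W5)"
  then obtain e where inj: "inj_on (\<lambda>(v, b). e v b) (verts W5 \<times> UNIV)"
    and e: "\<And>u v. u \<in> verts W5 \<Longrightarrow> v \<in> verts W5 \<Longrightarrow> u \<noteq> v \<Longrightarrow> adj W5 u v \<longleftrightarrow> crossing e u v"
    unfolding circle_graph_def by blast
  have dist: "e i b \<noteq> e j c" if "i < 6" "j < 6" "i \<noteq> j \<or> b \<noteq> c" for i j b c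
    using inj_onD[OF inj, of "(i, b)" "(j, c)"] that by (auto simp: W5_def)
  define l h where "l = min (e 5 False) (e 5 True)" and "h = max (e 5 False) (e 5 True)"
  define I where "I t \<longleftrightarrow> l < t \<and> t < h" for t
  have lh: "l < h" using dist[of 5 5 False True] unfolding l_def h_def by auto
  have ends: "e i b \<noteq> l" "e i b \<noteq> h" if "i < 5" for i b
    using dist[of i 5 b False] dist[of i 5 b True] that unfolding l_def h_def by (auto simp: min_def max_def)
  define x y where "x i = (if I (e i False) then e i False else e i True)"
    and "y i = (if I (e i False) then e i True else e i False)" for i
  have xy: "I (x i)" "\<not> I (y i)" "y i \<noteq> l" "y i \<noteq> h" if i: "i < 5" for i
  proof -
    have "crossing e 5 i" using e[of 5 i] i by (simp add: W5_def)
    then have "I (e i False) \<noteq> I (e i True)"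
    proof -
      have "I t \<longleftrightarrow> (e 5 False < t) \<noteq> (e 5 True < t)" if "t \<noteq> e 5 False" "t \<noteq> e 5 True" for t
        using that unfolding I_def l_def h_def by auto
      then have "I (e i b) \<longleftrightarrow> (e 5 False < e i b) \<noteq> (e 5 True < e i b)" for b
        using dist[of i 5 b] i by simp
      then show ?thesis using \<open>crossing e 5 i\<close> unfolding crossing_def by auto
    qed
    then show "I (x i)" "\<not> I (y i)" unfolding x_def y_def by auto
    show "y i \<noteq> l" "y i \<noteq> h" using ends[OF i] unfolding y_def by auto
  qed
  have y_ne: "y i \<noteq> y j" "x i \<noteq> x j" if "i < 5" "j < 5" "i \<noteq> j" for i j
    using dist that unfolding x_def y_def by auto
  \<comment> \<open>\<open>P\<close> orders the inner ends upwards from \<open>l\<close> to \<open>h\<close>. \<open>Q\<close> orders the outer ends along the other arc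
    from \<open>l\<close> to \<open>h\<close>, that is, downwards from \<open>l\<close> and then from the upper end of the line down to \<open>h\<close>.\<close>
  define P where "P i j \<longleftrightarrow> x i < x j" for i j
  define Q where "Q i j \<longleftrightarrow> (y i < l \<and> h < y j) \<or> (y j < y i \<and> (h < y j \<or> y i < l))" for i j
  have side: "y i < l \<or> h < y i" if "i < 5" for i using xy[OF that] unfolding I_def by auto
  have cross: "crossing e i j \<longleftrightarrow> P i j \<noteq> Q i j" if ij: "i < 5" "j < 5" "i \<noteq> j" for i j
  proof -
    have "crossing e i j \<longleftrightarrow> ((x i < x j) \<noteq> (x i < y j)) \<noteq> ((y i < x j) \<noteq> (y i < y j))"
      unfolding crossing_def x_def y_def by auto
    moreover have "x i < y j \<longleftrightarrow> h < y j" "y i < x j \<longleftrightarrow> y i < l"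
      using xy(1)[OF ij(1)] xy(1)[OF ij(2)] side[OF ij(1)] side[OF ij(2)] unfolding I_def by auto
    moreover have "((h < y j) \<noteq> ((y i < l) \<noteq> (y i < y j))) \<longleftrightarrow> Q i j"
      using side[OF ij(1)] side[OF ij(2)] y_ne(1)[OF ij] lh unfolding Q_def by linarith
    ultimately show ?thesis unfolding P_def by blast
  qed
  show False
  proof (rule pentagon_not_permutation_graph[of P Q])
    fix i j :: nat assume ij: "i < 5" "j < 5" "i \<noteq> j"
    show "P i j \<noteq> P j i" using y_ne(2)[OF ij] unfolding P_def by auto
    show "Q i j \<noteq> Q j i" using side[OF ij(1)] side[OF ij(2)] y_ne(1)[OF ij] lh unfolding Q_def by linarith
    have "adj W5 i j \<longleftrightarrow> j = (i + 1) mod 5 \<or> i = (j + 1) mod 5" using ij by (simp add: W5_def)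
    then show "P i j \<noteq> Q i j \<longleftrightarrow> j = (i + 1) mod 5 \<or> i = (j + 1) mod 5"
      using cross[OF ij] e[of i j] ij by (simp add: W5_def)
  next
    fix i j k :: nat assume "i < 5" "j < 5" "k < 5"
    show "P i j \<Longrightarrow> P j k \<Longrightarrow> P i k" unfolding P_def by linarith
    show "Q i j \<Longrightarrow> Q j k \<Longrightarrow> Q i k" using lh unfolding Q_def by linarith
  qed
qed

section \<open>Changing the chosen directions\<close>

text \<open>The only candidate for a vector aligned with the new choice is the fundamental vector of \<open>v\<close>.\<close>

lemma (in isotropic_system) transversal_upd:
  assumes t: "transversal V L p" and p: "\<And>t. p t \<noteq> 0" and v: "v \<in> V" and d: "d \<noteq> 0" "d \<noteq> p v"
    and x: "x \<in> L" "fundamental p V v x"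
  shows "transversal V L (p(v := d)) \<longleftrightarrow> x v \<noteq> d"
proof
  assume t': "transversal V L (p(v := d))"
  show "x v \<noteq> d"
  proof
    assume "x v = d"
    then have "aligned (p(v := d)) V x" using x(2) unfolding fundamental_def aligned_def by auto
    then have "x = (\<lambda>_. 0)" using transversal_zero[OF t' x(1)] by blast
    then show False using x(2) unfolding fundamental_def by simp
  qed
next
  assume xd: "x v \<noteq> d"
  show "transversal V L (p(v := d))"
    unfolding transversal_def
  proof (intro ballI impI)
    fix y assume y: "y \<in> L" "aligned (p(v := d)) V y"
    have yv: "y v = 0 \<or> y v = d" using y(2) v unfolding aligned_def by auto
    have yt: "y t = 0 \<or> y t = p t" if "t \<in> V" "t \<noteq> v" for t using y(2) that unfolding aligned_def by auto
    show "y = (\<lambda>_. 0)"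
    proof (cases "y v = 0")
      case True
      then have "aligned p V y" using yt unfolding aligned_def by blast
      then show ?thesis using transversal_zero[OF t y(1)] by blast
    next
      case False
      then have "y v = d" using yv by blast
      then have "fundamental p V v y" using d yt unfolding fundamental_def aligned_def by auto
      then show ?thesis using fundamental_unique[OF t p x y(1)] xd \<open>y v = d\<close> by simp
    qed
  qed
qed

lemma sum_of_two_directions:
  fixes a b c :: "bit \<times> bit"
  assumes "a \<noteq> 0" "b \<noteq> 0" "c \<noteq> 0" "a \<noteq> b" "a \<noteq> c" "b \<noteq> c"
  shows "a + b = c"
  using assms by (cases a rule: dir_cases; cases b rule: dir_cases; cases c rule: dir_cases) auto

text \<open>Changing the direction at \<open>v\<close> adds the fundamental vector of \<open>v\<close> to those of its neighbours and
  leaves the others alone: the graph undergoes a local complementation at \<open>v\<close>.\<close>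

lemma (in isotropic_system) circle_graph_upd:
  assumes t: "transversal V L p" and p: "\<And>t. p t \<noteq> 0" and v: "v \<in> V" and d: "d \<noteq> 0" "d \<noteq> p v"
    and t': "transversal V L (p(v := d))" and c: "circle_graph V (fund V L p)"
  shows "circle_graph V (fund V L (p(v := d)))"
proof -
  let ?p = "p(v := d)"
  have p': "?p t \<noteq> 0" for t using p d by simp
  obtain x where x: "x \<in> L" "fundamental p V v x" using ex_fundamental[OF t p v] by blast
  have xd: "x v \<noteq> d" using transversal_upd[OF t p v d x] t' by blast
  have xv: "x v \<noteq> 0" "x v \<noteq> p v" "\<And>s. s \<in> V \<Longrightarrow> s \<noteq> v \<Longrightarrow> x s = 0 \<or> x s = p s"
    using x(2) unfolding fundamental_def aligned_def by auto
  have x': "fundamental ?p V v x" using xv xd unfolding fundamental_def aligned_def by auto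
  have fv: "fund V L p v j \<longleftrightarrow> x j \<noteq> 0" "fund V L ?p v j \<longleftrightarrow> x j \<noteq> 0" for j
    using fund_iff[OF t p x] fund_iff[OF t' p' x(1) x'] by auto
  have fi: "fund V L ?p i j \<longleftrightarrow> fund V L p i j \<noteq> (fund V L p v i \<and> fund V L p v j)"
    if ij: "i \<in> V" "j \<in> V" "i \<noteq> v" "j \<noteq> v" "i \<noteq> j" for i j
  proof -
    obtain y where y: "y \<in> L" "fundamental p V i y" using ex_fundamental[OF t p ij(1)] by blast
    have yi: "y i \<noteq> 0" "y i \<noteq> p i" "\<And>s. s \<in> V \<Longrightarrow> s \<noteq> i \<Longrightarrow> y s = 0 \<or> y s = p s"
      using y(2) unfolding fundamental_def aligned_def by auto
    have f1: "fund V L p i j \<longleftrightarrow> y j \<noteq> 0" using fund_iff[OF t p y] .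
    have f2: "fund V L p v i \<longleftrightarrow> y v \<noteq> 0" using fund_sym[OF t p v ij(1)] ij(3) fund_iff[OF t p y] by auto
    show ?thesis
    proof (cases "y v = 0")
      case True
      then have "fundamental ?p V i y" using yi ij unfolding fundamental_def aligned_def by auto
      from fund_iff[OF t' p' y(1) this] show ?thesis using f1 f2 True by simp
    next
      case False
      then have yv: "y v = p v" using yi(3) v ij(3) by auto
      let ?z = "\<lambda>s. y s + x s"
      have "?z v = d" unfolding yv using xv xd d p by (intro sum_of_two_directions) auto
      moreover have "?z i \<noteq> 0 \<and> ?z i \<noteq> p i"
        using yi(1,2) xv(3)[OF ij(1,3)] by (metis add.right_neutral add.commute dir_add_assoc dir_add_eq_0)
      moreover have "?z s = 0 \<or> ?z s = p s" if "s \<in> V" "s \<noteq> v" "s \<noteq> i" for s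
        using dir_closed[of "y s" "p s" "x s"] yi(3) xv(3) that by blast
      ultimately have "fundamental ?p V i ?z" using ij unfolding fundamental_def aligned_def by auto
      then have "fund V L ?p i j \<longleftrightarrow> ?z j \<noteq> 0" using fund_iff[OF t' p' add[OF y(1) x(1)]] by blast
      moreover have "?z j \<noteq> 0 \<longleftrightarrow> (y j \<noteq> 0) \<noteq> (x j \<noteq> 0)"
        using yi(3)[of j] xv(3)[of j] ij p[of j] by auto
      ultimately show ?thesis using f1 f2 fv(1) False by simp
    qed
  qed
  show ?thesis
  proof (rule circle_graph_local_complement[OF c v])
    show "fund V L ?p v i \<longleftrightarrow> fund V L p v i" for i using fv by simp
    show "fund V L ?p i v \<longleftrightarrow> fund V L p i v" if "i \<in> V" "i \<noteq> v" for i
      unfolding fund_sym[OF t p that(1) v that(2)] fund_sym[OF t' p' that(1) v that(2)] fv ..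
    show "fund V L ?p i j \<longleftrightarrow> fund V L p i j \<noteq> (fund V L p v i \<and> fund V L p v j)"
      if "i \<in> V" "j \<in> V" "i \<noteq> v" "j \<noteq> v" "i \<noteq> j" for i j
      using fi[OF that] .
  qed
qed

lemma ex_third_direction:
  fixes a b :: "bit \<times> bit"
  assumes "a \<noteq> 0" "b \<noteq> 0" "a \<noteq> b"
  obtains c where "c \<noteq> 0" "c \<noteq> a" "c \<noteq> b"
proof (rule that[of "a + b"])
  show "a + b \<noteq> 0" "a + b \<noteq> a" "a + b \<noteq> b"
    using assms by (cases a rule: dir_cases; cases b rule: dir_cases; auto)+
qed

text \<open>Induction on the number of vertices where \<open>p\<close> and \<open>p'\<close> differ. If such a vertex \<open>v\<close> cannot be
  corrected alone, it has a neighbour \<open>w\<close> where they differ, too. If \<open>w\<close> cannot be corrected alone either,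
  both are corrected in three steps that pass through the third direction at \<open>v\<close>: a pivot, written as
  three local complementations.\<close>

lemma (in isotropic_system) circle_graph_gauge:
  assumes "transversal V L p" "\<And>t. p t \<noteq> 0" "transversal V L p'" "\<And>t. p' t \<noteq> 0"
    "circle_graph V (fund V L p)"
  shows "circle_graph V (fund V L p')"
  using assms
proof (induction "card {v \<in> V. p v \<noteq> p' v}" arbitrary: p rule: less_induct)
  case less
  note t = less.prems(1) and p = less.prems(2) and t' = less.prems(3) and p' = less.prems(4) and c = less.prems(5)
  let ?D = "\<lambda>p. {v \<in> V. p v \<noteq> p' v}"
  have finD: "finite (?D q)" for q using fin by simp
  show ?case
  proof (cases "?D p = {}")
    case True
    have "aligned p A x = aligned p' A x" if "A \<subseteq> V" for A x
    proof -
      have "p v = p' v" if "v \<in> A" for v using True that \<open>A \<subseteq> V\<close> by blast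
      then show ?thesis unfolding aligned_def by simp
    qed
    then have "fundamental p V i x = fundamental p' V i x" if "i \<in> V" for i x
      using True that unfolding fundamental_def by auto
    then have "fund V L p' i j = fund V L p i j" if "i \<in> V" for i j using that unfolding fund_def by simp
    then show ?thesis by (intro circle_graph_cong[OF c]) simp
  next
    case False
    \<comment> \<open>a vertex whose direction can be corrected at once\<close>
    have one: ?thesis if v: "v \<in> V" "p v \<noteq> p' v" and u: "transversal V L (p(v := p' v))" for v
    proof (rule less.hyps)
      have "?D (p(v := p' v)) \<subset> ?D p" using v by auto
      then show "card (?D (p(v := p' v))) < card (?D p)" using finD by (rule psubset_card_mono[rotated])
      show "circle_graph V (fund V L (p(v := p' v)))"
        using v p' by (intro circle_graph_upd[OF t p v(1) _ _ u c]) auto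
      show "transversal V L (p(v := p' v))" by (fact u)
      show "(p(v := p' v)) s \<noteq> 0" for s using p p' by simp
    qed (fact t' p')+
    obtain v where v: "v \<in> V" "p v \<noteq> p' v" using False by blast
    obtain x where x: "x \<in> L" "fundamental p V v x" using ex_fundamental[OF t p v(1)] by blast
    show ?thesis
    proof (cases "x v = p' v")
      case False
      then show ?thesis using one[OF v] transversal_upd[OF t p v(1) p' v(2)[symmetric] x] by blast
    next
      case xv: True
      have xs: "x s = 0 \<or> x s = p s" if "s \<in> V" "s \<noteq> v" for s
        using x(2) that unfolding fundamental_def aligned_def by auto
      obtain w where w: "w \<in> V" "w \<noteq> v" "x w \<noteq> 0" "p w \<noteq> p' w"
      proof (rule ccontr)
        assume n: "\<not> thesis"
        have "aligned p' V x" unfolding aligned_def using xs xv n that by metis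
        then have "x = (\<lambda>_. 0)" using transversal_zero[OF t' x(1)] by blast
        then show False using x(2) unfolding fundamental_def by simp
      qed
      have xw: "x w = p w" using xs w by blast
      obtain y where y: "y \<in> L" "fundamental p V w y" using ex_fundamental[OF t p w(1)] by blast
      have yw: "y w \<noteq> 0" "y w \<noteq> p w" and ys: "\<And>s. s \<in> V \<Longrightarrow> s \<noteq> w \<Longrightarrow> y s = 0 \<or> y s = p s"
        using y(2) unfolding fundamental_def aligned_def by auto
      have yv: "y v = p v"
        using fund_sym[OF t p v(1) w(1)] w(2,3) fund_iff[OF t p x] fund_iff[OF t p y] ys[OF v(1)] by auto
      show ?thesis
      proof (cases "y w = p' w")
        case False
        then show ?thesis using one[OF w(1,4)] transversal_upd[OF t p w(1) p' w(4)[symmetric] y] by blast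
      next
        case yw': True
        obtain d where d: "d \<noteq> 0" "d \<noteq> p v" "d \<noteq> p' v" using ex_third_direction[OF p p' v(2)] by blast
        let ?p1 = "p(v := d)" let ?p2 = "?p1(w := p' w)" let ?p3 = "?p2(v := p' v)"
        have n: "?p1 s \<noteq> 0" "?p2 s \<noteq> 0" "?p3 s \<noteq> 0" for s using p p' d by auto
        have t1: "transversal V L ?p1" using transversal_upd[OF t p v(1) d(1,2) x] d xv by auto
        have c1: "circle_graph V (fund V L ?p1)" by (rule circle_graph_upd[OF t p v(1) d(1,2) t1 c])
        let ?z = "\<lambda>s. y s + x s"
        have zw: "?z w \<noteq> 0" "?z w \<noteq> p w" "?z w \<noteq> p' w" "?z v = d"
        proof -
          show "?z w \<noteq> 0" "?z w \<noteq> p w" "?z w \<noteq> p' w"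
            unfolding xw yw' using p[of w] p'[of w] w(4)
            by (cases "p w" rule: dir_cases; cases "p' w" rule: dir_cases; auto)+
          show "?z v = d" unfolding yv xv using p p' d v(2) by (intro sum_of_two_directions) auto
        qed
        have zs: "?z s = 0 \<or> ?z s = p s" if "s \<in> V" "s \<noteq> v" "s \<noteq> w" for s
          using dir_closed[of "y s" "p s" "x s"] ys xs that by blast
        have z: "?z \<in> L" "fundamental ?p1 V w ?z"
          using add[OF y(1) x(1)] zw zs w(2) unfolding fundamental_def aligned_def by auto
        have w1: "p' w \<noteq> ?p1 w" using w by auto
        have t2: "transversal V L ?p2"
          using transversal_upd[OF t1 n(1) w(1) p' w1 z] zw by auto
        have c2: "circle_graph V (fund V L ?p2)" by (rule circle_graph_upd[OF t1 n(1) w(1) p' w1 t2 c1])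
        have yv2: "y v \<noteq> p' v" using yv v(2) by simp
        have y2: "fundamental ?p2 V v y"
          using yv p[of v] d(2) ys yw' w(2) unfolding fundamental_def aligned_def by auto
        have "p' v \<noteq> ?p2 v" using d w(2) by simp
        from transversal_upd[OF t2 n(2) v(1) p' this y(1) y2] have t3: "transversal V L ?p3"
          using yv2 by blast
        have c3: "circle_graph V (fund V L ?p3)"
          using d w(2) by (intro circle_graph_upd[OF t2 n(2) v(1) p' _ t3 c2]) auto
        show ?thesis
        proof (rule less.hyps[OF _ t3 n(3) t' p' c3])
          have "?D ?p3 \<subset> ?D p" using v w by auto
          then show "card (?D ?p3) < card (?D p)" using finD by (rule psubset_card_mono[rotated])
        qed
      qed
    qed
  qed
qed

section \<open>Chord diagrams\<close>

lemma cis_arc_connected: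
  assumes "p \<in> cis ` {s<..<t}" "q \<in> cis ` {s<..<t}" "cis ` {s<..<t} \<subseteq> S"
  shows "connected_component S p q"
  unfolding connected_component_def
proof (intro exI conjI)
  show "connected (cis ` {s<..<t})"
    by (intro connected_continuous_image continuous_intros) simp
qed (use assms in auto)

lemma cos_separates:
  assumes "0 < h" "h < pi"
  shows "\<bar>x\<bar> < h \<Longrightarrow> cos h < cos x" and "h < x \<Longrightarrow> x < 2 * pi - h \<Longrightarrow> cos x < cos h"
proof -
  show "cos h < cos x" if "\<bar>x\<bar> < h"
    using cos_monotone_0_pi[of "\<bar>x\<bar>" h] that assms by simp
  show "cos x < cos h" if x: "h < x" "x < 2 * pi - h"
  proof (cases "x \<le> pi")
    case True
    then show ?thesis using cos_monotone_0_pi[of h x] x assms by simp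
  next
    case False
    have "cos (2 * pi - x) < cos h" using cos_monotone_0_pi[of h "2 * pi - x"] x False assms by simp
    then show ?thesis by simp
  qed
qed

lemma cis_eq_iff_within:
  assumes "cis s = cis t" "\<bar>s - t\<bar> < 2 * pi" shows "s = t"
proof -
  have "cos s = cos t \<and> sin s = sin t" using assms(1) by (simp add: complex_eq_iff)
  then obtain n where n: "s = t + 2 * pi * real_of_int n" using sin_cos_eq_iff[of s t] by (auto simp: algebra_simps)
  then have "\<bar>2 * pi * real_of_int n\<bar> < 2 * pi * 1" using assms(2) by simp
  then have "\<bar>real_of_int n\<bar> < 1" unfolding abs_mult by (simp add: pi_gt_zero)
  then have "n = 0" by linarith
  then show ?thesis using n by simp
qed

text \<open>If the sides agree, an arc joins the two points. Otherwise the chord through the two removed points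
  separates them: the affine function \<open>g\<close>, which vanishes on this chord, has no zero on the rest of the circle.\<close>

lemma cut_circle_components:
  fixes a b s t :: real
  assumes ab: "0 \<le> a" "a < b" "b < 2 * pi" and s: "0 \<le> s" "s < 2 * pi" "s \<noteq> a" "s \<noteq> b"
    and t: "0 \<le> t" "t < 2 * pi" "t \<noteq> a" "t \<noteq> b"
  shows "connected_component (sphere 0 1 - {cis a, cis b}) (cis s) (cis t) \<longleftrightarrow>
    (a < s \<and> s < b \<longleftrightarrow> a < t \<and> t < b)"
proof
  let ?S = "sphere 0 1 - {cis a, cis b}"
  define m h where "m = (a + b) / 2" and "h = (b - a) / 2"
  have h: "0 < h" "h < pi" using ab unfolding h_def by auto
  define g where "g z = Re (z * cis (- m)) - cos h" for z
  have g_cis: "g (cis x) = cos (x - m) - cos h" for x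
    unfolding g_def cis_mult by simp
  have inside: "0 < g (cis x)" if "a < x" "x < b" for x
  proof -
    have "\<bar>x - m\<bar> < h" using that unfolding m_def h_def by (auto simp: abs_if field_simps)
    then show ?thesis using cos_separates(1)[OF h] g_cis by simp
  qed
  have outside': "g (cis x) < 0" if "b < x" "x < a + 2 * pi" for x
  proof -
    have "h < x - m" "x - m < 2 * pi - h" using that unfolding m_def h_def by (auto simp: field_simps)
    then show ?thesis using cos_separates(2)[OF h] g_cis by simp
  qed
  have outside: "g (cis x) < 0" if "0 \<le> x" "x < 2 * pi" "x < a \<or> b < x" for x
  proof (cases "b < x")
    case True
    then show ?thesis using outside'[of x] that ab by simp
  next
    case False
    have "cis (x + 2 * pi) = cis x" by (simp add: complex_eq_iff)
    then show ?thesis using outside'[of "x + 2 * pi"] that ab False by simp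
  qed
  have side: "0 < g (cis x) \<longleftrightarrow> a < x \<and> x < b" if "0 \<le> x" "x < 2 * pi" "x \<noteq> a" "x \<noteq> b" for x
    using inside[of x] outside[of x] that by fastforce
  have nz: "g z \<noteq> 0" if "z \<in> ?S" for z
  proof -
    have "norm z = 1" using that by simp
    then have "z = cis (Arg2pi z)" using Arg2pi_eq[of z] by (simp add: cis_conv_exp)
    then show ?thesis
      using inside[of "Arg2pi z"] outside[of "Arg2pi z"] Arg2pi_ge_0[of z] Arg2pi_lt_2pi[of z] that
      by (metis DiffD2 insertCI linorder_neqE_linordered_idom order_less_irrefl)
  qed
  assume "connected_component ?S (cis s) (cis t)"
  then obtain T where T: "connected T" "T \<subseteq> ?S" "cis s \<in> T" "cis t \<in> T"
    unfolding connected_component_def by blast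
  have "connected (g ` T)" unfolding g_def by (intro connected_continuous_image T continuous_intros)
  then have I: "is_interval (g ` T)" by (simp add: is_interval_connected_1)
  have "0 \<notin> g ` T" using nz T(2) by (metis imageE subsetD)
  moreover have "0 \<in> g ` T" if "x \<in> T" "y \<in> T" "g x < 0" "0 < g y" for x y
    using mem_is_interval_1_I[OF I, of "g x" "g y" 0] that by simp
  ultimately have "0 < g (cis s) \<longleftrightarrow> 0 < g (cis t)"
    using T nz by (metis linorder_neqE_linordered_idom subsetD)
  then show "a < s \<and> s < b \<longleftrightarrow> a < t \<and> t < b" using side s t by simp
next
  let ?S = "sphere 0 1 - {cis a, cis b}"
  assume eq: "a < s \<and> s < b \<longleftrightarrow> a < t \<and> t < b"
  show "connected_component ?S (cis s) (cis t)"
  proof (cases "a < s \<and> s < b")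
    case True
    have "cis x \<noteq> cis a \<and> cis x \<noteq> cis b" if "a < x" "x < b" for x
      using cis_eq_iff_within[of x a] cis_eq_iff_within[of x b] that ab by auto
    then have "cis ` {a<..<b} \<subseteq> ?S" by auto
    then show ?thesis using True eq by (intro cis_arc_connected[of _ a b]) auto
  next
    case False
    have "cis x \<noteq> cis a \<and> cis x \<noteq> cis b" if x: "b < x" "x < a + 2 * pi" for x
      using cis_eq_iff_within[of x a] cis_eq_iff_within[of x b] x ab by auto
    then have sub: "cis ` {b<..<a + 2 * pi} \<subseteq> ?S" by auto
    have "cis x \<in> cis ` {b<..<a + 2 * pi}" if "0 \<le> x" "x < 2 * pi" "x < a \<or> b < x" for x
    proof (cases "b < x")
      case True
      then show ?thesis using that ab by auto
    next
      case False
      have "cis x = cis (x + 2 * pi)" by (simp add: complex_eq_iff)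
      then show ?thesis using that ab False by (intro image_eqI) auto
    qed
    then show ?thesis using sub False eq s t by (intro cis_arc_connected[of _ b "a + 2 * pi"]) auto
  qed
qed

lemma linked_iff_crossing:
  assumes c: "c = {cis (e u False), cis (e u True)}" and d: "d = {cis (e v False), cis (e v True)}"
    and e: "\<And>b. 0 \<le> e u b \<and> e u b < 2 * pi" "\<And>b. 0 \<le> e v b \<and> e v b < 2 * pi"
    and ne: "\<And>b b'. e u b \<noteq> e v b'" "e u False \<noteq> e u True" "e v False \<noteq> e v True"
  shows "linked c d \<longleftrightarrow> crossing e u v"
proof -
  let ?S = "sphere 0 1 - c"
  have "linked c d \<longleftrightarrow> \<not> connected_component ?S (cis (e v False)) (cis (e v True))"
  proof
    assume "linked c d"
    then obtain p q where pq: "d = {p, q}" "\<not> connected_component ?S p q" unfolding linked_def by blast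
    then have "p = cis (e v False) \<and> q = cis (e v True) \<or> q = cis (e v False) \<and> p = cis (e v True)"
      unfolding d using cis_eq_iff_within[of "e v False" "e v True"] e(2) ne(3)
      by (auto simp: doubleton_eq_iff)
    then show "\<not> connected_component ?S (cis (e v False)) (cis (e v True))"
      using pq(2) connected_component_sym by blast
  next
    assume "\<not> connected_component ?S (cis (e v False)) (cis (e v True))"
    then show "linked c d" unfolding linked_def d by blast
  qed
  also have "\<dots> \<longleftrightarrow> crossing e u v"
  proof -
    have btw: "a < x \<and> x < b \<longleftrightarrow> (a < x) \<noteq> (b < x)" if "a < b" "x \<noteq> a" "x \<noteq> b" for a b x :: real
      using that by auto
    have c': "c = {cis (e u True), cis (e u False)}" unfolding c by (rule insert_commute)
    show ?thesis
    proof (cases "e u False < e u True")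
      case True
      have "connected_component ?S (cis (e v False)) (cis (e v True)) \<longleftrightarrow>
          (e u False < e v False \<and> e v False < e u True \<longleftrightarrow> e u False < e v True \<and> e v True < e u True)"
        unfolding c by (rule cut_circle_components) (use e True in \<open>simp_all add: ne(1)[symmetric]\<close>)
      then show ?thesis
        unfolding btw[OF True ne(1)[symmetric] ne(1)[symmetric]] crossing_def by blast
    next
      case False
      then have lt: "e u True < e u False" using ne(2) by simp
      have "connected_component ?S (cis (e v False)) (cis (e v True)) \<longleftrightarrow>
          (e u True < e v False \<and> e v False < e u False \<longleftrightarrow> e u True < e v True \<and> e v True < e u False)"
        unfolding c' by (rule cut_circle_components) (use e lt in \<open>simp_all add: ne(1)[symmetric]\<close>)
      then show ?thesis
        unfolding btw[OF lt ne(1)[symmetric] ne(1)[symmetric]] crossing_def by blast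
    qed
  qed
  finally show ?thesis .
qed

text \<open>The circle is cut open at angle 0.\<close>

theorem realisable_imp_circle_graph:
  assumes "realisable G" shows "circle_graph (verts G) (adj G)"
proof -
  obtain D f where D: "chord_diagram D" and f: "bij_betw f (verts G) D"
    and adj: "\<And>u v. u \<in> verts G \<Longrightarrow> v \<in> verts G \<Longrightarrow> u \<noteq> v \<Longrightarrow> adj G u v \<longleftrightarrow> linked (f u) (f v)"
    using assms unfolding realisable_def by blast
  have fD: "f v \<in> D" if "v \<in> verts G" for v using f that unfolding bij_betw_def by blast
  have "\<exists>ends :: bool \<Rightarrow> real. f v = {cis (ends False), cis (ends True)} \<and> ends False \<noteq> ends True \<and>
      (\<forall>b. 0 \<le> ends b \<and> ends b < 2 * pi)" if "v \<in> verts G" for v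
  proof -
    have "card (f v) = 2" "f v \<subseteq> sphere 0 1" using D fD[OF that] unfolding chord_diagram_def by auto
    then obtain p q where pq: "f v = {p, q}" "p \<noteq> q" by (meson card_2_iff)
    have c: "cis (Arg2pi z) = z" if "norm z = 1" for z
      using Arg2pi_eq[of z] that by (simp add: cis_conv_exp)
    have n: "norm p = 1" "norm q = 1" using pq \<open>f v \<subseteq> sphere 0 1\<close> by auto
    show ?thesis
      using pq c[OF n(1)] c[OF n(2)] Arg2pi_ge_0 Arg2pi_lt_2pi
      by (intro exI[of _ "\<lambda>b. if b then Arg2pi q else Arg2pi p"]) auto
  qed
  then obtain e :: "nat \<Rightarrow> bool \<Rightarrow> real" where e: "\<And>v. v \<in> verts G \<Longrightarrow> f v = {cis (e v False), cis (e v True)}"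
    "\<And>v. v \<in> verts G \<Longrightarrow> e v False \<noteq> e v True"
    "\<And>v b. v \<in> verts G \<Longrightarrow> 0 \<le> e v b \<and> e v b < 2 * pi" by metis
  have ne: "e u b \<noteq> e v b'" if "u \<in> verts G" "v \<in> verts G" "u \<noteq> v" for u v b b'
  proof
    assume eq: "e u b = e v b'"
    have "cis (e u b) \<in> f u" "cis (e v b') \<in> f v" using e(1) that by (cases b; cases b'; simp)+
    then have "f u \<inter> f v \<noteq> {}" using eq by auto
    moreover have "f u \<noteq> f v" using f that unfolding bij_betw_def by (auto simp: inj_on_def)
    ultimately show False
      using D disjointD[of D "f u" "f v"] fD[OF that(1)] fD[OF that(2)] unfolding chord_diagram_def by blast
  qed
  have "inj_on (\<lambda>(v, b). e v b) (verts G \<times> UNIV)"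
  proof (rule inj_onI)
    fix x y assume xy: "x \<in> verts G \<times> (UNIV :: bool set)" "y \<in> verts G \<times> (UNIV :: bool set)"
      "(case x of (v, b) \<Rightarrow> e v b) = (case y of (v, b) \<Rightarrow> e v b)"
    obtain i b j c where ij: "x = (i, b)" "y = (j, c)" by (metis surj_pair)
    then have "i = j" using xy ne[of i j b c] by auto
    moreover have "b = c" using xy ij \<open>i = j\<close> e(2)[of j] by (cases b; cases c) auto
    ultimately show "x = y" using ij by simp
  qed
  moreover have "adj G u v \<longleftrightarrow> crossing e u v" if "u \<in> verts G" "v \<in> verts G" "u \<noteq> v" for u v
    unfolding adj[OF that] using that
    by (intro linked_iff_crossing e ne) auto
  ultimately show ?thesis unfolding circle_graph_def by blast
qed

section \<open>Adjacency matrices\<close>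

lemma bij_vertex_enum:
  assumes "finite (verts H)"
  shows "bij_betw (\<lambda>k. sorted_list_of_set (verts H) ! k) {0..<card (verts H)} (verts H)"
  using bij_betw_nth[of "sorted_list_of_set (verts H)" "{..<card (verts H)}" "verts H"] assms
  by (simp add: atLeast0LessThan)

lemma adj_matrix_entry:
  assumes H: "framed_simple_graph H" and kl: "k < card (verts H)" "l < card (verts H)"
  shows "adj_matrix H $$ (k, l) = entry H (sorted_list_of_set (verts H) ! k) (sorted_list_of_set (verts H) ! l)"
proof -
  have "finite (verts H)" using H unfolding framed_simple_graph_def by blast
  then have "sorted_list_of_set (verts H) ! k = sorted_list_of_set (verts H) ! l \<longleftrightarrow> k = l"
    using kl by (simp add: nth_eq_iff_index_eq)
  then show ?thesis using kl unfolding adj_matrix_def Let_def entry_def by simp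
qed

lemma adj_matrix_carrier: "adj_matrix H \<in> carrier_mat (card (verts H)) (card (verts H))"
  unfolding adj_matrix_def Let_def by simp

lemma adj_matrix_mult_vec:
  fixes H defines "n \<equiv> card (verts H)" and "vs \<equiv> sorted_list_of_set (verts H)"
  assumes H: "framed_simple_graph H" and k: "k < n" and y: "y \<in> carrier_vec n"
    and X: "\<And>l. l < n \<Longrightarrow> y $ l = X (vs ! l)"
  shows "((adj_matrix H + 1\<^sub>m n) *\<^sub>v y) $ k = (\<Sum>w\<in>verts H. entry H (vs ! k) w * X w) + X (vs ! k)"
proof -
  have fin: "finite (verts H)" using H unfolding framed_simple_graph_def by blast
  note c = adj_matrix_carrier[of H, folded n_def]
  have "((adj_matrix H + 1\<^sub>m n) *\<^sub>v y) $ k = (\<Sum>l\<in>{0..<n}. (adj_matrix H + 1\<^sub>m n) $$ (k, l) * y $ l)"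
    using k y c by (auto simp: scalar_prod_def row_def intro!: sum.cong)
  also have "\<dots> = (\<Sum>l\<in>{0..<n}. entry H (vs ! k) (vs ! l) * X (vs ! l) + (if l = k then X (vs ! k) else 0))"
  proof (rule sum.cong[OF refl])
    fix l assume "l \<in> {0..<n}"
    then have l: "l < n" by simp
    have "(adj_matrix H + 1\<^sub>m n) $$ (k, l) = entry H (vs ! k) (vs ! l) + (if k = l then 1 else 0)"
      using k l c adj_matrix_entry[OF H k[unfolded n_def] l[unfolded n_def]] by (simp add: vs_def)
    then show "(adj_matrix H + 1\<^sub>m n) $$ (k, l) * y $ l =
        entry H (vs ! k) (vs ! l) * X (vs ! l) + (if l = k then X (vs ! k) else 0)"
      using X[OF l] by (simp add: algebra_simps)
  qed
  also have "\<dots> = (\<Sum>l\<in>{0..<n}. entry H (vs ! k) (vs ! l) * X (vs ! l)) + X (vs ! k)"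
    using k by (simp add: sum.distrib)
  also have "(\<Sum>l\<in>{0..<n}. entry H (vs ! k) (vs ! l) * X (vs ! l)) = (\<Sum>w\<in>verts H. entry H (vs ! k) w * X w)"
    unfolding n_def vs_def using sum.reindex_bij_betw[OF bij_vertex_enum[OF fin]] .
  finally show ?thesis .
qed

lemma corank_eq_0_iff:
  assumes "M \<in> carrier_mat n n"
  shows "corank M = 0 \<longleftrightarrow> det M \<noteq> 0"
proof -
  have "vec_space.rank n M \<le> n" using vec_space.rank_le_nc[OF assms] by simp
  then show ?thesis using vec_space.det_rank_iff[OF assms] assms unfolding corank_def by auto
qed

text \<open>A vector in the kernel of \<open>A + E\<close> is the first component of a vector of the space with \<open>A X = X\<close>,
  that is, with all entries in \<open>{0, ds}\<close>.\<close>

lemma corank_iff_transversal: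
  assumes H: "framed_simple_graph H"
  shows "corank (adj_matrix H + 1\<^sub>m (card (verts H))) = 0 \<longleftrightarrow>
    transversal (verts H) (graph_space H) (\<lambda>_. ds)"
proof -
  define n where "n = card (verts H)"
  define vs where "vs = sorted_list_of_set (verts H)"
  let ?M = "adj_matrix H + 1\<^sub>m n"
  have fin: "finite (verts H)" using H unfolding framed_simple_graph_def by blast
  have M: "?M \<in> carrier_mat n n" using adj_matrix_carrier[of H] unfolding n_def by simp
  have bij: "bij_betw (\<lambda>k. vs ! k) {0..<n} (verts H)" unfolding vs_def n_def by (rule bij_vertex_enum[OF fin])
  note mult = adj_matrix_mult_vec[OF H, folded n_def vs_def]
  have onto: "\<exists>k<n. v = vs ! k" if "v \<in> verts H" for v
    using bij that unfolding bij_betw_def by (metis atLeastLessThan_iff imageE)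
  have mem: "vs ! k \<in> verts H" if "k < n" for k using bij that by (auto dest: bij_betwE)
  have "det ?M \<noteq> 0 \<longleftrightarrow> transversal (verts H) (graph_space H) (\<lambda>_. ds)"
  proof
    assume d: "det ?M \<noteq> 0"
    show "transversal (verts H) (graph_space H) (\<lambda>_. ds)"
      unfolding transversal_def
    proof (intro ballI impI)
      fix x assume x: "x \<in> graph_space H" "aligned (\<lambda>_. ds) (verts H) x"
      let ?y = "Matrix.vec n (\<lambda>k. fst (x (vs ! k)))"
      have y: "?y \<in> carrier_vec n" by simp
      have "?M *\<^sub>v ?y = 0\<^sub>v n"
      proof (rule eq_vecI)
        fix k assume "k < dim_vec (0\<^sub>v n :: bit Matrix.vec)"
        then have k: "k < n" by simp
        have "x (vs ! k) = 0 \<or> x (vs ! k) = ds" using x(2) mem[OF k] unfolding aligned_def by blast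
        then have "snd (x (vs ! k)) + fst (x (vs ! k)) = 0" by auto
        then show "(?M *\<^sub>v ?y) $ k = 0\<^sub>v n $ k"
          using mult[OF k y, of "\<lambda>v. fst (x v)"] graph_space_snd[OF x(1) mem[OF k]] k by simp
      qed (use M in simp)
      then have y0: "?y = 0\<^sub>v n" using d det_0_iff_vec_prod_zero[OF M] y by blast
      show "x = (\<lambda>_. 0)"
      proof
        fix v
        show "x v = 0"
        proof (cases "v \<in> verts H")
          case True
          then obtain k where k: "k < n" "v = vs ! k" using onto by blast
          then have "fst (x v) = ?y $ k" by simp
          then have "fst (x v) = 0" unfolding y0 using k by simp
          then show ?thesis using x(2) True unfolding aligned_def by auto
        qed (rule graph_space_off[OF x(1)])
      qed
    qed
  next
    assume t: "transversal (verts H) (graph_space H) (\<lambda>_. ds)"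
    show "det ?M \<noteq> 0"
    proof
      assume "det ?M = 0"
      then obtain y where y: "y \<in> carrier_vec n" "y \<noteq> 0\<^sub>v n" "?M *\<^sub>v y = 0\<^sub>v n"
        using det_0_iff_vec_prod_zero[OF M] by blast
      define X where "X v = y $ (inv_into {0..<n} (\<lambda>k. vs ! k) v)" for v
      have X: "y $ k = X (vs ! k)" if "k < n" for k
        using bij_betw_inv_into_left[OF bij, of k] that unfolding X_def by simp
      let ?x = "graph_vec H X"
      have "aligned (\<lambda>_. ds) (verts H) ?x"
        unfolding aligned_def
      proof
        fix v assume v: "v \<in> verts H"
        then obtain k where k: "k < n" "v = vs ! k" using onto by blast
        have "(\<Sum>w\<in>verts H. entry H v w * X w) + X v = 0"
          using mult[OF k(1) y(1) X] y(3) k by simp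
        then have "(\<Sum>w\<in>verts H. entry H v w * X w) = X v"
          by (cases "X v"; cases "\<Sum>w\<in>verts H. entry H v w * X w") simp_all
        then have "?x v = (X v, X v)" using v unfolding graph_vec_def by simp
        then show "?x v = 0 \<or> ?x v = ds" by (cases "X v") (simp_all add: zero_prod_def)
      qed
      then have x0: "?x = (\<lambda>_. 0)" using t graph_vec_mem unfolding transversal_def by blast
      have "y = 0\<^sub>v n"
      proof (rule eq_vecI)
        fix k assume "k < dim_vec (0\<^sub>v n :: bit Matrix.vec)"
        then have k: "k < n" by simp
        have "fst (?x (vs ! k)) = X (vs ! k)" using mem[OF k] unfolding graph_vec_def by simp
        then show "y $ k = 0\<^sub>v n $ k" using X[OF k] k unfolding x0 by simp
      qed (use y in simp)
      then show False using y(2) by blast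
    qed
  qed
  then show ?thesis using corank_eq_0_iff[OF M] unfolding n_def by simp
qed

section \<open>Consequences of a non-vanishing bracket\<close>

lemma bracket_imp_W5_minor:
  assumes H: "framed_simple_graph H" and b: "parity_bracket (verts H) (graph_space H)"
  obtains p f where "transversal (verts H) (graph_space H) p" "\<And>t. p t \<noteq> 0"
    "inj_on f (verts W5)" "f ` verts W5 \<subseteq> verts H"
    "\<And>i j. i \<in> verts W5 \<Longrightarrow> j \<in> verts W5 \<Longrightarrow> i \<noteq> j \<Longrightarrow>
      fund (verts H) (graph_space H) p (f i) (f j) \<longleftrightarrow> adj W5 i j"
proof -
  let ?V = "verts H" and ?L = "graph_space H"
  let ?S = "evens ?V ?L"
  have "\<exists>p. p \<in> states ?S \<and> alive ?V ?L ?S p"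
  proof (rule ccontr)
    assume "\<not> ?thesis"
    then have "count_states ?S (alive ?V ?L ?S) = 0" by (intro count_states_0) blast
    then show False using b unfolding parity_bracket_def by simp
  qed
  then obtain p where p: "p \<in> states ?S" "transversal ?V ?L p" "reduces_to_W5 (?V - ?S) (fund ?V ?L p)"
    unfolding alive_def by blast
  obtain f where "inj_on f (verts W5)" "f ` verts W5 \<subseteq> ?V - ?S"
    "\<And>i j. i \<in> verts W5 \<Longrightarrow> j \<in> verts W5 \<Longrightarrow> i \<noteq> j \<Longrightarrow> fund ?V ?L p (f i) (f j) \<longleftrightarrow> adj W5 i j"
    by (rule reduces_imp_embedding[OF p(3)]) blast
  then show thesis using that[OF p(2) states_neq_0[OF p(1)]] by blast
qed

lemma bracket_imp_card:
  assumes "framed_simple_graph H" "parity_bracket (verts H) (graph_space H)"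
  shows "6 \<le> card (verts H)"
proof -
  obtain p f where f: "inj_on f (verts W5)" "f ` verts W5 \<subseteq> verts H"
    by (rule bracket_imp_W5_minor[OF assms])
  have "finite (verts H)" using assms unfolding framed_simple_graph_def by blast
  then have "card (verts W5) \<le> card (verts H)" using card_inj_on_le[OF f] by simp
  then show ?thesis by (simp add: W5_def)
qed

lemma fund_db_eq_adj:
  assumes H: "framed_simple_graph H" and ij: "i \<in> verts H" "j \<in> verts H" "i \<noteq> j"
  shows "fund (verts H) (graph_space H) (\<lambda>_. db) i j \<longleftrightarrow> adj H i j"
proof -
  interpret isotropic_system "verts H" "graph_space H" by (rule graph_space_isotropic[OF H])
  let ?x = "graph_vec H (\<lambda>v. of_bool (v = i))"
  have x: "?x v = (of_bool (v = i), entry H v i)" if "v \<in> verts H" for v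
    using that ij(1) fin unfolding graph_vec_def by (simp add: of_bool_def if_distrib cong: if_cong)
  have "fundamental (\<lambda>_. db) (verts H) i ?x"
    unfolding fundamental_def aligned_def
  proof (intro conjI ballI)
    show "?x i \<noteq> 0" "?x i \<noteq> db" using x[OF ij(1)] by (simp_all add: zero_prod_def)
    fix v assume "v \<in> verts H - {i}"
    then show "?x v = 0 \<or> ?x v = db" using x[of v] by (cases "entry H v i") (simp_all add: zero_prod_def)
  qed
  then have "fund (verts H) (graph_space H) (\<lambda>_. db) i j \<longleftrightarrow> ?x j \<noteq> 0"
    by (intro fund_iff graph_space_db_free graph_vec_mem) simp_all
  also have "\<dots> \<longleftrightarrow> entry H j i = 1" using x[OF ij(2)] ij(3) by (simp add: zero_prod_def)
  also have "\<dots> \<longleftrightarrow> adj H i j" using ij(3) H unfolding entry_def framed_simple_graph_def by auto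
  finally show ?thesis .
qed

text \<open>The graph \<open>H\<close> belongs to the constant choice \<open>db\<close>, which is transversal, and \<open>W5\<close> is an induced subgraph of
  the graph of another transversal choice.\<close>

lemma bracket_imp_not_realisable:
  assumes H: "framed_simple_graph H" and b: "parity_bracket (verts H) (graph_space H)"
  shows "\<not> realisable H"
proof
  assume "realisable H"
  then have c: "circle_graph (verts H) (adj H)" by (rule realisable_imp_circle_graph)
  interpret isotropic_system "verts H" "graph_space H" by (rule graph_space_isotropic[OF H])
  obtain p f where p: "transversal (verts H) (graph_space H) p" "\<And>t. p t \<noteq> 0"
    and f: "inj_on f (verts W5)" "f ` verts W5 \<subseteq> verts H"
      "\<And>i j. i \<in> verts W5 \<Longrightarrow> j \<in> verts W5 \<Longrightarrow> i \<noteq> j \<Longrightarrow>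
        fund (verts H) (graph_space H) p (f i) (f j) \<longleftrightarrow> adj W5 i j"
    by (rule bracket_imp_W5_minor[OF H b]) blast
  have "circle_graph (verts H) (fund (verts H) (graph_space H) (\<lambda>_. db))"
    by (rule circle_graph_cong[OF c]) (rule fund_db_eq_adj[OF H])
  then have "circle_graph (verts H) (fund (verts H) (graph_space H) p)"
    using circle_graph_gauge[OF graph_space_db_free _ p] by simp
  then have "circle_graph (verts W5) (adj W5)"
    by (rule circle_graph_image[OF _ f(1,2)]) (simp add: f(3))
  then show False using W5_not_circle_graph by blast
qed

section \<open>The free graph-knot of the wheel\<close>

lemma sum_upto_6:
  fixes h :: "nat \<Rightarrow> 'a :: comm_monoid_add"
  shows "sum h {0..<6} = h 0 + h 1 + h 2 + h 3 + h 4 + h 5"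
  by (simp add: eval_nat_numeral add.assoc)

lemma less_6_cases:
  assumes "i < (6 :: nat)"
  obtains "i = 0" | "i = 1" | "i = 2" | "i = 3" | "i = 4" | "i = 5"
  using assms by linarith

lemma adj_matrix_W5: "i < 6 \<Longrightarrow> j < 6 \<Longrightarrow> adj_matrix W5 $$ (i, j) = (if i = j then 0 else of_bool (adj W5 i j))"
  unfolding adj_matrix_def Let_def by (simp add: W5_def)

lemma framed_W5: "framed_simple_graph W5"
  unfolding framed_simple_graph_def W5_def by (auto, presburger)

lemma adj_W5:
  "adj W5 i j \<longleftrightarrow> i < 5 \<and> j < 5 \<and> (j = (i + 1) mod 5 \<or> i = (j + 1) mod 5) \<or> i < 5 \<and> j = 5 \<or> i = 5 \<and> j < 5"
  by (simp add: W5_def)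

text \<open>The equations of the kernel of the adjacency matrix of the wheel, with \<open>h\<close> at the hub.\<close>

lemma wheel_kernel:
  fixes a b c d e h :: bit
  assumes "b + e + h = 0" "a + c + h = 0" "b + d + h = 0" "c + e + h = 0" "a + d + h = 0" "a + b + c + d + e = 0"
  shows "a = 0 \<and> b = 0 \<and> c = 0 \<and> d = 0 \<and> e = 0 \<and> h = 0"
  using assms by (cases a; cases b; cases c; cases d; cases e; cases h) simp_all

lemma W5_matrix_adj_matrix: "W5_matrix (adj_matrix W5)"
  unfolding W5_matrix_def
proof (intro conjI allI impI refl)
  let ?A = "adj_matrix W5"
  show A: "?A \<in> carrier_mat 6 6" using adj_matrix_carrier[of W5] by (simp add: W5_def)
  show "transpose_mat ?A = ?A"
  proof (rule eq_matI)
    fix i j assume "i < dim_row ?A" "j < dim_col ?A"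
    then have "i < 6" "j < 6" using A by auto
    then show "transpose_mat ?A $$ (i, j) = ?A $$ (i, j)"
      using A framed_W5 unfolding framed_simple_graph_def by (auto simp: adj_matrix_W5)
  qed (use A in auto)
  have "det ?A \<noteq> 0"
  proof
    assume "det ?A = 0"
    then obtain y where y: "y \<in> carrier_vec 6" "y \<noteq> 0\<^sub>v 6" "?A *\<^sub>v y = 0\<^sub>v 6"
      using det_0_iff_vec_prod_zero[OF A] by blast
    have row: "(\<Sum>l\<in>{0..<6}. ?A $$ (k, l) * y $ l) = 0" if k: "k < 6" for k
    proof -
      have "(?A *\<^sub>v y) $ k = (\<Sum>l\<in>{0..<6}. ?A $$ (k, l) * y $ l)"
        using k y(1) A by (simp add: scalar_prod_def row_def)
      then show ?thesis using y(3) k by simp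
    qed
    have r0: "y $ 1 + y $ 4 + y $ 5 = 0"
      using row[of 0] unfolding sum_upto_6 by (simp add: adj_matrix_W5 adj_W5 del: One_nat_def)
    have r1: "y $ 0 + y $ 2 + y $ 5 = 0"
      using row[of 1] unfolding sum_upto_6 by (simp add: adj_matrix_W5 adj_W5 del: One_nat_def)
    have r2: "y $ 1 + y $ 3 + y $ 5 = 0"
      using row[of 2] unfolding sum_upto_6 by (simp add: adj_matrix_W5 adj_W5 del: One_nat_def)
    have r3: "y $ 2 + y $ 4 + y $ 5 = 0"
      using row[of 3] unfolding sum_upto_6 by (simp add: adj_matrix_W5 adj_W5 del: One_nat_def)
    have r4: "y $ 0 + y $ 3 + y $ 5 = 0"
      using row[of 4] unfolding sum_upto_6 by (simp add: adj_matrix_W5 adj_W5 del: One_nat_def)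
    have r5: "y $ 0 + y $ 1 + y $ 2 + y $ 3 + y $ 4 = 0"
      using row[of 5] unfolding sum_upto_6 by (simp add: adj_matrix_W5 adj_W5 del: One_nat_def)
    have "y $ 0 = 0 \<and> y $ 1 = 0 \<and> y $ 2 = 0 \<and> y $ 3 = 0 \<and> y $ 4 = 0 \<and> y $ 5 = 0"
      by (rule wheel_kernel) (fact r0 r1 r2 r3 r4 r5)+
    then have "y = 0\<^sub>v 6" using y(1) by (intro eq_vecI) (auto elim!: less_6_cases simp del: One_nat_def)
    then show False using y(2) by blast
  qed
  then show "det ?A = 1" by simp
qed

text \<open>The columns of \<open>A\<close> are the first components of the fundamental vectors for the straight directions: if
  \<open>X\<close> is column \<open>i\<close> then \<open>(A(G) + E) X = B X\<close> is the \<open>i\<close>-th unit vector. So the Gauss diagram is \<open>W5\<close>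
  whatever the diagonal of \<open>A\<close> is.\<close>

lemma wheel_bracket:
  assumes A: "W5_matrix A" and B: "B \<in> carrier_mat 6 6" "inverts_mat B A"
    and G: "framed_simple_graph G" and GB: "adj_matrix G = B + 1\<^sub>m 6"
  shows "transversal (verts G) (graph_space G) (\<lambda>_. ds)" and "parity_bracket (verts G) (graph_space G)"
proof -
  interpret isotropic_system "verts G" "graph_space G" by (rule graph_space_isotropic[OF G])
  have Ac: "A \<in> carrier_mat 6 6" and Aij: "\<And>i j. i < 6 \<Longrightarrow> j < 6 \<Longrightarrow> i \<noteq> j \<Longrightarrow> A $$ (i, j) = of_bool (adj W5 i j)"
    using A unfolding W5_matrix_def by (auto simp: adj_matrix_W5)
  have BA: "B * A = 1\<^sub>m 6" using B unfolding inverts_mat_def by simp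
  have n: "card (verts G) = 6"
    using adj_matrix_carrier[of G] B(1) unfolding GB by auto
  have M: "adj_matrix G + 1\<^sub>m 6 = B"
    unfolding GB using B(1) by (intro eq_matI) (auto simp: add.assoc)
  have "det B * det A = 1" using det_mult[OF B(1) Ac] BA by simp
  then have "det B \<noteq> 0" by (cases "det B") simp_all
  then have "corank (adj_matrix G + 1\<^sub>m (card (verts G))) = 0"
    unfolding n M using corank_eq_0_iff[OF B(1)] by simp
  then show k: knot using corank_iff_transversal[OF G] by simp
  define vs where "vs = sorted_list_of_set (verts G)"
  have bij: "bij_betw (\<lambda>k. vs ! k) {0..<6} (verts G)"
    using bij_vertex_enum[OF fin] unfolding vs_def n .
  have vs_eq: "vs ! i = vs ! j \<longleftrightarrow> i = j" if "i < 6" "j < 6" for i j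
    using bij that unfolding bij_betw_def by (auto simp: inj_on_def)
  have mem: "vs ! i \<in> verts G" if "i < 6" for i using bij that by (auto dest: bij_betwE)
  define X where "X i v = A $$ (inv_into {0..<6} (\<lambda>k. vs ! k) v, i)" for i v
  have X: "X i (vs ! j) = A $$ (j, i)" if "j < 6" for i j
    using bij_betw_inv_into_left[OF bij, of j] that unfolding X_def by simp
  define x where "x i = graph_vec G (X i)" for i
  have xv: "x i (vs ! j) = (A $$ (j, i), A $$ (j, i) + of_bool (j = i))" if ij: "i < 6" "j < 6" for i j
  proof -
    have c: "col A i \<in> carrier_vec 6" using Ac by (intro carrier_vecI) simp
    have "((adj_matrix G + 1\<^sub>m 6) *\<^sub>v col A i) $ j = (\<Sum>w\<in>verts G. entry G (vs ! j) w * X i w) + X i (vs ! j)"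
      using adj_matrix_mult_vec[OF G, unfolded n, folded vs_def, OF ij(2) c, of "X i"] X Ac ij by simp
    moreover have "((adj_matrix G + 1\<^sub>m 6) *\<^sub>v col A i) $ j = (B * A) $$ (j, i)"
      unfolding M using B(1) Ac ij by simp
    moreover have "(B * A) $$ (j, i) = of_bool (j = i)" unfolding BA using ij by simp
    ultimately have "(\<Sum>w\<in>verts G. entry G (vs ! j) w * X i w) + X i (vs ! j) = of_bool (j = i)"
      by (simp only:)
    then have "(\<Sum>w\<in>verts G. entry G (vs ! j) w * X i w) = A $$ (j, i) + of_bool (j = i)"
      unfolding X[OF ij(2)]
      by (cases "\<Sum>w\<in>verts G. entry G (vs ! j) w * X i w"; cases "A $$ (j, i)"; cases "j = i") simp_all
    then show ?thesis using mem[OF ij(2)] X[OF ij(2)] unfolding x_def graph_vec_def by simp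
  qed
  have onto: "\<exists>k<6. v = vs ! k" if "v \<in> verts G" for v
    using bij that unfolding bij_betw_def by (metis atLeastLessThan_iff imageE)
  have fx: "x i \<in> graph_space G" "fundamental (\<lambda>_. ds) (verts G) (vs ! i) (x i)" if i: "i < 6" for i
  proof -
    show "x i \<in> graph_space G" unfolding x_def by (rule graph_vec_mem)
    show "fundamental (\<lambda>_. ds) (verts G) (vs ! i) (x i)"
      unfolding fundamental_def aligned_def
    proof (intro conjI ballI)
      show "x i (vs ! i) \<noteq> 0" "x i (vs ! i) \<noteq> ds"
        using xv[OF i i] by (cases "A $$ (i, i)"; simp add: zero_prod_def)+
      fix v assume v: "v \<in> verts G - {vs ! i}"
      then obtain j where j: "j < 6" "v = vs ! j" using onto by blast
      then have "j \<noteq> i" using v by auto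
      then show "x i v = 0 \<or> x i v = ds" using xv[OF i j(1)] j(2) by (cases "A $$ (j, i)") (simp_all add: zero_prod_def)
    qed
  qed
  have fu: "fund (verts G) (graph_space G) (\<lambda>_. ds) (vs ! i) (vs ! j) \<longleftrightarrow> adj W5 i j"
    if ij: "i < 6" "j < 6" "i \<noteq> j" for i j
    using fund_iff[OF k ds_neq fx[OF ij(1)]] xv[OF ij(1,2)] ij Aij[of j i] framed_W5
    unfolding framed_simple_graph_def by (auto simp: zero_prod_def)
  have "vs ! i \<notin> evens (verts G) (graph_space G)" if i: "i < 6" for i
  proof -
    have "q (x i) = (\<Sum>j\<in>{0..<6}. quad (x i (vs ! j)))"
      unfolding q_def using sum.reindex_bij_betw[OF bij, of "\<lambda>v. quad (x i v)"] by simp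
    also have "\<dots> = (\<Sum>j\<in>{0..<6}. if j = i then 0 else of_bool (adj W5 j i))"
    proof (rule sum.cong[OF refl])
      fix j assume "j \<in> {0..<6::nat}"
      then have j: "j < 6" by simp
      show "quad (x i (vs ! j)) = (if j = i then 0 else of_bool (adj W5 j i))"
        using xv[OF i j] Aij[OF j i] by (cases "A $$ (i, i)") (auto simp: quad_def)
    qed
    also have "\<dots> = 1"
      unfolding sum_upto_6 using i by (rule less_6_cases) (simp_all add: W5_def)
    finally show ?thesis using evens_iff[OF k fx[OF i] mem[OF i]] by simp
  qed
  then have ev: "evens (verts G) (graph_space G) = {}"
    using onto unfolding evens_def by blast
  have "reduces_to_W5 (verts G) (fund (verts G) (graph_space G) (\<lambda>_. ds))"
  proof (rule reduces_to_W5.iso)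
    have W: "verts W5 = {0..<6}" by (simp add: W5_def)
    show "bij_betw (\<lambda>k. vs ! k) (verts W5) (verts G)" unfolding W by (rule bij)
    show "fund (verts G) (graph_space G) (\<lambda>_. ds) (vs ! i) (vs ! j) \<longleftrightarrow> adj W5 i j"
      if "i \<in> verts W5" "j \<in> verts W5" "i \<noteq> j" for i j
      using fu that unfolding W by simp
  qed
  then have "{p \<in> states {}. alive (verts G) (graph_space G) {} p} = {\<lambda>_. ds}"
    using k unfolding states_empty alive_def by auto
  then show "parity_bracket (verts G) (graph_space G)" unfolding parity_bracket_def ev count_states_def by simp
qed

theorem corollary3p1:
  shows "(\<exists>A. W5_matrix A) \<and>
    (\<forall>A B G. W5_matrix A \<and> B \<in> carrier_mat 6 6 \<and> inverts_mat A B \<and> inverts_mat B A \<and>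
        framed_simple_graph G \<and> adj_matrix G = B + 1\<^sub>m 6 \<longrightarrow>
      free_graph_knot (free_graph_link G) \<and>
      (\<forall>H \<in> free_graph_link G. 6 \<le> card (verts H)) \<and>
      empty_graph \<notin> free_graph_link G \<and>
      (\<forall>H \<in> free_graph_link G. \<not> realisable H))"
proof (intro conjI allI impI)
  show "\<exists>A. W5_matrix A" using W5_matrix_adj_matrix by blast
next
  fix A B G
  assume "W5_matrix A \<and> B \<in> carrier_mat 6 6 \<and> inverts_mat A B \<and> inverts_mat B A \<and>
        framed_simple_graph G \<and> adj_matrix G = B + 1\<^sub>m 6"
  then have G: "framed_simple_graph G" and
    wheel: "transversal (verts G) (graph_space G) (\<lambda>_. ds)" "parity_bracket (verts G) (graph_space G)"
    using wheel_bracket[of A B G] by blast+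
  have inv: "framed_simple_graph H" "transversal (verts H) (graph_space H) (\<lambda>_. ds)"
      "parity_bracket (verts H) (graph_space H)" if "H \<in> free_graph_link G" for H
    using that wheel equivclp_same[of G H] unfolding free_graph_link_def same_invariants_def by blast+
  show "free_graph_knot (free_graph_link G)"
    unfolding free_graph_knot_def
  proof (intro conjI exI ballI)
    show "framed_simple_graph G" by (rule G)
    show "corank (adj_matrix H + 1\<^sub>m (card (verts H))) = 0" if "H \<in> free_graph_link G" for H
      using corank_iff_transversal inv that by blast
  qed (rule refl)
  show card: "\<forall>H\<in>free_graph_link G. 6 \<le> card (verts H)"
    using bracket_imp_card inv by blast
  show "empty_graph \<notin> free_graph_link G"
    using card by (auto simp: empty_graph_def)
  show "\<forall>H\<in>free_graph_link G. \<not> realisable H"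
    using bracket_imp_not_realisable inv by blast
qed

end
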